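(* The Efficient Dominating Set problem (given a graph $G$ and an integer $\ell$, decide whether $G$ has an efficient dominating set of size at most $\ell$) is fixed-parameter tractable when parameterized by $2ccvd(G)$; that is, it can be solved in time $f(2ccvd(G))\cdot |V(G)|^{O(1)}$ for some computable function $f$.
   Context: A set $D\subseteq V(G)$ is an efficient dominating set of $G$ if $|N[v]\cap D|=1$ for every vertex $v$, where $N[v]$ is the closed neighborhood. A $2$-club is a graph in which every pair of vertices is at distance at most $2$. $2ccvd(G)$ (the 2-club cluster vertex deletion number) is the minimum $|S|$ over sets $S\subseteq V(G)$ such that every connected component of $G-S$ is a $2$-club. *)

theory Defs
  imports Main "Graph_Theory.Digraph_Component" "Graph_Theory.Shortest_Path"
begin

section \<open>Graphs\<close>

text \<open>
  A finite simple undirected graph is a \<^locale>\<open>pair_graph\<close>: finitely many vertices, and a symmetric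
  loop-free set of arcs, each edge being represented by its two orientations.
\<close>

definition closed_nbhd :: "('a,'b) pre_digraph \<Rightarrow> 'a \<Rightarrow> 'a set" where
  "closed_nbhd G v = insert v {u. v \<rightarrow>\<^bsub>G\<^esub> u}"

definition efficient_dominating_set :: "('a,'b) pre_digraph \<Rightarrow> 'a set \<Rightarrow> bool" where
  "efficient_dominating_set G D \<longleftrightarrow>
     D \<subseteq> verts G \<and> (\<forall>v \<in> verts G. card (closed_nbhd G v \<inter> D) = 1)"

definition graph_dist :: "('a,'b) pre_digraph \<Rightarrow> 'a \<Rightarrow> 'a \<Rightarrow> ereal" where
  "graph_dist G u v = wf_digraph.\<mu> G (\<lambda>_. 1) u v"

definition two_club :: "('a,'b) pre_digraph \<Rightarrow> bool" where
  "two_club G \<longleftrightarrow> (\<forall>u \<in> verts G. \<forall>v \<in> verts G. graph_dist G u v \<le> 2)"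

text \<open>
  In a symmetric graph the elements of \<^const>\<open>pre_digraph.sccs\<close> are the connected components, as
  induced subgraphs. Distances are therefore taken inside the component.
\<close>

definition two_club_deletion_set :: "('a,'b) pre_digraph \<Rightarrow> 'a set \<Rightarrow> bool" where
  "two_club_deletion_set G S \<longleftrightarrow>
     S \<subseteq> verts G \<and> (\<forall>C \<in> pre_digraph.sccs (G \<restriction> (verts G - S)). two_club C)"

text \<open>The set of all vertices is a deletion set, so the least value exists for a finite graph.\<close>

definition two_ccvd :: "('a,'b) pre_digraph \<Rightarrow> nat" where
  "two_ccvd G = (LEAST k. \<exists>S. two_club_deletion_set G S \<and> card S = k)"


section \<open>Random access machines\<close>

text \<open>
  The machine model is the unit-cost random access machine with addition and truncated subtraction,
  with programs in structured form. A state consists of the registers and of the memory, both holding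
  natural numbers. There is deliberately no multiplication: numbers then grow by only a constant
  number of bits per step, and running times agree with those of Turing machines up to a polynomial.
  \<open>Load a\<close> is the content of the memory cell whose address is the value of \<open>a\<close>.
\<close>

type_synonym state = "(nat \<Rightarrow> nat) \<times> (nat \<Rightarrow> nat)"

datatype aexp = Const nat | Reg nat | Load aexp | Plus aexp aexp | Minus aexp aexp

datatype bexp = Less aexp aexp | Neg bexp | Conj bexp bexp

datatype com =
    Skip
  | Assign nat aexp
  | Store aexp aexp
  | Seq com com
  | Ite bexp com com
  | While bexp com

fun aval :: "aexp \<Rightarrow> state \<Rightarrow> nat" where
  "aval (Const k) s = k"
| "aval (Reg x) s = fst s x"
| "aval (Load a) s = snd s (aval a s)"
| "aval (Plus a b) s = aval a s + aval b s"
| "aval (Minus a b) s = aval a s - aval b s"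

fun bval :: "bexp \<Rightarrow> state \<Rightarrow> bool" where
  "bval (Less a b) s = (aval a s < aval b s)"
| "bval (Neg b) s = (\<not> bval b s)"
| "bval (Conj b c) s = (bval b s \<and> bval c s)"

fun acost :: "aexp \<Rightarrow> nat" where
  "acost (Const k) = 1"
| "acost (Reg x) = 1"
| "acost (Load a) = acost a + 1"
| "acost (Plus a b) = acost a + acost b + 1"
| "acost (Minus a b) = acost a + acost b + 1"

fun bcost :: "bexp \<Rightarrow> nat" where
  "bcost (Less a b) = acost a + acost b + 1"
| "bcost (Neg b) = bcost b + 1"
| "bcost (Conj b c) = bcost b + bcost c + 1"

text \<open>\<open>exec c s t s'\<close>: started in \<open>s\<close>, the program \<open>c\<close> halts in \<open>s'\<close> after \<open>t\<close> steps.\<close>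

inductive exec :: "com \<Rightarrow> state \<Rightarrow> nat \<Rightarrow> state \<Rightarrow> bool" where
  Skip: "exec Skip s 1 s"
| Assign: "exec (Assign x a) s (acost a + 1) ((fst s)(x := aval a s), snd s)"
| Store: "exec (Store a b) s (acost a + acost b + 1) (fst s, (snd s)(aval a s := aval b s))"
| Seq: "exec c1 s t1 s1 \<Longrightarrow> exec c2 s1 t2 s2 \<Longrightarrow> exec (Seq c1 c2) s (t1 + t2) s2"
| IfTrue: "bval b s \<Longrightarrow> exec c1 s t s' \<Longrightarrow> exec (Ite b c1 c2) s (bcost b + t) s'"
| IfFalse: "\<not> bval b s \<Longrightarrow> exec c2 s t s' \<Longrightarrow> exec (Ite b c1 c2) s (bcost b + t) s'"
| WhileFalse: "\<not> bval b s \<Longrightarrow> exec (While b c) s (bcost b) s"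
| WhileTrue: "bval b s \<Longrightarrow> exec c s t1 s1 \<Longrightarrow> exec (While b c) s1 t2 s2 \<Longrightarrow>
    exec (While b c) s (bcost b + t1 + t2) s2"

inductive_cases SkipE: "exec Skip s t s'"
inductive_cases AssignE: "exec (Assign x a) s t s'"
inductive_cases StoreE: "exec (Store a b) s t s'"
inductive_cases SeqE: "exec (Seq c1 c2) s t s'"
inductive_cases IfE: "exec (Ite b c1 c2) s t s'"
inductive_cases WhileE: "exec (While b c) s t s'"

lemma exec_deterministic:
  "exec c s t s' \<Longrightarrow> exec c s u s'' \<Longrightarrow> t = u \<and> s' = s''"
proof (induction arbitrary: u s'' rule: exec.induct)
  case (Skip s)
  from Skip show ?case by (rule SkipE) auto
next
  case (Assign x a s)
  from Assign show ?case by (rule AssignE) auto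
next
  case (Store a b s)
  from Store show ?case by (rule StoreE) auto
next
  case (Seq c1 s t1 s1 c2 t2 s2)
  from Seq.prems show ?case by (rule SeqE) (use Seq.IH in blast)
next
  case (IfTrue b s c1 t s' c2)
  from IfTrue.prems show ?case by (rule IfE) (use IfTrue.IH IfTrue.hyps in blast)+
next
  case (IfFalse b s c2 t s' c1)
  from IfFalse.prems show ?case by (rule IfE) (use IfFalse.IH IfFalse.hyps in blast)+
next
  case (WhileFalse b s c)
  from WhileFalse.prems show ?case by (rule WhileE) (use WhileFalse.hyps in blast)+
next
  case (WhileTrue b s c t1 s1 t2 s2)
  from WhileTrue.prems show ?case by (rule WhileE) (use WhileTrue.IH WhileTrue.hyps in blast)+
qed

text \<open>The input is the initial memory content and the output is the final content of cell 0.\<close>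

definition halts_within :: "com \<Rightarrow> (nat \<Rightarrow> nat) \<Rightarrow> nat \<Rightarrow> nat \<Rightarrow> bool" where
  "halts_within P inp T out \<longleftrightarrow>
     (\<exists>t s. exec P (\<lambda>_. 0, inp) t s \<and> t \<le> T \<and> snd s 0 = out)"

definition computable :: "(nat \<Rightarrow> nat) \<Rightarrow> bool" where
  "computable f \<longleftrightarrow> (\<exists>P. \<forall>k. \<exists>T. halts_within P ((\<lambda>_. 0)(0 := k)) T (f k))"

definition decides_within :: "com \<Rightarrow> (nat \<Rightarrow> nat) \<Rightarrow> nat \<Rightarrow> bool \<Rightarrow> bool" where
  "decides_within P inp T answer \<longleftrightarrow> halts_within P inp T (if answer then 1 else 0)"

text \<open>
  Encoding of a graph with vertices \<open>0, \<dots>, n - 1\<close> and an integer \<open>l\<close>: cell 0 holds \<open>n\<close>, cell 1 holds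
  \<open>\<bar>l\<bar>\<close>, cell 2 holds 1 if \<open>l\<close> is negative, and the cells from 3 on hold the adjacency matrix row by
  row. All remaining cells are 0.
\<close>

definition encode_instance :: "nat \<Rightarrow> (nat,'b) pre_digraph \<Rightarrow> int \<Rightarrow> nat \<Rightarrow> nat" where
  "encode_instance n G l a =
     (if a = 0 then n
      else if a = 1 then nat \<bar>l\<bar>
      else if a = 2 then (if l < 0 then 1 else 0)
      else if a - 3 < n * n then
        (if ((a - 3) div n) \<rightarrow>\<^bsub>G\<^esub> ((a - 3) mod n) then 1 else 0)
      else 0)"

end

theory Submission
  imports Defs
begin

text \<open>
  Let \<open>S\<close> be a set such that the components of \<open>G - S\<close> are 2-clubs. It is found by a search tree: if
  some component of \<open>G - S\<close> is not a 2-club, then it contains a path \<open>a b c d\<close> with \<open>a\<close> and \<open>d\<close> at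
  distance 3, and every solution must delete one of its four vertices. Every word over 8 letters of
  length \<open>k\<close> describes a branch of this tree together with the trace \<open>H\<close> of the dominating set on \<open>S\<close>.

  Once \<open>S\<close> and \<open>H\<close> are fixed, an efficient dominating set \<open>D\<close> has at most one vertex in each component of
  \<open>G - S\<close>, and components interact only through \<open>S\<close>. With weights \<open>2 ^ k + 2 ^ j\<close> on \<open>S\<close>, the vertices of
  \<open>S\<close> not dominated by \<open>H\<close> are dominated exactly once by \<open>D - S\<close>, and no others are, if and only if the
  total weight of the neighbours of \<open>D - S\<close> in \<open>S\<close> is the weight of that set of vertices. So one has
  to solve a subset sum problem with one choice per component and a target below \<open>8 ^ k\<close>.

  The search is run for \<open>k = 0, 1, 2, \<dots>\<close> until a set \<open>S\<close> is found. It is written in a language with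
  bounded loops only, whose programs denote total functions and whose running time is
  polynomial in the largest loop bound \<open>n + 8 ^ k\<close>.
\<close>

section \<open>A loop language and its compilation\<close>

text \<open>Several chosen vertices may be adjacent to the same vertex of \<open>S\<close>, so
  weights occur with multiplicity, and with plain powers of 2 two copies of one weight could pass
  for the next weight. The common offset \<open>2 ^ k\<close> excludes this: it counts the summands,
  and a carry always merges two summands into one, so an equal total leaves no room for carries. No
  table entry records a size. Once \<open>S\<close> and \<open>H\<close> are fixed, a component
  receives a vertex exactly if \<open>H\<close> leaves one of its vertices undominated, so all
  solutions with this trace have the same cardinality. The 8 letters are 4 vertices of a path times
  2 choices for the trace. The parameter itself is never computed. The search stops at the least
  size of a set that meets all such paths; this size is at most the parameter, and the answer given
  there is correct for every graph.\<close>

definition runs :: "com \<Rightarrow> state \<Rightarrow> nat \<Rightarrow> (state \<Rightarrow> bool) \<Rightarrow> bool" where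
  "runs c s T Q \<longleftrightarrow> (\<exists>t s'. exec c s t s' \<and> t \<le> T \<and> Q s')"

lemma runs_mono: "runs c s T Q \<Longrightarrow> T \<le> T' \<Longrightarrow> (\<And>s. Q s \<Longrightarrow> Q' s) \<Longrightarrow> runs c s T' Q'"
  unfolding runs_def by (meson le_trans)

lemma runs_Assign:
  "acost a + 1 \<le> T \<Longrightarrow> Q ((fst s)(x := aval a s), snd s) \<Longrightarrow> runs (Assign x a) s T Q"
  unfolding runs_def by (meson exec.Assign)

lemma runs_Store:
  "acost a + acost b + 1 \<le> T \<Longrightarrow> Q (fst s, (snd s)(aval a s := aval b s)) \<Longrightarrow> runs (Store a b) s T Q"
  unfolding runs_def by (meson exec.Store)

lemma runs_Seq:
  "runs c s T R \<Longrightarrow> (\<And>s'. R s' \<Longrightarrow> runs c' s' T' Q) \<Longrightarrow> T + T' \<le> U \<Longrightarrow> runs (Seq c c') s U Q"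
  unfolding runs_def by (meson exec.Seq add_mono le_trans)

lemma runs_Ite:
  "(bval b s \<Longrightarrow> runs c1 s T1 Q) \<Longrightarrow> (\<not> bval b s \<Longrightarrow> runs c2 s T1 Q) \<Longrightarrow> bcost b + T1 \<le> T \<Longrightarrow>
   runs (Ite b c1 c2) s T Q"
  unfolding runs_def
  by (cases "bval b s") (meson exec.IfTrue exec.IfFalse add_le_mono le_refl le_trans)+

text \<open>The index of the invariant counts rounds and decides the guard, so the loop makes
  exactly \<open>N\<close> rounds; the last summand pays for the failing test.\<close>

lemma runs_While:
  assumes "I 0 s"
    and "\<And>i s. i < N \<Longrightarrow> I i s \<Longrightarrow> bval b s \<and> runs c s T (I (Suc i))"
    and "\<And>s. I N s \<Longrightarrow> \<not> bval b s"
  shows "runs (While b c) s (N * (T + bcost b) + bcost b) (I N)"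
proof -
  \<comment> \<open>Generalised to the \<open>m\<close> rounds still to come, because the induction
    peels off the first round.\<close>
  have "\<forall>i s. i + m = N \<longrightarrow> I i s \<longrightarrow> runs (While b c) s (m * (T + bcost b) + bcost b) (I N)" for m
  proof (induction m)
    case 0
    then show ?case
      using assms(3) unfolding runs_def by (auto intro!: exI exec.WhileFalse)
  next
    case (Suc m)
    show ?case
    proof (intro allI impI)
      fix i s assume i: "i + Suc m = N" and I: "I i s"
      then obtain t1 s1 where 1: "bval b s" "exec c s t1 s1" "t1 \<le> T" "I (Suc i) s1"
        using assms(2)[of i s] unfolding runs_def by auto
      moreover obtain t2 s2 where
        "exec (While b c) s1 t2 s2" "t2 \<le> m * (T + bcost b) + bcost b" "I N s2"
        using Suc 1 i unfolding runs_def by fastforce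
      ultimately show "runs (While b c) s (Suc m * (T + bcost b) + bcost b) (I N)"
        unfolding runs_def by (intro exI[of _ "bcost b + t1 + t2"] exI[of _ s2]) (auto intro: exec.WhileTrue)
    qed
  qed
  then have "I 0 s \<longrightarrow> runs (While b c) s (N * (T + bcost b) + bcost b) (I N)"
    by (metis add_0)
  then show ?thesis using assms(1) by simp
qed

section \<open>Syntax, semantics and compilation of the loop language\<close>

text \<open>
  Expressions may contain bounded sums, and thereby bounded quantifiers. Loops and sums are bounded
  by the registers 0, 1, 2, which programs never change; register 3 holds the address behind the
  input, where four interleaved arrays are stored.
\<close>

datatype xexp =
    Lit nat
  | Var nat
  | Ld xexp
  | Add xexp xexp
  | Sub xexp xexp
  | Cnd xexp xexp xexp
  | Sum nat nat xexp

datatype stm =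
    Set nat xexp
  | Put nat xexp xexp
  | Sq stm stm (infixr ";;" 60)
  | For nat nat stm

definition upd :: "nat \<Rightarrow> nat \<Rightarrow> state \<Rightarrow> state" where
  "upd x v s = ((fst s)(x := v), snd s)"

lemma fst_upd [simp]: "fst (upd x v s) = (fst s)(x := v)"
  and snd_upd [simp]: "snd (upd x v s) = snd s"
  by (simp_all add: upd_def)

primrec xval :: "xexp \<Rightarrow> state \<Rightarrow> nat" where
  "xval (Lit k) s = k"
| "xval (Var x) s = fst s x"
| "xval (Ld e) s = snd s (xval e s)"
| "xval (Add a b) s = xval a s + xval b s"
| "xval (Sub a b) s = xval a s - xval b s"
| "xval (Cnd t a b) s = (if 0 < xval t s then xval a s else xval b s)"
| "xval (Sum x b e) s = (\<Sum>i < fst s b. xval e (upd x i s))"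

primrec sem :: "stm \<Rightarrow> state \<Rightarrow> state" where
  "sem (Set x e) s = upd x (xval e s) s"
| "sem (Put j a e) s = (fst s, (snd s)(fst s 3 + (4 * xval a s + j) := xval e s))"
| "sem (c ;; d) s = sem d (sem c s)"
| "sem (For x b c) s = fold (\<lambda>i s. sem c (upd x i s)) [0..<fst s b] s"

primrec wfx :: "nat \<Rightarrow> xexp \<Rightarrow> bool" where
  "wfx d (Lit k) = True"
| "wfx d (Var x) = (x < d)"
| "wfx d (Ld e) = wfx d e"
| "wfx d (Add a b) = (wfx d a \<and> wfx d b)"
| "wfx d (Sub a b) = (wfx d a \<and> wfx d b)"
| "wfx d (Cnd t a b) = (wfx d t \<and> wfx d a \<and> wfx d b)"
| "wfx d (Sum x b e) = (3 < x \<and> x < d \<and> b < 3 \<and> wfx d e)"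

primrec wfs :: "nat \<Rightarrow> stm \<Rightarrow> bool" where
  "wfs d (Set x e) = (3 < x \<and> x < d \<and> wfx d e)"
| "wfs d (Put j a e) = (3 < d \<and> wfx d a \<and> wfx d e)"
| "wfs d (c1 ;; c2) = (wfs d c1 \<and> wfs d c2)"
| "wfs d (For x b c) = (3 < x \<and> x < d \<and> b < 3 \<and> wfs d c)"

text \<open>Stack discipline: the result goes to register \<open>d\<close>, and everything from
  \<open>d\<close> on is scratch. A sum keeps its accumulator in \<open>d\<close>, its counter in
  \<open>d + 1\<close> and the old value of \<open>x\<close> in \<open>d + 2\<close>, from which the
  bound variable is restored.\<close>

primrec compile_exp :: "xexp \<Rightarrow> nat \<Rightarrow> com" where
  "compile_exp (Lit k) d = Assign d (Const k)"
| "compile_exp (Var x) d = Assign d (Reg x)"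
| "compile_exp (Ld e) d = Seq (compile_exp e d) (Assign d (Load (Reg d)))"
| "compile_exp (Add a b) d = Seq (compile_exp a d) (Seq (compile_exp b (Suc d)) (Assign d (Plus (Reg d) (Reg (Suc d)))))"
| "compile_exp (Sub a b) d = Seq (compile_exp a d) (Seq (compile_exp b (Suc d)) (Assign d (Minus (Reg d) (Reg (Suc d)))))"
| "compile_exp (Cnd t a b) d = Seq (compile_exp t d) (Ite (Less (Const 0) (Reg d)) (compile_exp a d) (compile_exp b d))"
| "compile_exp (Sum x b e) d =
     Seq (Assign d (Const 0)) (Seq (Assign (d + 1) (Const 0)) (Seq (Assign (d + 2) (Reg x))
     (Seq (While (Less (Reg (d + 1)) (Reg b))
        (Seq (Assign x (Reg (d + 1))) (Seq (compile_exp e (d + 3))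
         (Seq (Assign d (Plus (Reg d) (Reg (d + 3)))) (Assign (d + 1) (Plus (Reg (d + 1)) (Const 1)))))))
     (Assign x (Reg (d + 2))))))"

text \<open>The counter lives in the hidden register \<open>d\<close> and is copied to
  \<open>x\<close> in each round, so a body that overwrites \<open>x\<close> cannot disturb the
  loop. The factor 4 of an array address is spelled out as additions.\<close>

primrec compile_stm :: "stm \<Rightarrow> nat \<Rightarrow> com" where
  "compile_stm (Set x e) d = Seq (compile_exp e d) (Assign x (Reg d))"
| "compile_stm (Put j a e) d = Seq (compile_exp a d) (Seq (compile_exp e (Suc d))
     (Store (Plus (Reg 3) (Plus (Plus (Plus (Reg d) (Reg d)) (Plus (Reg d) (Reg d))) (Const j)))
       (Reg (Suc d))))"
| "compile_stm (c1 ;; c2) d = Seq (compile_stm c1 d) (compile_stm c2 d)"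
| "compile_stm (For x b c) d = Seq (Assign d (Const 0)) (While (Less (Reg d) (Reg b))
     (Seq (Assign x (Reg d)) (Seq (compile_stm c (Suc d)) (Assign d (Plus (Reg d) (Const 1))))))"

text \<open>The constants are instruction costs of the compiled code: a round of a sum spends 10 on
  assignments and 3 on the guard. For \<open>Cnd\<close> the times of both branches are added, as an
  upper bound of their maximum.\<close>

primrec xtime :: "xexp \<Rightarrow> nat \<Rightarrow> nat" where
  "xtime (Lit k) M = 2"
| "xtime (Var x) M = 2"
| "xtime (Ld e) M = xtime e M + 3"
| "xtime (Add a b) M = xtime a M + xtime b M + 4"
| "xtime (Sub a b) M = xtime a M + xtime b M + 4"
| "xtime (Cnd t a b) M = xtime t M + xtime a M + xtime b M + 3"
| "xtime (Sum x b e) M = M * (xtime e M + 13) + 11"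

primrec stime :: "stm \<Rightarrow> nat \<Rightarrow> nat" where
  "stime (Set x e) M = xtime e M + 2"
| "stime (Put j a e) M = xtime a M + xtime e M + 13"
| "stime (c1 ;; c2) M = stime c1 M + stime c2 M"
| "stime (For x b c) M = M * (stime c M + 9) + 5"

section \<open>Correctness of the compiler\<close>

definition agree :: "nat \<Rightarrow> state \<Rightarrow> state \<Rightarrow> bool" where
  "agree d s s' \<longleftrightarrow> snd s = snd s' \<and> (\<forall>x < d. fst s x = fst s' x)"

lemma agree_trans: "agree d s s' \<Longrightarrow> agree d s' s'' \<Longrightarrow> agree d s s''"
  by (simp add: agree_def)

lemma agree_mono: "agree d s s' \<Longrightarrow> d' \<le> d \<Longrightarrow> agree d' s s'"
  by (simp add: agree_def)

lemma agree_upd: "agree d s s' \<Longrightarrow> agree d (upd x v s) (upd x v s')"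
  by (simp add: agree_def)

lemma xval_cong: "wfx d e \<Longrightarrow> agree d s s' \<Longrightarrow> xval e s = xval e s'"
proof (induction e arbitrary: s s')
  case (Sum x b e)
  have "xval e (upd x i s) = xval e (upd x i s')" for i
    using Sum.prems by (intro Sum.IH agree_upd) auto
  then show ?case using Sum.prems by (auto simp: agree_def)
next
  case (Cnd e1 e2 e3)
  show ?case using Cnd.prems Cnd.IH[of s s'] by simp
next
  case (Ld e)
  show ?case using Ld.prems Ld.IH[of s s'] by (simp add: agree_def)
next
  case (Add a b)
  show ?case using Add.prems Add.IH[of s s'] by simp
next
  case (Sub a b)
  show ?case using Sub.prems Sub.IH[of s s'] by simp
qed (auto simp: agree_def)

text \<open>Writes go to registers from 4 to \<open>d - 1\<close> only: the loop bounds survive, and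
  so do the hidden counters of the compiled code.\<close>

lemma sem_frame_reg: "wfs d c \<Longrightarrow> x < 4 \<or> d \<le> x \<Longrightarrow> fst (sem c s) x = fst s x"
proof (induction c arbitrary: s)
  case (For y b c)
  have "fst (fold (\<lambda>i s. sem c (upd y i s)) is s) x = fst s x" for "is"
    by (induction "is" arbitrary: s) (use For in auto)
  then show ?case by simp
qed auto

lemma sem_cong: "wfs d c \<Longrightarrow> d \<le> d' \<Longrightarrow> agree d' s s' \<Longrightarrow> agree d' (sem c s) (sem c s')"
proof (induction c arbitrary: s s')
  case (Set x e)
  then show ?case using xval_cong[of d e s s'] agree_mono[of d' s s' d] by (simp add: agree_upd)
next
  case (Put j a e)
  then show ?case
    using xval_cong[of d e s s'] xval_cong[of d a s s'] agree_mono[of d' s s' d] by (simp add: agree_def)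
next
  case (For x b c)
  have "agree d' (fold (\<lambda>i s. sem c (upd x i s)) is s) (fold (\<lambda>i s. sem c (upd x i s)) is s')" for "is"
    using For.prems(3)
  proof (induction "is" arbitrary: s s')
    case (Cons a "is")
    then show ?case using For.IH[OF _ For.prems(2)] For.prems(1) by (simp add: agree_upd)
  qed simp
  moreover have "fst s b = fst s' b" using For.prems by (simp add: agree_def)
  ultimately show ?case by simp
qed simp

text \<open>Serves the second operand, which is evaluated one register higher so that the first
  result \<open>v\<close> survives. Correctness of \<open>b\<close> is a premise, so that the lemma
  applies inside the induction on expressions as well as after it.\<close>

lemma compile_exp_next:
  assumes IH: "\<And>d s. wfx d0 b \<Longrightarrow> d0 \<le> d \<Longrightarrow> 3 < d0 \<Longrightarrow> \<forall>b<3. fst s b \<le> M \<Longrightarrow>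
      runs (compile_exp b d) s (xtime b M) (\<lambda>s'. agree d s s' \<and> fst s' d = xval b s)"
    and "wfx d0 b" "d0 \<le> d" "3 < d0" "\<forall>b<3. fst s b \<le> M" "agree d s s1 \<and> fst s1 d = v"
  shows "runs (compile_exp b (Suc d)) s1 (xtime b M)
      (\<lambda>s'. agree d s s' \<and> fst s' d = v \<and> fst s' (Suc d) = xval b s)"
proof -
  have "\<forall>b<3. fst s1 b \<le> M" "xval b s1 = xval b s"
    using assms(2-) xval_cong[of d0 b s s1] agree_mono[of d s s1 d0] by (auto simp: agree_def)
  then show ?thesis
    using IH[of "Suc d" s1] assms(2-) by (auto elim!: runs_mono simp: agree_def)
qed

lemma compile_exp_correct:
  assumes "wfx d0 e" "d0 \<le> d" "3 < d0" "\<forall>b<3. fst s b \<le> M"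
  shows "runs (compile_exp e d) s (xtime e M) (\<lambda>s'. agree d s s' \<and> fst s' d = xval e s)"
  using assms
proof (induction e arbitrary: d s)
  case (Lit k)
  show ?case by (auto intro!: runs_Assign simp: agree_def)
next
  case (Var x)
  then show ?case by (auto intro!: runs_Assign simp: agree_def)
next
  case (Ld e)
  have *: "runs (compile_exp e d) s (xtime e M) (\<lambda>s'. agree d s s' \<and> fst s' d = xval e s)"
    using Ld by simp
  show ?case
    by (simp only: compile_exp.simps, rule runs_Seq[OF *], rule runs_Assign[of _ 3]) (auto simp: agree_def)
next
  case (Add a b)
  show ?case
  proof -
    have 1: "runs (compile_exp a d) s (xtime a M) (\<lambda>s'. agree d s s' \<and> fst s' d = xval a s)"
      by (rule Add.IH(1)) (use Add.prems in simp_all)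
    have 2: "runs (compile_exp b (Suc d)) s1 (xtime b M)
        (\<lambda>s'. agree d s s' \<and> fst s' d = xval a s \<and> fst s' (Suc d) = xval b s)"
      if "agree d s s1 \<and> fst s1 d = xval a s" for s1
      by (rule compile_exp_next[OF Add.IH(2)]) (use Add.prems that in simp_all)
    show ?thesis
      by (simp only: compile_exp.simps compile_stm.simps, rule runs_Seq[OF 1], rule runs_Seq[OF 2], assumption, rule runs_Assign[of _ 4])
        (auto simp: agree_def)
  qed
next
  case (Sub a b)
  show ?case
  proof -
    have 1: "runs (compile_exp a d) s (xtime a M) (\<lambda>s'. agree d s s' \<and> fst s' d = xval a s)"
      by (rule Sub.IH(1)) (use Sub.prems in simp_all)
    have 2: "runs (compile_exp b (Suc d)) s1 (xtime b M)
        (\<lambda>s'. agree d s s' \<and> fst s' d = xval a s \<and> fst s' (Suc d) = xval b s)"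
      if "agree d s s1 \<and> fst s1 d = xval a s" for s1
      by (rule compile_exp_next[OF Sub.IH(2)]) (use Sub.prems that in simp_all)
    show ?thesis
      by (simp only: compile_exp.simps compile_stm.simps, rule runs_Seq[OF 1], rule runs_Seq[OF 2], assumption, rule runs_Assign[of _ 4])
        (auto simp: agree_def)
  qed
next
  case (Cnd t a b)
  have *: "runs (compile_exp e d) s1 (xtime a M + xtime b M) (\<lambda>s'. agree d s s' \<and> fst s' d = xval e s)"
    if "agree d s s1" "e = a \<or> e = b" for e s1
  proof -
    have "\<forall>b<3. fst s1 b \<le> M" "xval e s1 = xval e s"
      using Cnd.prems that xval_cong[of d0 e s s1] agree_mono[of d s s1 d0] by (auto simp: agree_def)
    then have "runs (compile_exp e d) s1 (xtime e M) (\<lambda>s'. agree d s1 s' \<and> fst s' d = xval e s)"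
      using that(2) Cnd.IH(2,3)[of d s1] Cnd.prems by auto
    then show ?thesis
      by (rule runs_mono) (use that in \<open>auto intro: agree_trans\<close>)
  qed
  show ?case
  proof -
    have 1: "runs (compile_exp t d) s (xtime t M) (\<lambda>s'. agree d s s' \<and> fst s' d = xval t s)"
      using Cnd.IH(1) Cnd.prems by simp
    show ?thesis
      by (simp only: compile_exp.simps compile_stm.simps, rule runs_Seq[OF 1], rule runs_Ite) (auto intro!: runs_mono[OF *])
  qed
next
  case (Sum x b e)
  have x: "3 < x" "x < d0" "b < 3" "wfx d0 e" using Sum.prems by auto
  \<comment> \<open>Register \<open>x\<close> is exempt because it holds the running index; its old
    value waits in \<open>d + 2\<close>.\<close>
  define I where "I i s' \<longleftrightarrow> snd s' = snd s \<and> (\<forall>y<d. y \<noteq> x \<longrightarrow> fst s' y = fst s y) \<and>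
      fst s' d = (\<Sum>j<i. xval e (upd x j s)) \<and> fst s' (d + 1) = i \<and> fst s' (d + 2) = fst s x"
    for i s'
  let ?B = "Seq (Assign x (Reg (d + 1))) (Seq (compile_exp e (d + 3))
         (Seq (Assign d (Plus (Reg d) (Reg (d + 3)))) (Assign (d + 1) (Plus (Reg (d + 1)) (Const 1)))))"
  have body: "runs ?B s1 (xtime e M + 10) (I (Suc i))" if "I i s1" for i s1
  proof -
    define s2 where "s2 = upd x i s1"
    have a: "agree d (upd x i s) s2"
      using that by (auto simp: I_def s2_def agree_def)
    have "\<forall>b<3. fst s2 b \<le> M"
    proof (intro allI impI)
      fix b' :: nat assume "b' < 3"
      then have "b' < d" "b' \<noteq> x" using x Sum.prems by auto
      then have "fst s2 b' = fst s b'" using a by (auto simp: agree_def)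
      then show "fst s2 b' \<le> M" using Sum.prems \<open>b' < 3\<close> by simp
    qed
    then have 1: "runs (compile_exp e (d + 3)) s2 (xtime e M)
        (\<lambda>s'. agree (d + 3) s2 s' \<and> fst s' (d + 3) = xval e s2)"
      using Sum.IH[of "d + 3" s2] Sum.prems by simp
    have 2: "xval e s2 = xval e (upd x i s)"
      using a xval_cong[OF x(4)] agree_mono[OF a Sum.prems(2)] by metis
    have 3: "fst s1 (d + 1) = i" using that by (simp add: I_def)
    show ?thesis
    proof (rule runs_Seq[where T = 2 and R = "\<lambda>s'. s' = s2"])
      show "runs (Assign x (Reg (d + 1))) s1 2 (\<lambda>s'. s' = s2)"
        by (rule runs_Assign) (use 3 in \<open>auto simp: s2_def upd_def\<close>)
      fix s' assume "s' = s2"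
      show "runs (Seq (compile_exp e (d + 3))
         (Seq (Assign d (Plus (Reg d) (Reg (d + 3)))) (Assign (d + 1) (Plus (Reg (d + 1)) (Const 1)))))
         s' (xtime e M + 8) (I (Suc i))"
        unfolding \<open>s' = s2\<close>
      proof (rule runs_Seq[OF 1])
        fix s3 assume s3: "agree (d + 3) s2 s3 \<and> fst s3 (d + 3) = xval e s2"
        have r: "fst s3 d = (\<Sum>j<i. xval e (upd x j s))" "fst s3 (Suc d) = i" "fst s3 (d + 2) = fst s x"
          "\<And>y. y < d \<Longrightarrow> y \<noteq> x \<Longrightarrow> fst s3 y = fst s y" "snd s3 = snd s"
        proof -
          have *: "fst s3 y = (if y = x then i else fst s1 y)" if "y < d + 3" for y
            using s3 that by (auto simp: agree_def s2_def)
          show "fst s3 d = (\<Sum>j<i. xval e (upd x j s))" "fst s3 (Suc d) = i" "fst s3 (d + 2) = fst s x"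
            "\<And>y. y < d \<Longrightarrow> y \<noteq> x \<Longrightarrow> fst s3 y = fst s y"
            using that x Sum.prems(2) by (auto simp: * I_def)
          show "snd s3 = snd s" using that s3 by (auto simp: agree_def s2_def I_def)
        qed
        show "runs (Seq (Assign d (Plus (Reg d) (Reg (d + 3))))
            (Assign (d + 1) (Plus (Reg (d + 1)) (Const 1)))) s3 8 (I (Suc i))"
          by (rule runs_Seq[where T = 4 and T' = 4], rule runs_Assign[where T = 4 and Q = "\<lambda>s'. s' = upd d (fst s3 d + fst s3 (d + 3)) s3"])
            (auto simp: upd_def I_def r[simplified] s3 2 intro!: runs_Assign[where T = 4])
      qed simp
    qed simp
  qed
  have loop: "runs (While (Less (Reg (d + 1)) (Reg b)) ?B) s1 (M * (xtime e M + 13) + 3) (I (fst s b))"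
    if "I 0 s1" for s1
  proof -
    have "runs (While (Less (Reg (d + 1)) (Reg b)) ?B) s1
        (fst s b * (xtime e M + 10 + bcost (Less (Reg (d + 1)) (Reg b))) + bcost (Less (Reg (d + 1)) (Reg b)))
        (I (fst s b))"
      by (rule runs_While[where I = I, OF that]) (use body x Sum.prems in \<open>auto simp: I_def\<close>)
    then show ?thesis
      by (rule runs_mono) (use Sum.prems(4) x in \<open>auto simp: add.commute intro!: mult_le_mono\<close>)
  qed
  show ?case
    apply (simp only: compile_exp.simps)
    apply (rule runs_Seq[OF runs_Assign[where T = 2 and Q = "\<lambda>s'. s' = upd d 0 s"]])
      apply (simp_all add: upd_def)[2]
    apply (rule runs_Seq[OF runs_Assign[where T = 2 and Q = "\<lambda>s'. s' = upd (d + 1) 0 (upd d 0 s)"]])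
       apply (simp_all add: upd_def)[2]
     apply (rule runs_Seq[OF runs_Assign[where T = 2 and
         Q = "\<lambda>s'. s' = upd (d + 2) (fst s x) (upd (d + 1) 0 (upd d 0 s))"]])
       apply (use x Sum.prems(2) in \<open>simp_all add: upd_def\<close>)[2]
      apply (rule runs_Seq[OF loop])
        apply (use x Sum.prems(2) in \<open>simp add: I_def upd_def\<close>)
       apply (rule runs_Assign[where T = 2])
        apply (use x Sum.prems(2) in \<open>auto simp: I_def agree_def\<close>)
    done
qed

lemma compile_stm_correct:
  assumes "wfs d0 c" "d0 \<le> d" "3 < d0" "\<forall>b<3. fst s b \<le> M"
  shows "runs (compile_stm c d) s (stime c M) (agree d (sem c s))"
  using assms
proof (induction c arbitrary: d s)
  case (Set x e)
  show ?case
  proof -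
    have 1: "runs (compile_exp e d) s (xtime e M) (\<lambda>s'. agree d s s' \<and> fst s' d = xval e s)"
      by (rule compile_exp_correct[of d0]) (use Set.prems in simp_all)
    show ?thesis
      by (simp only: compile_exp.simps compile_stm.simps, rule runs_Seq[OF 1], rule runs_Assign[where T = 2])
        (use Set.prems in \<open>auto simp: agree_def\<close>)
  qed
next
  case (Put j a e)
  show ?case
  proof -
    have 1: "runs (compile_exp a d) s (xtime a M) (\<lambda>s'. agree d s s' \<and> fst s' d = xval a s)"
      by (rule compile_exp_correct[of d0]) (use Put.prems in simp_all)
    have 2: "runs (compile_exp e (Suc d)) s1 (xtime e M)
        (\<lambda>s'. agree d s s' \<and> fst s' d = xval a s \<and> fst s' (Suc d) = xval e s)"
      if "agree d s s1 \<and> fst s1 d = xval a s" for s1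
      by (rule compile_exp_next[of d0, OF compile_exp_correct[of d0]]) (use Put.prems that in simp_all)
    show ?thesis
      by (simp only: compile_stm.simps, rule runs_Seq[OF 1], rule runs_Seq[OF 2], assumption,
          rule runs_Store[where T = 13])
        (use Put.prems in \<open>auto simp: agree_def algebra_simps\<close>)
  qed
next
  case (Sq c1 c2)
  have *: "runs (compile_stm c2 d) s1 (stime c2 M) (agree d (sem c2 (sem c1 s)))" if "agree d (sem c1 s) s1" for s1
  proof -
    have "fst s1 b = fst s b" if "b < 3" for b
      using \<open>agree d (sem c1 s) s1\<close> that Sq.prems sem_frame_reg[of d0 c1 b s] by (auto simp: agree_def)
    then have "\<forall>b<3. fst s1 b \<le> M"
      using Sq.prems by simp
    then have "runs (compile_stm c2 d) s1 (stime c2 M) (agree d (sem c2 s1))"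
      using Sq.IH(2) Sq.prems by simp
    then show ?thesis
      using sem_cong[of d0 c2 d, OF _ _ that] Sq.prems
      by (elim runs_mono) (auto intro: agree_trans)
  qed
  show ?case
    by (simp only: compile_stm.simps sem.simps, rule runs_Seq[OF Sq.IH(1) *]) (use Sq.prems in auto)
next
  case (For x b c)
  have x: "3 < x" "x < d0" "b < 3" "wfs d0 c" using For.prems by auto
  \<comment> \<open>The source state after \<open>i\<close> rounds. Its bound register never
    changes, so re-reading it in the compiled guard agrees with the single reading in
    \<open>fold\<close>.\<close>
  define F where "F i = fold (\<lambda>i s. sem c (upd x i s)) [0..<i] s" for i
  have F_Suc: "F (Suc i) = sem c (upd x i (F i))" for i by (simp add: F_def)
  have F_reg: "y < 4 \<Longrightarrow> fst (F i) y = fst s y" for i y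
    by (induction i) (use x in \<open>auto simp: F_Suc F_def sem_frame_reg[of d0 c]\<close>)
  define I where "I i s' \<longleftrightarrow> agree d (F i) s' \<and> fst s' d = i" for i s'
  let ?B = "Seq (Assign x (Reg d)) (Seq (compile_stm c (Suc d)) (Assign d (Plus (Reg d) (Const 1))))"
  have body: "runs ?B s1 (stime c M + 6) (I (Suc i))" if "I i s1" for i s1
  proof -
    define s2 where "s2 = upd x i s1"
    have a: "agree d (upd x i (F i)) s2" "fst s2 d = i" "fst s1 d = i"
      using that x For.prems by (auto simp: I_def s2_def agree_upd)
    have "\<forall>b<3. fst s2 b \<le> M"
    proof (intro allI impI)
      fix b' :: nat assume "b' < 3"
      then have "b' < d" "b' \<noteq> x" using x For.prems by auto
      then have "fst s2 b' = fst s b'" using a(1) \<open>b' < 3\<close> F_reg[of b' i] by (auto simp: agree_def)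
      then show "fst s2 b' \<le> M" using For.prems \<open>b' < 3\<close> by simp
    qed
    then have 1: "runs (compile_stm c (Suc d)) s2 (stime c M) (agree (Suc d) (sem c s2))"
      using For.IH[of "Suc d" s2] For.prems by simp
    have 2: "agree d (F (Suc i)) (sem c s2)"
      unfolding F_Suc by (rule sem_cong[OF x(4) For.prems(2) a(1)])
    have 3: "fst (sem c s2) d = i" using sem_frame_reg[OF x(4)] For.prems(2) a(2) by simp
    show ?thesis
    proof (rule runs_Seq[where T = 2 and R = "\<lambda>s'. s' = s2"])
      show "runs (Assign x (Reg d)) s1 2 (\<lambda>s'. s' = s2)"
        by (rule runs_Assign) (use a in \<open>auto simp: s2_def upd_def\<close>)
      fix s' assume "s' = s2"
      show "runs (Seq (compile_stm c (Suc d)) (Assign d (Plus (Reg d) (Const 1)))) s' (stime c M + 4) (I (Suc i))"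
        unfolding \<open>s' = s2\<close>
        by (rule runs_Seq[OF 1], rule runs_Assign[where T = 4]) (use 2 3 in \<open>auto simp: I_def agree_def\<close>)
    qed simp
  qed
  have loop: "runs (While (Less (Reg d) (Reg b)) ?B) s1 (M * (stime c M + 9) + 3) (I (fst s b))"
    if "I 0 s1" for s1
  proof -
    have b: "fst s' b = fst s b" if "I i s'" for i s'
      using that F_reg[of b i] x For.prems by (auto simp: I_def agree_def)
    have "runs (While (Less (Reg d) (Reg b)) ?B) s1
        (fst s b * (stime c M + 6 + bcost (Less (Reg d) (Reg b))) + bcost (Less (Reg d) (Reg b)))
        (I (fst s b))"
      by (rule runs_While[where I = I, OF that]) (use body b in \<open>auto simp: I_def\<close>)
    then show ?thesis
      by (rule runs_mono) (use For.prems(4) x in \<open>auto simp: add.commute intro!: mult_le_mono\<close>)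
  qed
  show ?case
    by (simp only: compile_stm.simps, rule runs_Seq[OF runs_Assign[where T = 2 and Q = "I 0"]],
        simp, use x For.prems in \<open>simp add: I_def F_def agree_def\<close>, rule runs_mono[OF loop])
      (auto simp: I_def F_def)
qed

section \<open>Polynomial running time\<close>

definition polynomial_bound :: "(nat \<Rightarrow> nat) \<Rightarrow> bool" where
  "polynomial_bound f \<longleftrightarrow> (\<exists>C D. \<forall>M\<ge>1. f M \<le> C * M ^ D)"

lemma polynomial_bound_const: "polynomial_bound (\<lambda>M. c)"
  unfolding polynomial_bound_def by (rule exI[of _ c], rule exI[of _ 0]) simp

lemma polynomial_bound_add:
  assumes "polynomial_bound f" "polynomial_bound g"
  shows "polynomial_bound (\<lambda>M. f M + g M)"
proof -
  obtain C D C' D' where f: "\<And>M. M \<ge> 1 \<Longrightarrow> f M \<le> C * M ^ D" and g: "\<And>M. M \<ge> 1 \<Longrightarrow> g M \<le> C' * M ^ D'"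
    using assms unfolding polynomial_bound_def by blast
  have "f M + g M \<le> (C + C') * M ^ (D + D')" if M: "M \<ge> 1" for M :: nat
  proof -
    have "M ^ D \<le> M ^ (D + D')" "M ^ D' \<le> M ^ (D + D')"
      using M by (auto intro: power_increasing)
    then have "C * M ^ D + C' * M ^ D' \<le> (C + C') * M ^ (D + D')"
      unfolding add_mult_distrib by (intro add_mono mult_left_mono) auto
    then show ?thesis using f[OF M] g[OF M] by linarith
  qed
  then show ?thesis unfolding polynomial_bound_def by blast
qed

text \<open>Each nested loop or sum contributes one factor \<open>M\<close> and so raises the degree
  by one.\<close>

lemma polynomial_bound_mult:
  assumes "polynomial_bound f"
  shows "polynomial_bound (\<lambda>M. M * f M)"
proof -
  obtain C D where f: "\<And>M. M \<ge> 1 \<Longrightarrow> f M \<le> C * M ^ D"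
    using assms unfolding polynomial_bound_def by blast
  have "M * f M \<le> C * M ^ Suc D" if M: "M \<ge> 1" for M :: nat
    using mult_left_mono[OF f[OF M], of M] by (simp add: mult.left_commute)
  then show ?thesis unfolding polynomial_bound_def by blast
qed

lemma xtime_polynomial: "polynomial_bound (xtime e)"
proof (induction e)
  case (Sum x b e)
  then show ?case
    by (simp only: xtime.simps[abs_def])
      (intro polynomial_bound_add polynomial_bound_mult polynomial_bound_const)
qed (simp_all only: xtime.simps[abs_def], (intro polynomial_bound_add polynomial_bound_const; assumption)+)

lemma stime_polynomial: "polynomial_bound (stime c)"
proof (induction c)
  case (For x b c)
  then show ?case
    by (simp only: stime.simps[abs_def])
      (intro polynomial_bound_add polynomial_bound_mult polynomial_bound_const)
qed (simp_all only: stime.simps[abs_def],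
    (intro polynomial_bound_add polynomial_bound_const xtime_polynomial; assumption)+)

section \<open>The combinatorial core\<close>

definition nb :: "(nat \<Rightarrow> nat \<Rightarrow> bool) \<Rightarrow> nat \<Rightarrow> nat \<Rightarrow> bool" where
  "nb E u v \<longleftrightarrow> u = v \<or> E u v"

definition near :: "nat \<Rightarrow> (nat \<Rightarrow> nat \<Rightarrow> bool) \<Rightarrow> nat set \<Rightarrow> nat \<Rightarrow> nat \<Rightarrow> bool" where
  "near n E S u v \<longleftrightarrow> nb E u v \<or> (\<exists>m<n. m \<notin> S \<and> E u m \<and> E m v)"

definition obstruction :: "nat \<Rightarrow> (nat \<Rightarrow> nat \<Rightarrow> bool) \<Rightarrow> nat set \<Rightarrow> nat \<Rightarrow> nat \<Rightarrow> nat \<Rightarrow> nat \<Rightarrow> bool" where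
  "obstruction n E S a b c d \<longleftrightarrow> a \<notin> S \<and> b \<notin> S \<and> c \<notin> S \<and> d \<notin> S \<and>
     E a b \<and> E b c \<and> E c d \<and> \<not> near n E S a d"

text \<open>A local form of the 2-club condition: a component with two vertices at distance above 2
  also has two at distance exactly 3, joined by such a path. It can be tested by four nested bounded
  searches.\<close>

definition clean :: "nat \<Rightarrow> (nat \<Rightarrow> nat \<Rightarrow> bool) \<Rightarrow> nat set \<Rightarrow> bool" where
  "clean n E S \<longleftrightarrow> \<not> (\<exists>a<n. \<exists>b<n. \<exists>c<n. \<exists>d<n. obstruction n E S a b c d)"

definition ndom :: "nat \<Rightarrow> (nat \<Rightarrow> nat \<Rightarrow> bool) \<Rightarrow> nat set \<Rightarrow> nat \<Rightarrow> nat" where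
  "ndom n E D u = card {s. s < n \<and> s \<in> D \<and> nb E u s}"

definition eds :: "nat \<Rightarrow> (nat \<Rightarrow> nat \<Rightarrow> bool) \<Rightarrow> nat set \<Rightarrow> bool" where
  "eds n E D \<longleftrightarrow> D \<subseteq> {..<n} \<and> (\<forall>u<n. ndom n E D u = 1)"

definition in_class :: "nat \<Rightarrow> (nat \<Rightarrow> nat \<Rightarrow> bool) \<Rightarrow> nat set \<Rightarrow> nat \<Rightarrow> nat \<Rightarrow> bool" where
  "in_class n E S r u \<longleftrightarrow> u \<notin> S \<and> near n E S r u"

text \<open>For a clean \<open>S\<close>, the least vertex of its component; a sweep over all
  vertices thus treats every component once.\<close>

definition is_rep :: "nat \<Rightarrow> (nat \<Rightarrow> nat \<Rightarrow> bool) \<Rightarrow> nat set \<Rightarrow> nat \<Rightarrow> bool" where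
  "is_rep n E S r \<longleftrightarrow> r \<notin> S \<and> (\<forall>u<n. u < r \<longrightarrow> u \<notin> S \<longrightarrow> \<not> near n E S u r)"

definition low :: "nat \<Rightarrow> (nat \<Rightarrow> nat \<Rightarrow> bool) \<Rightarrow> nat set \<Rightarrow> nat \<Rightarrow> nat \<Rightarrow> bool" where
  "low n E S r v \<longleftrightarrow> (\<exists>u<n. u < r \<and> u \<notin> S \<and> near n E S u v)"

definition wsum :: "nat \<Rightarrow> (nat \<Rightarrow> nat \<Rightarrow> bool) \<Rightarrow> (nat \<Rightarrow> nat) \<Rightarrow> nat \<Rightarrow> nat" where
  "wsum n E w v = (\<Sum>s<n. if E v s then w s else 0)"

definition target :: "nat \<Rightarrow> (nat \<Rightarrow> nat \<Rightarrow> bool) \<Rightarrow> nat set \<Rightarrow> (nat \<Rightarrow> nat) \<Rightarrow> nat" where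
  "target n E H w = (\<Sum>s<n. if ndom n E H s = 0 then w s else 0)"

text \<open>
  \<open>D\<close> is the part, outside \<open>S\<close>, of a dominating set with trace \<open>H\<close> on \<open>S\<close>, restricted to the classes that meet
  \<open>{..<r}\<close>; only domination of the vertices outside \<open>S\<close> is required, the weight \<open>x\<close> controls \<open>S\<close>.
\<close>

definition partial_solution :: "nat \<Rightarrow> (nat \<Rightarrow> nat \<Rightarrow> bool) \<Rightarrow> nat set \<Rightarrow> nat set \<Rightarrow> (nat \<Rightarrow> nat) \<Rightarrow> nat \<Rightarrow>
    nat set \<Rightarrow> nat \<Rightarrow> bool" where
  "partial_solution n E S H w r D x \<longleftrightarrow>
     D \<subseteq> {v. v < n \<and> v \<notin> S \<and> low n E S r v} \<and>
     (\<forall>u<n. u \<notin> S \<longrightarrow> low n E S r u \<longrightarrow> ndom n E (H \<union> D) u = 1) \<and>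
     (\<Sum>v\<in>D. wsum n E w v) = x"

text \<open>Counts the components, with least vertex below \<open>r\<close>, in which
  \<open>H\<close> leaves some vertex undominated. These are the components that must receive a
  vertex.\<close>

definition nreps :: "nat \<Rightarrow> (nat \<Rightarrow> nat \<Rightarrow> bool) \<Rightarrow> nat set \<Rightarrow> nat set \<Rightarrow> nat \<Rightarrow> nat" where
  "nreps n E S H r = (\<Sum>i<r. if is_rep n E S i \<and> (\<exists>u<n. in_class n E S i u \<and> ndom n E H u = 0) then 1 else 0)"

lemma ndom_Un:
  assumes "A \<inter> B = {}"
  shows "ndom n E (A \<union> B) u = ndom n E A u + ndom n E B u"
proof -
  have "{s. s < n \<and> s \<in> A \<union> B \<and> nb E u s} = {s. s < n \<and> s \<in> A \<and> nb E u s} \<union> {s. s < n \<and> s \<in> B \<and> nb E u s}"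
    by auto
  then show ?thesis
    unfolding ndom_def using assms by (auto intro: card_Un_disjoint)
qed

lemma ndom_0: "(\<And>s. s < n \<Longrightarrow> s \<in> D \<Longrightarrow> \<not> nb E u s) \<Longrightarrow> ndom n E D u = 0"
  unfolding ndom_def by auto

lemma ndom_single: "v < n \<Longrightarrow> ndom n E {v} u = (if nb E u v then 1 else 0)"
proof -
  assume "v < n"
  then have "{s. s < n \<and> s \<in> {v} \<and> nb E u s} = (if nb E u v then {v} else {})" by auto
  then show ?thesis unfolding ndom_def by simp
qed

lemma ndom_ge_2:
  assumes "a < n" "b < n" "a \<in> D" "b \<in> D" "a \<noteq> b" "nb E u a" "nb E u b"
  shows "2 \<le> ndom n E D u"
proof -
  have "card {a, b} \<le> ndom n E D u"
    unfolding ndom_def by (rule card_mono) (use assms in auto)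
  then show ?thesis using assms by simp
qed

section \<open>Components as classes of \<open>near\<close>, and the recurrence over them\<close>

locale sgraph =
  fixes n :: nat and E :: "nat \<Rightarrow> nat \<Rightarrow> bool"
  assumes sym: "u < n \<Longrightarrow> v < n \<Longrightarrow> E u v \<Longrightarrow> E v u"
begin

lemma nb_sym: "u < n \<Longrightarrow> v < n \<Longrightarrow> nb E u v \<Longrightarrow> nb E v u"
  unfolding nb_def using sym by blast

lemma near_sym: "u < n \<Longrightarrow> v < n \<Longrightarrow> near n E S u v \<Longrightarrow> near n E S v u"
  unfolding near_def using sym nb_sym by blast

lemma near_refl: "near n E S u u"
  by (simp add: near_def nb_def)

text \<open>A walk of three edges outside \<open>S\<close> whose ends are not near would be an
  obstruction, so it can be shortened. Two such extensions give transitivity of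
  \<open>near\<close>.\<close>

lemma near_extend:
  assumes "clean n E S" "u < n" "v < n" "z < n" "u \<notin> S" "v \<notin> S" "z \<notin> S" "near n E S u v" "E v z"
  shows "near n E S u z"
  using assms unfolding near_def clean_def obstruction_def nb_def by blast

lemma near_trans:
  assumes "clean n E S" "u < n" "v < n" "z < n" "u \<notin> S" "v \<notin> S" "z \<notin> S" "near n E S u v" "near n E S v z"
  shows "near n E S u z"
proof -
  consider "v = z" | "E v z" | m where "m < n" "m \<notin> S" "E v m" "E m z"
    using assms(9) unfolding near_def nb_def by blast
  then show ?thesis
  proof cases
    case 1
    then show ?thesis using assms by simp
  next
    case 2
    then show ?thesis using assms near_extend[of S u v z] by blast
  next
    case (3 m)
    then have "near n E S u m" using assms near_extend[of S u v m] by blast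
    then show ?thesis using assms 3 near_extend[of S u m z] by blast
  qed
qed

context
  fixes S :: "nat set"
  assumes clean: "clean n E S"
begin

lemma low_Suc:
  assumes "r < n"
  shows "low n E S (Suc r) v \<longleftrightarrow> low n E S r v \<or> r \<notin> S \<and> near n E S r v"
  using assms unfolding low_def by (auto simp: less_Suc_eq)

text \<open>Makes \<open>low\<close> a property of whole components, so that those already treated
  do not interact with the one of \<open>r\<close>.\<close>

lemma low_near:
  assumes "low n E S r u" "near n E S u v" "u < n" "v < n" "u \<notin> S" "v \<notin> S"
  shows "low n E S r v"
proof -
  obtain t where t: "t < n" "t < r" "t \<notin> S" "near n E S t u"
    using assms(1) unfolding low_def by blast
  then have "near n E S t v" using near_trans[OF clean, of t u v] assms by blast
  then show ?thesis using t unfolding low_def by blast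
qed

lemma low_n: "v < n \<Longrightarrow> v \<notin> S \<Longrightarrow> low n E S n v"
  unfolding low_def using near_refl by blast

lemma is_rep_iff: "r < n \<Longrightarrow> is_rep n E S r \<longleftrightarrow> r \<notin> S \<and> \<not> low n E S r r"
  unfolding is_rep_def low_def by blast

text \<open>Either \<open>r\<close> lies in \<open>S\<close>, or its component has a smaller vertex
  and has been treated before.\<close>

lemma partial_solution_Suc_not_rep:
  assumes "r < n" "\<not> is_rep n E S r"
  shows "partial_solution n E S H w (Suc r) D x \<longleftrightarrow> partial_solution n E S H w r D x"
proof -
  have "low n E S (Suc r) v \<longleftrightarrow> low n E S r v" if "v < n" "v \<notin> S" for v
    using assms that low_Suc[of r v] low_near[of r r v] is_rep_iff[of r] by blast
  then show ?thesis unfolding partial_solution_def by blast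
qed

text \<open>A class has diameter at most 2 and a common neighbour inside the class, so it contains at
  most one vertex of a partial solution.\<close>

lemma partial_solution_Suc_rep:
  assumes r: "r < n" "is_rep n E S r" and H: "H \<subseteq> S" and sol: "partial_solution n E S H w (Suc r) D x"
  shows "(\<forall>u<n. in_class n E S r u \<longrightarrow> ndom n E H u = 1) \<and> partial_solution n E S H w r D x \<or>
    (\<exists>v D'. v < n \<and> in_class n E S r v \<and> v \<notin> D' \<and> D = insert v D' \<and> finite D' \<and>
      (\<forall>u<n. in_class n E S r u \<longrightarrow> ndom n E H u + (if nb E u v then 1 else 0) = 1) \<and>
      wsum n E w v \<le> x \<and> partial_solution n E S H w r D' (x - wsum n E w v))"
proof -
  have r': "r \<notin> S" "\<not> low n E S r r" using r is_rep_iff by auto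
  define C where "C = {u. u < n \<and> in_class n E S r u}"
  define D' where "D' = D - C"
  have D: "D \<subseteq> {v. v < n \<and> v \<notin> S \<and> low n E S (Suc r) v}"
    and dom: "\<And>u. u < n \<Longrightarrow> u \<notin> S \<Longrightarrow> low n E S (Suc r) u \<Longrightarrow> ndom n E (H \<union> D) u = 1"
    and x: "(\<Sum>v\<in>D. wsum n E w v) = x"
    using sol unfolding partial_solution_def by auto
  have fin: "finite D" using D by (auto intro: finite_subset[of _ "{..<n}"])
  have C: "u \<in> C \<Longrightarrow> u < n \<and> u \<notin> S \<and> near n E S r u \<and> low n E S (Suc r) u \<and> \<not> low n E S r u" for u
    using r' r low_Suc[of r u] low_near[of r u r] near_sym[of r u] unfolding C_def in_class_def by blast
  have notC: "u \<notin> C \<Longrightarrow> u < n \<Longrightarrow> u \<notin> S \<Longrightarrow> low n E S (Suc r) u \<Longrightarrow> low n E S r u" for u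
    using low_Suc[of r u] r unfolding C_def in_class_def by blast
  have CC: "near n E S u v" if "u \<in> C" "v \<in> C" for u v
    using C[OF that(1)] C[OF that(2)] near_sym[of r u] near_trans[OF clean, of u r v] r r' by blast
  have Cout: "\<not> nb E u v" if "u \<in> C" "v < n" "v \<notin> S" "v \<notin> C" for u v
  proof
    assume "nb E u v"
    then have "near n E S u v" by (simp add: near_def)
    then have "near n E S r v" using C[OF that(1)] near_trans[OF clean, of r u v] that r r' by blast
    then show False using that unfolding C_def in_class_def by blast
  qed
  have D'sub: "D' \<subseteq> {v. v < n \<and> v \<notin> S \<and> low n E S r v}"
    using D notC unfolding D'_def by blast
  have HD: "H \<inter> D = {}" using H D by blast
  have one: "v1 = v2" if "v1 \<in> D \<inter> C" "v2 \<in> D \<inter> C" for v1 v2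
  proof (rule ccontr)
    assume ne: "v1 \<noteq> v2"
    have c: "v1 < n" "v2 < n" "v1 \<notin> S" "v2 \<notin> S" "v1 \<in> C" "v2 \<in> C" "near n E S v1 v2"
      using that C CC by auto
    obtain m where m: "m < n" "m \<notin> S" "nb E m v1" "nb E m v2"
    proof -
      consider "E v1 v2" | m where "m < n" "m \<notin> S" "E v1 m" "E m v2"
        using c(7) ne unfolding near_def nb_def by blast
      then show ?thesis
      proof cases
        case 1
        then show ?thesis using that[of v1] c by (simp add: nb_def)
      next
        case 2
        then show ?thesis using that[of m] c sym[of v1 m] by (simp add: nb_def)
      qed
    qed
    have "m \<in> C" using Cout[of v1 m] c m nb_sym[of m v1] by blast
    then have "ndom n E (H \<union> D) m = 1" using dom C by blast
    moreover have "2 \<le> ndom n E (H \<union> D) m"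
      by (rule ndom_ge_2[of v1 _ v2]) (use c m that ne in auto)
    ultimately show False by simp
  qed
  \<comment> \<open>No edge outside \<open>S\<close> leaves the component \<open>C\<close>, so the
    vertices of \<open>D'\<close> dominate nothing in it.\<close>
  have cntC: "ndom n E (H \<union> D) u = ndom n E H u + ndom n E (D \<inter> C) u" if "u \<in> C" for u
  proof -
    have "H \<union> D = H \<union> ((D \<inter> C) \<union> D')" unfolding D'_def by blast
    moreover have "ndom n E D' u = 0" by (rule ndom_0) (use Cout that D'sub D'_def in blast)
    moreover have "H \<inter> ((D \<inter> C) \<union> D') = {}" "(D \<inter> C) \<inter> D' = {}"
      using HD unfolding D'_def by auto
    ultimately show ?thesis by (simp only: ndom_Un add_0_right)
  qed
  have cntout: "ndom n E (H \<union> D') u = 1" if "u < n" "u \<notin> S" "low n E S r u" for u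
  proof -
    have "u \<notin> C" using C that by blast
    have "ndom n E (D \<inter> C) u = 0"
      by (rule ndom_0) (use Cout that \<open>u \<notin> C\<close> C nb_sym[of u] in blast)
    moreover have "ndom n E (H \<union> D) u = 1" using dom low_Suc r that by blast
    moreover have "H \<union> D = (H \<union> D') \<union> (D \<inter> C)" unfolding D'_def by blast
    moreover have "(H \<union> D') \<inter> (D \<inter> C) = {}" using HD unfolding D'_def by blast
    ultimately show ?thesis by (simp add: ndom_Un)
  qed
  show ?thesis
  proof (cases "D \<inter> C = {}")
    case True
    then have "D' = D" unfolding D'_def by blast
    have "\<forall>u<n. in_class n E S r u \<longrightarrow> ndom n E H u = 1"
    proof (intro allI impI)
      fix u assume "u < n" "in_class n E S r u"
      then have "u \<in> C" by (simp add: C_def)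
      then show "ndom n E H u = 1" using cntC[of u] dom[of u] C[of u] True by (simp add: ndom_def)
    qed
    moreover have "partial_solution n E S H w r D x"
      unfolding partial_solution_def using D'sub cntout x \<open>D' = D\<close> by auto
    ultimately show ?thesis by blast
  next
    case False
    then obtain v where v: "v \<in> D \<inter> C" by blast
    then have DC: "D \<inter> C = {v}" using one by blast
    have Dv: "D = insert v D'" "v \<notin> D'" "finite D'" using DC fin unfolding D'_def by auto
    then have xx: "x = wsum n E w v + (\<Sum>v\<in>D'. wsum n E w v)" using x by simp
    have "ndom n E H u + (if nb E u v then 1 else 0) = 1" if "u < n" "in_class n E S r u" for u
    proof -
      have "u \<in> C" using that by (simp add: C_def)
      moreover have "v < n" using C v by blast
      ultimately show ?thesis
        using cntC[of u] dom[of u] C[of u] DC ndom_single[of v n E u] by (simp split: if_splits)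
    qed
    moreover have "partial_solution n E S H w r D' (x - wsum n E w v)"
      unfolding partial_solution_def using D'sub cntout xx by auto
    moreover have "v < n" "in_class n E S r v" using v unfolding C_def by auto
    ultimately show ?thesis using Dv xx by (intro disjI2 exI[of _ v] exI[of _ D']) simp
  qed
qed

lemma partial_solution_Suc_rep_skip:
  assumes r: "r < n" "is_rep n E S r" and H: "H \<subseteq> S"
    and full: "\<forall>u<n. in_class n E S r u \<longrightarrow> ndom n E H u = 1" and sol: "partial_solution n E S H w r D x"
  shows "partial_solution n E S H w (Suc r) D x"
proof -
  have r': "r \<notin> S" "\<not> low n E S r r" using r is_rep_iff by auto
  have D: "D \<subseteq> {v. v < n \<and> v \<notin> S \<and> low n E S r v}"
    using sol unfolding partial_solution_def by auto
  have "ndom n E (H \<union> D) u = 1" if u: "u < n" "u \<notin> S" "low n E S (Suc r) u" for u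
  proof (cases "low n E S r u")
    case True
    then show ?thesis using sol u unfolding partial_solution_def by blast
  next
    case False
    then have "near n E S r u" using u low_Suc r by blast
    then have "ndom n E H u = 1" using full u by (simp add: in_class_def)
    moreover have "ndom n E D u = 0"
    proof (rule ndom_0)
      fix s assume s: "s < n" "s \<in> D"
      show "\<not> nb E u s"
      proof
        assume "nb E u s"
        then have "near n E S s u" using near_sym u s by (simp add: near_def nb_sym)
        then show False using D s u False low_near[of r s u] by blast
      qed
    qed
    moreover have "H \<inter> D = {}" using H D by blast
    ultimately show ?thesis by (simp add: ndom_Un)
  qed
  then show ?thesis using sol D low_Suc[OF r(1)] unfolding partial_solution_def by blast
qed

text \<open>Outside \<open>S\<close> no edge joins \<open>v\<close> to an earlier component, so
  exact domination there is undisturbed, while \<open>D\<close> contributes nothing to the component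
  of \<open>r\<close>.\<close>

lemma partial_solution_Suc_rep_add:
  assumes r: "r < n" "is_rep n E S r" and H: "H \<subseteq> S"
    and v: "v < n" "in_class n E S r v"
    and full: "\<forall>u<n. in_class n E S r u \<longrightarrow> ndom n E H u + (if nb E u v then 1 else 0) = 1"
    and x: "wsum n E w v \<le> x" and sol: "partial_solution n E S H w r D (x - wsum n E w v)"
  shows "partial_solution n E S H w (Suc r) (insert v D) x"
proof -
  have r': "r \<notin> S" "\<not> low n E S r r" using r is_rep_iff by auto
  have D: "D \<subseteq> {v. v < n \<and> v \<notin> S \<and> low n E S r v}" and fin: "finite D"
    using sol unfolding partial_solution_def by (auto intro: finite_subset[of _ "{..<n}"])
  have v': "v \<notin> S" "near n E S r v" using v by (auto simp: in_class_def)
  have vl: "\<not> low n E S r v" using low_near[of r v r] near_sym[of r v] r r' v v' by blast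
  have HD: "H \<inter> insert v D = {}" "v \<notin> D" using H D v' vl by auto
  have "ndom n E (H \<union> insert v D) u = 1" if u: "u < n" "u \<notin> S" "low n E S (Suc r) u" for u
  proof -
    have *: "ndom n E (H \<union> insert v D) u = ndom n E (H \<union> D) u + (if nb E u v then 1 else 0)"
    proof -
      have "H \<union> insert v D = (H \<union> D) \<union> {v}" by blast
      then show ?thesis using HD v ndom_Un[of "H \<union> D" "{v}" n E u] ndom_single[of v n E u] by simp
    qed
    show ?thesis
    proof (cases "low n E S r u")
      case True
      have "\<not> nb E u v"
      proof
        assume "nb E u v"
        then have "near n E S u v" by (simp add: near_def)
        then show False using vl low_near[of r u v] True u v v' by blast
      qed
      then show ?thesis using * True sol u unfolding partial_solution_def by simp
    next
      case False
      then have "near n E S r u" using u low_Suc r by blast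
      then have "ndom n E H u + (if nb E u v then 1 else 0) = 1" using full u by (simp add: in_class_def)
      moreover have "ndom n E D u = 0"
      proof (rule ndom_0)
        fix s assume s: "s < n" "s \<in> D"
        show "\<not> nb E u s"
        proof
          assume "nb E u s"
          then have "near n E S s u" using near_sym u s by (simp add: near_def nb_sym)
          then show False using D s u False low_near[of r s u] by blast
        qed
      qed
      moreover have "H \<inter> D = {}" using HD by blast
      ultimately show ?thesis using * by (simp add: ndom_Un)
    qed
  qed
  moreover have "insert v D \<subseteq> {v. v < n \<and> v \<notin> S \<and> low n E S (Suc r) v}"
    using D v v' low_Suc[OF r(1)] r' by blast
  moreover have "(\<Sum>v\<in>insert v D. wsum n E w v) = x"
    using sol x HD fin unfolding partial_solution_def by simp
  ultimately show ?thesis unfolding partial_solution_def by blast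
qed

text \<open>The recurrence from row \<open>r\<close> to row \<open>Suc r\<close> of the subset sum
  table. The guard \<open>wsum n E w v \<le> x\<close> keeps truncated subtraction from reading
  entry 0 by mistake.\<close>

lemma partial_solution_step:
  assumes "r < n" "H \<subseteq> S"
  shows "(\<exists>D. partial_solution n E S H w (Suc r) D x) \<longleftrightarrow>
    (if is_rep n E S r then
       (\<forall>u<n. in_class n E S r u \<longrightarrow> ndom n E H u = 1) \<and> (\<exists>D. partial_solution n E S H w r D x) \<or>
       (\<exists>v<n. in_class n E S r v \<and>
         (\<forall>u<n. in_class n E S r u \<longrightarrow> ndom n E H u + (if nb E u v then 1 else 0) = 1) \<and>
         wsum n E w v \<le> x \<and> (\<exists>D. partial_solution n E S H w r D (x - wsum n E w v)))
     else \<exists>D. partial_solution n E S H w r D x)"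
proof (cases "is_rep n E S r")
  case True
  show ?thesis
    unfolding if_P[OF True]
  proof (intro iffI)
    assume "\<exists>D. partial_solution n E S H w (Suc r) D x"
    then obtain D where "partial_solution n E S H w (Suc r) D x" ..
    from partial_solution_Suc_rep[OF assms(1) True assms(2) this]
    show "(\<forall>u<n. in_class n E S r u \<longrightarrow> ndom n E H u = 1) \<and> (\<exists>D. partial_solution n E S H w r D x) \<or>
       (\<exists>v<n. in_class n E S r v \<and>
         (\<forall>u<n. in_class n E S r u \<longrightarrow> ndom n E H u + (if nb E u v then 1 else 0) = 1) \<and>
         wsum n E w v \<le> x \<and> (\<exists>D. partial_solution n E S H w r D (x - wsum n E w v)))"
      by (elim disjE conjE exE) (rule disjI1 disjI2; intro conjI exI; assumption)+
  next
    assume "(\<forall>u<n. in_class n E S r u \<longrightarrow> ndom n E H u = 1) \<and> (\<exists>D. partial_solution n E S H w r D x) \<or>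
       (\<exists>v<n. in_class n E S r v \<and>
         (\<forall>u<n. in_class n E S r u \<longrightarrow> ndom n E H u + (if nb E u v then 1 else 0) = 1) \<and>
         wsum n E w v \<le> x \<and> (\<exists>D. partial_solution n E S H w r D (x - wsum n E w v)))"
    then show "\<exists>D. partial_solution n E S H w (Suc r) D x"
    proof (elim disjE conjE exE)
      fix D assume "\<forall>u<n. in_class n E S r u \<longrightarrow> ndom n E H u = 1" "partial_solution n E S H w r D x"
      then show ?thesis using partial_solution_Suc_rep_skip[OF assms(1) True assms(2)] by (intro exI)
    next
      fix v D
      assume "v < n" "in_class n E S r v" "wsum n E w v \<le> x" "partial_solution n E S H w r D (x - wsum n E w v)"
        "\<forall>u<n. in_class n E S r u \<longrightarrow> ndom n E H u + (if nb E u v then 1 else 0) = 1"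
      then show ?thesis using partial_solution_Suc_rep_add[OF assms(1) True assms(2)] by (intro exI)
    qed
  qed
next
  case False
  then show ?thesis using partial_solution_Suc_not_rep[OF assms(1)] by simp
qed

lemma partial_solution_0: "(\<exists>D. partial_solution n E S H w 0 D x) \<longleftrightarrow> x = 0"
  unfolding partial_solution_def low_def by auto

text \<open>A component is skipped only if \<open>H\<close> dominates all of it, and otherwise gets
  exactly one vertex; neither depends on the choice of \<open>D\<close>.\<close>

lemma card_partial_solution:
  assumes "H \<subseteq> S" "r \<le> n" "partial_solution n E S H w r D x"
  shows "card D = nreps n E S H r"
  using assms(2,3)
proof (induction r arbitrary: D x)
  case 0
  then show ?case by (auto simp: partial_solution_def low_def nreps_def)
next
  case (Suc r)
  then have r: "r < n" by simp
  show ?case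
  proof (cases "is_rep n E S r")
    case False
    then show ?thesis using Suc partial_solution_Suc_not_rep[OF r] by (simp add: nreps_def)
  next
    case True
    from partial_solution_Suc_rep[OF r True assms(1) Suc.prems(2)] show ?thesis
    proof (elim disjE exE conjE)
      assume "\<forall>u<n. in_class n E S r u \<longrightarrow> ndom n E H u = 1" "partial_solution n E S H w r D x"
      then show ?thesis using Suc by (auto simp: nreps_def)
    next
      fix v D'
      assume *: "v < n" "in_class n E S r v" "v \<notin> D'" "D = insert v D'" "finite D'"
        "\<forall>u<n. in_class n E S r u \<longrightarrow> ndom n E H u + (if nb E u v then 1 else 0) = 1"
        "partial_solution n E S H w r D' (x - wsum n E w v)"
      \<comment> \<open>The chosen vertex dominates itself, so \<open>H\<close> cannot dominate it
        as well.\<close>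
      have "ndom n E H v = 0" using * by (auto simp: nb_def)
      then have "\<exists>u<n. in_class n E S r u \<and> ndom n E H u = 0" using * by blast
      then show ?thesis using * Suc.IH[OF _ *(7)] r True by (simp add: nreps_def)
    qed
  qed
qed

end

end

section \<open>Sums of weights determine multiplicities\<close>

text \<open>By induction on the lowest bit: a carry out of it would cost two summands and save one.\<close>

lemma binary_sum_unique:
  fixes m t :: "nat \<Rightarrow> nat"
  assumes "\<forall>i<k. t i \<le> 1"
    and "(\<Sum>i<k. m i * 2 ^ i) = (\<Sum>i<k. t i * 2 ^ i) + q * 2 ^ k"
    and "(\<Sum>i<k. m i) \<le> (\<Sum>i<k. t i)"
  shows "\<forall>i<k. m i = t i"
  using assms
proof (induction k arbitrary: m t q)
  case (Suc k)
  define M where "M = (\<Sum>i<k. m (Suc i) * 2 ^ i)"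
  define T where "T = (\<Sum>i<k. t (Suc i) * 2 ^ i)"
  have eq: "m 0 + 2 * M = t 0 + 2 * T + 2 * (q * 2 ^ k)"
    using Suc.prems(2) unfolding sum.lessThan_Suc_shift M_def T_def
    by (simp add: sum_distrib_left mult.left_commute)
  have t0: "t 0 \<le> 1" using Suc.prems(1) by simp
  have "m 0 mod 2 = t 0 mod 2" using arg_cong[OF eq, of "\<lambda>x. x mod 2"] by simp
  then have "m 0 = t 0 + 2 * (m 0 div 2)" using t0 by presburger
  then obtain c where c: "m 0 = t 0 + 2 * c" by blast
  have eq': "M + c = T + q * 2 ^ k" using eq c by simp
  have le: "m 0 + (\<Sum>i<k. m (Suc i)) \<le> t 0 + (\<Sum>i<k. t (Suc i))"
    using Suc.prems(3) unfolding sum.lessThan_Suc_shift by simp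
  show ?case
  proof (cases k)
    \<comment> \<open>There is no higher digit to carry into; the bound on the number of summands
      alone forces \<open>c = 0\<close>.\<close>
    case 0
    then show ?thesis using le c by simp
  next
    case (Suc k')
    \<comment> \<open>The surplus of \<open>2 * c\<close> units of digit 0 becomes \<open>c\<close>
      units of digit 1, so \<open>m'\<close> has at least \<open>c\<close> summands fewer than
      \<open>m\<close>.\<close>
    define m' where "m' i = (if i = 0 then m 1 + c else m (Suc i))" for i
    have M': "(\<Sum>i<k. m' i * 2 ^ i) = M + c" and m': "(\<Sum>i<k. m' i) = (\<Sum>i<k. m (Suc i)) + c"
      unfolding M_def m'_def Suc sum.lessThan_Suc_shift by simp_all
    have "\<forall>i<k. m' i = t (Suc i)"
      using M' m' Suc.IH[of "\<lambda>i. t (Suc i)" m' q] Suc.prems(1) eq' le c unfolding T_def by simp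
    moreover from this have "(\<Sum>i<k. m' i) = (\<Sum>i<k. t (Suc i))" by simp
    then have "c = 0" using m' le c by simp
    moreover have "m' i = m (Suc i)" if "c = 0" for i using that by (simp add: m'_def)
    ultimately show ?thesis using c by (metis add_0_right less_Suc_eq_0_disj mult_0_right)
  qed
qed simp

lemma sum_powers_of_2: "(\<Sum>i<k. (2::nat) ^ i) < 2 ^ k"
  by (induction k) auto

text \<open>The low part \<open>B\<close> stays below \<open>2 ^ k\<close>, so the offsets on the
  left cannot outnumber those on the right. Missing offsets reappear in the low part as a multiple
  of \<open>2 ^ k\<close>, which is the \<open>q\<close> of
  \<open>binary_sum_unique\<close>.\<close>

lemma shifted_binary_sum_unique:
  fixes m t :: "nat \<Rightarrow> nat"
  assumes t: "\<forall>i<k. t i \<le> 1" and eq: "(\<Sum>i<k. m i * (2 ^ k + 2 ^ i)) = (\<Sum>i<k. t i * (2 ^ k + 2 ^ i))"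
  shows "\<forall>i<k. m i = t i"
proof -
  define P :: nat where "P = 2 ^ k"
  define a where "a = (\<Sum>i<k. m i)"
  define b where "b = (\<Sum>i<k. t i)"
  define A where "A = (\<Sum>i<k. m i * 2 ^ i)"
  define B where "B = (\<Sum>i<k. t i * 2 ^ i)"
  have "B \<le> (\<Sum>i<k. 2 ^ i)"
    unfolding B_def using t by (intro sum_mono) auto
  then have B: "B < P" using sum_powers_of_2[of k] unfolding P_def by linarith
  have e: "a * P + A = b * P + B"
    using eq unfolding a_def b_def A_def B_def P_def
    by (simp add: add_mult_distrib2 sum.distrib sum_distrib_right)
  have "a \<le> b"
  proof (rule ccontr)
    assume "\<not> a \<le> b"
    then have "(b + 1) * P \<le> a * P" by (intro mult_right_mono) auto
    then have "b * P + P \<le> a * P" by simp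
    then show False using e B by linarith
  qed
  then have "b * P = a * P + (b - a) * P" by (simp flip: add_mult_distrib)
  then have "A = B + (b - a) * P" using e by linarith
  from binary_sum_unique[OF t this[unfolded A_def B_def P_def] \<open>a \<le> b\<close>[unfolded a_def b_def]]
  show ?thesis .
qed

text \<open>
  The common offset \<open>P\<close>, later \<open>2 ^ k\<close>, bounds the number of weights in a sum of given value.
\<close>

definition good_weights :: "nat \<Rightarrow> nat \<Rightarrow> nat set \<Rightarrow> (nat \<Rightarrow> nat) \<Rightarrow> bool" where
  "good_weights P k S w \<longleftrightarrow> inj_on w S \<and> (\<forall>s. s \<notin> S \<longrightarrow> w s = 0) \<and> (\<forall>s\<in>S. \<exists>j<k. w s = P + 2 ^ j)"

text \<open>Each element of \<open>S\<close> owns one binary position, and unoccupied positions get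
  digit 0. In the application \<open>m\<close> is a domination count, possibly above 1, and
  \<open>t\<close> a demand of 0 or 1.\<close>

lemma good_weights_unique:
  fixes m t :: "nat \<Rightarrow> nat"
  assumes w: "good_weights (2 ^ k) k S w" and t: "\<forall>s\<in>S. t s \<le> 1"
    and eq: "(\<Sum>s\<in>S. m s * w s) = (\<Sum>s\<in>S. t s * w s)"
  shows "\<forall>s\<in>S. m s = t s"
proof -
  obtain f where f: "\<And>s. s \<in> S \<Longrightarrow> f s < k \<and> w s = 2 ^ k + 2 ^ f s"
    using w unfolding good_weights_def by metis
  have inj: "inj_on f S" using w f unfolding good_weights_def inj_on_def by metis
  have sub: "f ` S \<subseteq> {..<k}" using f by auto
  define ext where "ext g i = (if i \<in> f ` S then g (inv_into S f i) else 0)" for g :: "nat \<Rightarrow> nat" and i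
  have ext: "ext g (f s) = g s" if "s \<in> S" for g s
    using that inj by (simp add: ext_def)
  have sum: "(\<Sum>i<k. ext g i * (2 ^ k + 2 ^ i)) = (\<Sum>s\<in>S. g s * w s)" for g
  proof -
    have "(\<Sum>i<k. ext g i * (2 ^ k + 2 ^ i)) = (\<Sum>i\<in>f ` S. ext g i * (2 ^ k + 2 ^ i))"
      by (rule sum.mono_neutral_right) (use sub in \<open>auto simp: ext_def\<close>)
    also have "\<dots> = (\<Sum>s\<in>S. g s * w s)"
      unfolding sum.reindex[OF inj] by (intro sum.cong) (auto simp: ext f)
    finally show ?thesis .
  qed
  have "\<forall>i<k. ext t i \<le> 1" using t by (auto simp: ext_def inv_into_into)
  then have "\<forall>i<k. ext m i = ext t i"
    using shifted_binary_sum_unique[of k "ext t" "ext m"] eq unfolding sum by blast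
  then show ?thesis using ext f by metis
qed

context sgraph
begin

text \<open>Double counting of the edges between \<open>D\<close> and \<open>S\<close>; as the two
  are disjoint, \<open>nb\<close> is plain adjacency here.\<close>

lemma wsum_eq_ndom:
  assumes D: "D \<subseteq> {..<n}" "D \<inter> S = {}" and S: "S \<subseteq> {..<n}" and w: "good_weights P k S w"
  shows "(\<Sum>v\<in>D. wsum n E w v) = (\<Sum>s\<in>S. ndom n E D s * w s)"
proof -
  have fin: "finite D" "finite S" using D S by (auto intro: finite_subset)
  have "wsum n E w v = (\<Sum>s\<in>S. if E v s then w s else 0)" for v
    unfolding wsum_def by (rule sum.mono_neutral_right) (use S w in \<open>auto simp: good_weights_def\<close>)
  then have "(\<Sum>v\<in>D. wsum n E w v) = (\<Sum>v\<in>D. \<Sum>s\<in>S. if E v s then w s else 0)" by simp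
  also have "\<dots> = (\<Sum>s\<in>S. \<Sum>v\<in>D. if E v s then w s else 0)" by (rule sum.swap)
  also have "\<dots> = (\<Sum>s\<in>S. ndom n E D s * w s)"
  proof (rule sum.cong[OF refl])
    fix s assume s: "s \<in> S"
    have "{v. v < n \<and> v \<in> D \<and> nb E s v} = {v\<in>D. E v s}"
      using s D S sym unfolding nb_def by blast
    then show "(\<Sum>v\<in>D. if E v s then w s else 0) = ndom n E D s * w s"
      unfolding ndom_def using fin by (simp add: sum.If_cases Int_def)
  qed
  finally show ?thesis .
qed

lemma target_eq:
  assumes S: "S \<subseteq> {..<n}" and w: "good_weights P k S w"
  shows "target n E H w = (\<Sum>s\<in>S. (if ndom n E H s = 0 then 1 else 0) * w s)"
proof -
  have "target n E H w = (\<Sum>s\<in>S. if ndom n E H s = 0 then w s else 0)"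
    unfolding target_def by (rule sum.mono_neutral_right) (use S w in \<open>auto simp: good_weights_def\<close>)
  also have "\<dots> = (\<Sum>s\<in>S. (if ndom n E H s = 0 then 1 else 0) * w s)"
    by (rule sum.cong) auto
  finally show ?thesis .
qed

text \<open>Equality with the target says that \<open>D\<close> dominates each vertex of
  \<open>S\<close> missed by \<open>H\<close> once, and no other vertex of \<open>S\<close>. The
  weights cannot see a vertex of \<open>S\<close> that \<open>H\<close> alone dominates twice, hence
  the separate condition.\<close>

lemma partial_solution_n_iff_eds:
  assumes clean: "clean n E S" and S: "S \<subseteq> {..<n}" and H: "H \<subseteq> S" and w: "good_weights (2 ^ k) k S w"
    and D: "D \<inter> S = {}"
  shows "partial_solution n E S H w n D (target n E H w) \<and> (\<forall>s<n. s \<in> S \<longrightarrow> ndom n E H s \<le> 1) \<longleftrightarrow> eds n E (H \<union> D)"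
    (is "?L \<longleftrightarrow> ?R")
proof -
  have HD: "H \<inter> D = {}" using H D by blast
  let ?t = "\<lambda>s. if ndom n E H s = 0 then 1 else 0 :: nat"
  show ?thesis
  proof
    assume L: ?L
    then have D': "D \<subseteq> {..<n}" unfolding partial_solution_def by auto
    have "(\<Sum>s\<in>S. ndom n E D s * w s) = (\<Sum>s\<in>S. ?t s * w s)"
      using L wsum_eq_ndom[OF D' D S w] target_eq[OF S w] unfolding partial_solution_def by simp
    then have t: "\<forall>s\<in>S. ndom n E D s = ?t s"
      using good_weights_unique[OF w, of ?t "ndom n E D"] by auto
    have "ndom n E (H \<union> D) u = 1" if "u < n" for u
    proof (cases "u \<in> S")
      case True
      then show ?thesis using t L that ndom_Un[OF HD, of n E u] by (auto simp: le_Suc_eq)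
    next
      case False
      then show ?thesis using L that low_n[OF clean] unfolding partial_solution_def by blast
    qed
    then show ?R using D' H S unfolding eds_def by blast
  next
    assume R: ?R
    then have D': "D \<subseteq> {..<n}" and one: "\<And>u. u < n \<Longrightarrow> ndom n E H u + ndom n E D u = 1"
      using ndom_Un[OF HD] unfolding eds_def by auto
    have t: "ndom n E D s = ?t s" if "s \<in> S" for s
      using one[of s] that S by (auto split: if_splits)
    have "(\<Sum>v\<in>D. wsum n E w v) = target n E H w"
      unfolding wsum_eq_ndom[OF D' D S w] target_eq[OF S w] by (rule sum.cong) (simp_all add: t)
    moreover have "D \<subseteq> {v. v < n \<and> v \<notin> S \<and> low n E S n v}"
      using D D' low_n[OF clean] by blast
    moreover have "\<forall>s<n. s \<in> S \<longrightarrow> ndom n E H s \<le> 1" using one by (metis le_add1)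
    ultimately show ?L using R unfolding partial_solution_def eds_def by blast
  qed
qed

text \<open>Since the trace fixes the size, the bound \<open>l\<close> is tested once, outside the
  table.\<close>

lemma accept_iff:
  assumes clean: "clean n E S" and S: "S \<subseteq> {..<n}" and H: "H \<subseteq> S" and w: "good_weights (2 ^ k) k S w"
  shows "(\<exists>D. partial_solution n E S H w n D (target n E H w)) \<and> (\<forall>s<n. s \<in> S \<longrightarrow> ndom n E H s \<le> 1) \<and>
      card H + nreps n E S H n \<le> l \<longleftrightarrow>
    (\<exists>D. eds n E D \<and> D \<inter> S = H \<and> card D \<le> l)" (is "?L \<longleftrightarrow> ?R")
proof -
  have cardD: "card (H \<union> D) = card H + nreps n E S H n"
    if "partial_solution n E S H w n D (target n E H w)" for D
  proof -
    have "D \<subseteq> {..<n}" "D \<inter> S = {}" using that unfolding partial_solution_def by auto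
    moreover from this have "finite H" "finite D"
      using finite_subset[of H "{..<n}"] finite_subset[of D "{..<n}"] H S by auto
    ultimately have "card (H \<union> D) = card H + card D"
      using H by (intro card_Un_disjoint) auto
    then show ?thesis using card_partial_solution[OF clean H order_refl that] by simp
  qed
  show ?thesis
  proof
    assume L: ?L
    then obtain D where D: "partial_solution n E S H w n D (target n E H w)" by blast
    then have "D \<inter> S = {}" unfolding partial_solution_def by auto
    then have "eds n E (H \<union> D)" "(H \<union> D) \<inter> S = H"
      using partial_solution_n_iff_eds[OF clean S H w] L D H by auto
    then show ?R using cardD[OF D] L by metis
  next
    assume ?R
    then obtain D where D: "eds n E D" "D \<inter> S = H" "card D \<le> l" by blast
    then have *: "(D - S) \<inter> S = {}" "H \<union> (D - S) = D" by auto
    then have "partial_solution n E S H w n (D - S) (target n E H w)" "\<forall>s<n. s \<in> S \<longrightarrow> ndom n E H s \<le> 1"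
      using partial_solution_n_iff_eds[OF clean S H w *(1)] D by auto
    then show ?L using cardD * D by metis
  qed
qed

end

section \<open>The search tree\<close>

definition pick :: "nat \<Rightarrow> (nat \<Rightarrow> nat \<Rightarrow> bool) \<Rightarrow> nat set \<Rightarrow> nat \<times> nat \<times> nat \<times> nat" where
  "pick n E S =
    (let a = LEAST a. a < n \<and> (\<exists>b<n. \<exists>c<n. \<exists>d<n. obstruction n E S a b c d);
         b = LEAST b. b < n \<and> (\<exists>c<n. \<exists>d<n. obstruction n E S a b c d);
         c = LEAST c. c < n \<and> (\<exists>d<n. obstruction n E S a b c d);
         d = LEAST d. d < n \<and> obstruction n E S a b c d
     in (a, b, c, d))"

lemma pick_obstruction:
  assumes "\<not> clean n E S" "pick n E S = (a, b, c, d)"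
  shows "a < n" "b < n" "c < n" "d < n" "obstruction n E S a b c d"
proof -
  have "\<exists>a. a < n \<and> (\<exists>b<n. \<exists>c<n. \<exists>d<n. obstruction n E S a b c d)"
    using assms(1) unfolding clean_def by blast
  from LeastI_ex[OF this] have a: "a < n" "\<exists>b. b < n \<and> (\<exists>c<n. \<exists>d<n. obstruction n E S a b c d)"
    using assms(2) unfolding pick_def by (auto simp: Let_def)
  from LeastI_ex[OF this(2)] have b: "b < n" "\<exists>c. c < n \<and> (\<exists>d<n. obstruction n E S a b c d)"
    using assms(2) unfolding pick_def by (auto simp: Let_def)
  from LeastI_ex[OF this(2)] have c: "c < n" "\<exists>d. d < n \<and> obstruction n E S a b c d"
    using assms(2) unfolding pick_def by (auto simp: Let_def)
  from LeastI_ex[OF this(2)] have d: "d < n" "obstruction n E S a b c d"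
    using assms(2) unfolding pick_def by (auto simp: Let_def)
  show "a < n" "b < n" "c < n" "d < n" "obstruction n E S a b c d" using a b c d by auto
qed

definition sel :: "nat \<Rightarrow> nat \<times> nat \<times> nat \<times> nat \<Rightarrow> nat" where
  "sel q = (\<lambda>(a, b, c, d). if q = 0 then a else if q = 1 then b else if q = 2 then c else d)"

text \<open>A branching step on the digit \<open>q < 8\<close>: the two low bits choose the deleted vertex of the
  obstruction, the high bit tells whether this vertex is put into the dominating set.\<close>

definition branch_step :: "nat \<Rightarrow> (nat \<Rightarrow> nat \<Rightarrow> bool) \<Rightarrow> nat \<Rightarrow> nat \<Rightarrow> nat \<Rightarrow> (nat \<Rightarrow> nat) \<times> (nat \<Rightarrow> nat) \<Rightarrow>
    (nat \<Rightarrow> nat) \<times> (nat \<Rightarrow> nat)" where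
  "branch_step n E P p q = (\<lambda>(w, h). let S = {v. 0 < w v} in
     if clean n E S then (w, h)
     else let z = sel (if 3 < q then q - 4 else q) (pick n E S) in (w(z := P + p), h(z := q - 3)))"

text \<open>Reads \<open>c\<close> as an octal number, lowest digit first. \<open>p\<close> doubles
  with every digit, so all weights get distinct exponents.\<close>

primrec branch :: "nat \<Rightarrow> (nat \<Rightarrow> nat \<Rightarrow> bool) \<Rightarrow> nat \<Rightarrow> nat \<Rightarrow> nat \<Rightarrow> nat \<Rightarrow>
    (nat \<Rightarrow> nat) \<times> (nat \<Rightarrow> nat) \<Rightarrow> (nat \<Rightarrow> nat) \<times> (nat \<Rightarrow> nat)" where
  "branch n E P 0 p c wh = wh"
| "branch n E P (Suc i) p c wh = branch n E P i (2 * p) (c div 8) (branch_step n E P p (c mod 8) wh)"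

definition branch_inv :: "nat \<Rightarrow> nat \<Rightarrow> nat \<Rightarrow> (nat \<Rightarrow> nat) \<times> (nat \<Rightarrow> nat) \<Rightarrow> bool" where
  "branch_inv n P j = (\<lambda>(w, h). let S = {v. 0 < w v} in
     S \<subseteq> {..<n} \<and> card S \<le> j \<and> {v. 0 < h v} \<subseteq> S \<and> good_weights P j S w)"

text \<open>The deleted vertex is new to \<open>S\<close>, and the exponent \<open>j\<close> is new
  among the weights, which keeps them injective.\<close>

lemma branch_inv_step:
  assumes "branch_inv n P j wh" "0 < P"
  shows "branch_inv n P (Suc j) (branch_step n E P (2 ^ j) q wh)"
proof -
  obtain w h where wh: "wh = (w, h)" by fastforce
  define S where "S = {v. 0 < w v}"
  have inv: "S \<subseteq> {..<n}" "card S \<le> j" "{v. 0 < h v} \<subseteq> S" "good_weights P j S w"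
    using assms unfolding branch_inv_def wh S_def by (auto simp: Let_def)
  have good: "good_weights P (Suc j) S w"
    using inv(4) unfolding good_weights_def by (meson less_SucI)
  show ?thesis
  proof (cases "clean n E S")
    case True
    then show ?thesis using inv good unfolding branch_inv_def branch_step_def wh S_def by (auto simp: Let_def)
  next
    case False
    obtain a b c d where p: "pick n E S = (a, b, c, d)" by (metis prod_cases4)
    define z where "z = sel (if 3 < q then q - 4 else q) (pick n E S)"
    have z: "z < n" "z \<notin> S"
      using pick_obstruction[OF False p] unfolding z_def p sel_def obstruction_def by auto
    have st: "branch_step n E P (2 ^ j) q wh = (w(z := P + 2 ^ j), h(z := q - 3))"
      using False unfolding branch_step_def wh z_def S_def by (simp add: Let_def)
    have S': "{v. 0 < (w(z := P + 2 ^ j)) v} = insert z S"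
      unfolding S_def by auto
    have "finite S" using inv(1) finite_subset by blast
    then have "card (insert z S) \<le> Suc j" using inv(2) z by simp
    moreover have "{v. 0 < (h(z := q - 3)) v} \<subseteq> insert z S" using inv(3) by auto
    moreover have "good_weights P (Suc j) (insert z S) (w(z := P + 2 ^ j))"
    proof -
      have ne: "w s \<noteq> P + 2 ^ j" if s: "s \<in> S" for s
      proof -
        obtain i where "i < j" "w s = P + 2 ^ i" using inv(4) s unfolding good_weights_def by blast
        then show ?thesis by simp
      qed
      have "inj_on w S" using inv(4) unfolding good_weights_def by blast
      then have "inj_on (w(z := P + 2 ^ j)) S"
        using z(2) by (metis (no_types, lifting) fun_upd_other inj_on_cong)
      moreover have "(w(z := P + 2 ^ j)) z \<notin> (w(z := P + 2 ^ j)) ` (S - {z})"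
      proof
        assume "(w(z := P + 2 ^ j)) z \<in> (w(z := P + 2 ^ j)) ` (S - {z})"
        then obtain x where "x \<in> S" "x \<noteq> z" "(w(z := P + 2 ^ j)) z = (w(z := P + 2 ^ j)) x" by blast
        then show False using ne[of x] by simp
      qed
      ultimately have "inj_on (w(z := P + 2 ^ j)) (insert z S)"
        by (simp add: inj_on_insert del: fun_upd_apply)
      moreover have "\<exists>i<Suc j. (w(z := P + 2 ^ j)) s = P + 2 ^ i" if "s \<in> insert z S" for s
        using good that z unfolding good_weights_def by (cases "s = z") auto
      moreover have "(w(z := P + 2 ^ j)) s = 0" if "s \<notin> insert z S" for s
        using inv(4) that unfolding good_weights_def by simp
      ultimately show ?thesis unfolding good_weights_def by blast
    qed
    ultimately show ?thesis unfolding st branch_inv_def using inv(1) z by (simp add: S' Let_def del: fun_upd_apply)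
  qed
qed

lemma branch_inv_branch:
  assumes "branch_inv n P j wh" "0 < P"
  shows "branch_inv n P (j + i) (branch n E P i (2 ^ j) c wh)"
  using assms
proof (induction i arbitrary: j c wh)
  case (Suc i)
  then show ?case using branch_inv_step[OF Suc.prems] Suc.IH[of "Suc j"] by (simp add: algebra_simps)
qed simp

text \<open>Enlarging \<open>S\<close> can destroy \<open>near\<close> but never create it, so a
  path untouched by \<open>S'\<close> would remain an obstruction.\<close>

lemma clean_superset_hits:
  assumes "clean n E S'" "S \<subseteq> S'" "obstruction n E S a b c d" "a < n" "b < n" "c < n" "d < n"
  shows "a \<in> S' \<or> b \<in> S' \<or> c \<in> S' \<or> d \<in> S'"
  using assms unfolding clean_def obstruction_def near_def by blast

text \<open>The low bits follow \<open>S'\<close>: every branching deletes a further vertex of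
  \<open>S'\<close>, so \<open>i\<close> digits suffice. The high bits copy \<open>D\<close>. The
  branch may become clean before all of \<open>S'\<close> is deleted.\<close>

lemma branch_complete:
  assumes "clean n E S'" "finite S'" "{v. 0 < w v} \<subseteq> S'" "card S' \<le> card {v. 0 < w v} + i"
    "{v. 0 < h v} = D \<inter> {v. 0 < w v}" "0 < P"
  shows "\<exists>c<8 ^ i. \<exists>w' h'. branch n E P i p c (w, h) = (w', h') \<and> clean n E {v. 0 < w' v} \<and>
    {v. 0 < h' v} = D \<inter> {v. 0 < w' v}"
  using assms(3-5)
proof (induction i arbitrary: p w h)
  case 0
  then have "{v. 0 < w v} = S'" using assms(2) by (simp add: card_subset_eq card_mono order_antisym)
  then show ?case using 0 assms(1) by simp
next
  case (Suc i)
  define S where "S = {v. 0 < w v}"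
  show ?case
  proof (cases "clean n E S")
    case True
    have st: "branch_step n E P p' q (w, h) = (w, h)" for p' q
      using True unfolding branch_step_def S_def by simp
    then have "branch n E P i' p' c (w, h) = (w, h)" for i' p' c
      by (induction i' arbitrary: p' c) simp_all
    \<comment> \<open>A clean set is not changed any more, so every word works; 0 is taken.\<close>
    then show ?thesis using True Suc.prems unfolding S_def
      by (intro exI[of _ 0] exI[of _ w] exI[of _ h] conjI) (simp_all del: branch.simps)
  next
    case False
    obtain a b c d where p: "pick n E S = (a, b, c, d)" by (metis prod_cases4)
    have "a \<in> S' \<or> b \<in> S' \<or> c \<in> S' \<or> d \<in> S'"
      using clean_superset_hits[OF assms(1), of S] pick_obstruction[OF False p] Suc.prems(1) unfolding S_def by blast
    moreover have "sel 0 (pick n E S) = a" "sel 1 (pick n E S) = b" "sel 2 (pick n E S) = c" "sel 3 (pick n E S) = d"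
      unfolding sel_def p by simp_all
    ultimately have "sel 0 (pick n E S) \<in> S' \<or> sel 1 (pick n E S) \<in> S' \<or> sel 2 (pick n E S) \<in> S' \<or> sel 3 (pick n E S) \<in> S'"
      by simp
    then have "\<exists>q0. sel q0 (pick n E S) \<in> S' \<and> q0 < 4"
      by (auto intro: exI[of _ 0] exI[of _ 1] exI[of _ 2] exI[of _ 3] simp del: One_nat_def)
    then obtain q0 where q0: "q0 < 4" "sel q0 (pick n E S) \<in> S'" by blast
    define z where "z = sel q0 (pick n E S)"
    have z: "z \<in> S'" "z \<notin> S"
      using q0 pick_obstruction[OF False p] unfolding z_def p sel_def obstruction_def by auto
    \<comment> \<open>The high bit encodes membership in \<open>D\<close>; the truncated
      \<open>q - 3\<close> is positive exactly if it is set.\<close>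
    define q where "q = (if z \<in> D then q0 + 4 else q0)"
    have q: "q < 8" "(if 3 < q then q - 4 else q) = q0" "0 < q - 3 \<longleftrightarrow> z \<in> D"
      using q0 unfolding q_def by auto
    let ?w = "w(z := P + p)" and ?h = "h(z := q - 3)"
    have st: "branch_step n E P p q (w, h) = (?w, ?h)"
      using False q(2) unfolding branch_step_def z_def S_def by (simp add: Let_def)
    have S: "{v. 0 < ?w v} = insert z S" using assms(6) unfolding S_def by auto
    have "finite S" using Suc.prems(1) assms(2) finite_subset unfolding S_def by blast
    then have "\<exists>c<8 ^ i. \<exists>w' h'. branch n E P i (2 * p) c (?w, ?h) = (w', h') \<and> clean n E {v. 0 < w' v} \<and>
      {v. 0 < h' v} = D \<inter> {v. 0 < w' v}"
      using z Suc.prems q(3) unfolding S_def[symmetric]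
      by (intro Suc.IH) (simp_all only: S, auto)
    then obtain c where c: "c < 8 ^ i" "\<exists>w' h'. branch n E P i (2 * p) c (?w, ?h) = (w', h') \<and>
      clean n E {v. 0 < w' v} \<and> {v. 0 < h' v} = D \<inter> {v. 0 < w' v}" by blast
    have "8 * c + q < 8 ^ Suc i" "(8 * c + q) mod 8 = q" "(8 * c + q) div 8 = c"
      using c(1) q(1) by simp_all
    then show ?thesis using c(2) st by (intro exI[of _ "8 * c + q"]) simp
  qed
qed

text \<open>There are at most \<open>k\<close> weights of at most \<open>2 * 2 ^ k\<close> each. One
  register therefore bounds both the words and the columns of the table.\<close>

lemma target_bound:
  assumes "good_weights (2 ^ k) k S w" "S \<subseteq> {..<n}" "card S \<le> k"
  shows "target n E H w < 8 ^ k"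
proof -
  have "target n E H w \<le> (\<Sum>s<n. w s)"
    unfolding target_def by (rule sum_mono) simp
  also have "\<dots> = (\<Sum>s\<in>S. w s)"
    by (rule sum.mono_neutral_right) (use assms in \<open>auto simp: good_weights_def\<close>)
  also have "\<dots> \<le> (\<Sum>s\<in>S. 2 * 2 ^ k)"
  proof (rule sum_mono)
    fix s assume "s \<in> S"
    then obtain j where "j < k" "w s = 2 ^ k + 2 ^ j" using assms(1) unfolding good_weights_def by blast
    moreover have "(2::nat) ^ j \<le> 2 ^ k" using \<open>j < k\<close> by (intro power_increasing) auto
    ultimately show "w s \<le> 2 * 2 ^ k" by simp
  qed
  also have "\<dots> \<le> k * (2 * 2 ^ k)" using assms(3) by simp
  also have "\<dots> < 8 ^ k"
  proof (induction k)
    case (Suc k)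
    have "(2::nat) ^ k \<le> 8 ^ k" by (rule power_mono) auto
    then show ?case using Suc by simp
  qed simp
  finally show ?thesis .
qed

section \<open>Connection with the graph library\<close>

text \<open>With unit costs a walk costs its length, and the distance is an infimum over walks; if
  all had length 3 or more, so would the infimum.\<close>

lemma graph_dist_le_2D:
  assumes wf: "wf_digraph K" and dist: "graph_dist K a d \<le> 2"
  shows "a = d \<or> (\<exists>e\<in>arcs K. tail K e = a \<and> head K e = d) \<or>
    (\<exists>e\<in>arcs K. \<exists>e'\<in>arcs K. tail K e = a \<and> head K e = tail K e' \<and> head K e' = d)"
proof (rule ccontr)
  assume not: "\<not> ?thesis"
  interpret K: wf_digraph K by (rule wf)
  have "3 \<le> length p" if p: "K.awalk a p d" for p
  proof (rule ccontr)
    assume "\<not> 3 \<le> length p"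
    then consider "p = []" | e where "p = [e]" | e e' where "p = [e, e']"
      by (cases p rule: list.exhaust[case_names Nil Cons]; cases "tl p"; cases "tl (tl p)") auto
    then show False
      using p not by cases (auto simp: K.awalk_simps)
  qed
  moreover have "K.awalk_cost (\<lambda>_. 1) p = length p" for p
    by (induction p) auto
  ultimately have "3 \<le> graph_dist K a d"
    unfolding graph_dist_def K.\<mu>_def by (intro INF_greatest) simp
  then have "(3::ereal) \<le> 2" using dist by (rule order_trans)
  then show False by simp
qed

text \<open>The path puts \<open>a\<close> and \<open>d\<close> into one component, and a short walk
  inside that component avoids \<open>S\<close>. This direction bounds the depth of the search by
  \<open>two_ccvd\<close>; the answer itself is justified from \<open>clean\<close>.\<close>

lemma clean_if_deletion_set:
  assumes G: "pair_graph G" and V: "pverts G = {..<n}" and E: "\<And>u v. E u v \<longleftrightarrow> (u, v) \<in> parcs G"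
    and S: "two_club_deletion_set (with_proj G) S"
  shows "clean n E S"
  unfolding clean_def
proof (intro notI, elim exE conjE)
  fix a b c d
  assume less: "a < n" "b < n" "c < n" "d < n" and obstruction: "obstruction n E S a b c d"
  define H where "H = with_proj G \<restriction> ({..<n} - S)"
  interpret pair_graph G by (rule G)
  interpret H: wf_digraph H unfolding H_def by (rule wellformed_induce_subgraph)
  have sym: "(u, v) \<in> parcs G \<Longrightarrow> (v, u) \<in> parcs G" for u v
    using pair_sym_arcs by (simp add: symmetric_def sym_def)
  have adj: "u \<rightarrow>\<^bsub>H\<^esub> v" if "E u v" "u < n" "u \<notin> S" "v < n" "v \<notin> S" for u v
    by (rule H.dominatesI[of "(u, v)"]) (use that E in \<open>auto simp: H_def arc_to_ends_def\<close>)
  have symH: "symmetric H"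
    unfolding symmetric_def sym_def
  proof (intro allI impI)
    fix u v assume "u \<rightarrow>\<^bsub>H\<^esub> v"
    then have "(u, v) \<in> parcs G" "u < n" "u \<notin> S" "v < n" "v \<notin> S"
      by (auto simp: H_def arcs_ends_def arc_to_ends_def)
    then show "v \<rightarrow>\<^bsub>H\<^esub> u" using adj[of v u] E sym by blast
  qed
  have ad: "a \<rightarrow>\<^sup>*\<^bsub>H\<^esub> d"
    using obstruction less adj[of a b] adj[of b c] adj[of c d]
    by (auto simp: obstruction_def intro: H.adj_reachable_trans)
  then have da: "d \<rightarrow>\<^sup>*\<^bsub>H\<^esub> a" using symmetric_reachable[OF symH] by blast
  have "a \<in> verts H" using ad H.reachable_in_verts by blast
  then have "H \<restriction> H.scc_of a \<in> H.sccs" by (intro H.in_verts_sccsD_sccs H.scc_of_in_sccs_verts)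
  then have "two_club (H \<restriction> H.scc_of a)"
    using S V unfolding two_club_deletion_set_def H_def by simp
  moreover have "a \<in> H.scc_of a" "d \<in> H.scc_of a"
    using ad da \<open>a \<in> verts H\<close> by (auto simp: H.scc_of_def)
  ultimately have "graph_dist (H \<restriction> H.scc_of a) a d \<le> 2" unfolding two_club_def by simp
  from graph_dist_le_2D[OF H.wellformed_induce_subgraph this] have "near n E S a d"
    unfolding near_def nb_def E by (auto simp: H_def)
  then show False using obstruction unfolding obstruction_def by blast
qed

lemma two_ccvd_attained:
  assumes "pair_graph G"
  shows "\<exists>S. two_club_deletion_set (with_proj G) S \<and> card S = two_ccvd (with_proj G)"
proof -
  have "two_club_deletion_set (with_proj G) (pverts G)"
    unfolding two_club_deletion_set_def
  proof (intro conjI ballI)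
    fix C assume "C \<in> pre_digraph.sccs (with_proj G \<restriction> (verts (with_proj G) - pverts G))"
    then have "verts C = {}"
      unfolding pre_digraph.sccs_def by (auto simp: induced_subgraph_def subgraph_def)
    then show "two_club C" by (simp add: two_club_def)
  qed simp
  then have "\<exists>k S. two_club_deletion_set (with_proj G) S \<and> card S = k" by blast
  then show ?thesis unfolding two_ccvd_def by (rule LeastI_ex)
qed

lemma eds_iff:
  assumes G: "pair_graph G" and V: "pverts G = {..<n}" and E: "\<And>u v. E u v \<longleftrightarrow> (u, v) \<in> parcs G"
  shows "eds n E D \<longleftrightarrow> efficient_dominating_set (with_proj G) D"
proof -
  have "closed_nbhd (with_proj G) v \<inter> D = {s. s < n \<and> s \<in> D \<and> nb E v s}" if "D \<subseteq> {..<n}" for v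
    using that by (auto simp: closed_nbhd_def nb_def E)
  then show ?thesis
    unfolding eds_def efficient_dominating_set_def ndom_def using V by auto
qed

section \<open>The algorithm as a loop program\<close>

text \<open>Positive numbers count as true, so truncated subtraction is comparison and addition is
  disjunction. \<open>IndE\<close> normalises to 0 or 1 where truth values are counted.\<close>

definition NotE :: "xexp \<Rightarrow> xexp" where "NotE e = Sub (Lit 1) e"
definition AndE :: "xexp \<Rightarrow> xexp \<Rightarrow> xexp" where "AndE a b = Cnd a b (Lit 0)"
definition OrE :: "xexp \<Rightarrow> xexp \<Rightarrow> xexp" where "OrE a b = Add a b"
definition ImpE :: "xexp \<Rightarrow> xexp \<Rightarrow> xexp" where "ImpE a b = Cnd a b (Lit 1)"
definition LtE :: "xexp \<Rightarrow> xexp \<Rightarrow> xexp" where "LtE a b = Sub b a"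
definition EqE :: "xexp \<Rightarrow> xexp \<Rightarrow> xexp" where "EqE a b = NotE (Add (Sub a b) (Sub b a))"
definition ExE :: "nat \<Rightarrow> xexp \<Rightarrow> xexp" where "ExE x e = Sum x 0 e"
definition AllE :: "nat \<Rightarrow> xexp \<Rightarrow> xexp" where "AllE x e = NotE (ExE x (NotE e))"
definition IndE :: "xexp \<Rightarrow> xexp" where "IndE e = Cnd e (Lit 1) (Lit 0)"
definition ArrE :: "nat \<Rightarrow> xexp \<Rightarrow> xexp" where
  "ArrE j e = Ld (Add (Var 3) (Add (Add (Add e e) (Add e e)) (Lit j)))"

definition ar :: "state \<Rightarrow> nat \<Rightarrow> nat \<Rightarrow> nat" where
  "ar s j i = snd s (fst s 3 + (4 * i + j))"

text \<open>The range check confines the relation to the matrix, so it is independent of the cells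
  behind it, where the arrays live.\<close>

definition edge :: "nat \<Rightarrow> (nat \<Rightarrow> nat) \<Rightarrow> nat \<Rightarrow> nat \<Rightarrow> bool" where
  "edge n inp u v \<longleftrightarrow> u < n \<and> v < n \<and> 0 < inp (3 + (n * u + v))"

abbreviation adj :: "state \<Rightarrow> nat \<Rightarrow> nat \<Rightarrow> bool" where
  "adj s \<equiv> edge (fst s 0) (snd s)"

abbreviation support :: "(nat \<Rightarrow> nat) \<Rightarrow> nat set" where
  "support f \<equiv> {v. 0 < f v}"

lemma sum_nat_pos_iff: "0 < (\<Sum>i<(n::nat). f i :: nat) \<longleftrightarrow> (\<exists>i<n. 0 < f i)"
  by (metis finite_lessThan lessThan_iff neq0_conv sum_eq_0_iff)

lemma sum_indicator: "(\<Sum>i<(n::nat). if P i then 1 else 0 :: nat) = card {i. i < n \<and> P i}"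
proof -
  have "{..<n} \<inter> Collect P = {i. i < n \<and> P i}" by auto
  then show ?thesis by (simp add: sum.If_cases)
qed

lemma tr_simps [simp]:
  "0 < xval (NotE e) s \<longleftrightarrow> \<not> 0 < xval e s"
  "0 < xval (AndE a b) s \<longleftrightarrow> 0 < xval a s \<and> 0 < xval b s"
  "0 < xval (OrE a b) s \<longleftrightarrow> 0 < xval a s \<or> 0 < xval b s"
  "0 < xval (ImpE a b) s \<longleftrightarrow> (0 < xval a s \<longrightarrow> 0 < xval b s)"
  "0 < xval (LtE a b) s \<longleftrightarrow> xval a s < xval b s"
  "0 < xval (EqE a b) s \<longleftrightarrow> xval a s = xval b s"
  "0 < xval (ExE x e) s \<longleftrightarrow> (\<exists>i<fst s 0. 0 < xval e (upd x i s))"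
  "0 < xval (AllE x e) s \<longleftrightarrow> (\<forall>i<fst s 0. 0 < xval e (upd x i s))"
  "0 < xval (IndE e) s \<longleftrightarrow> 0 < xval e s"
  unfolding NotE_def AndE_def OrE_def ImpE_def LtE_def EqE_def ExE_def AllE_def IndE_def
  by (auto simp: sum_nat_pos_iff Suc_le_eq)

lemma xval_IndE [simp]: "xval (IndE e) s = (if 0 < xval e s then 1 else 0)"
  by (simp add: IndE_def)

lemma xval_ArrE [simp]: "xval (ArrE j e) s = ar s j (xval e s)"
  by (auto simp: ArrE_def ar_def intro!: arg_cong[where f = "snd s"])

lemma ar_upd [simp]: "x \<noteq> 3 \<Longrightarrow> ar (upd x v s) j = ar s j"
  by (simp add: ar_def fun_eq_iff)

lemma wfx_simps [simp]:
  "wfx d (NotE e) = wfx d e"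
  "wfx d (AndE a b) = (wfx d a \<and> wfx d b)"
  "wfx d (OrE a b) = (wfx d a \<and> wfx d b)"
  "wfx d (ImpE a b) = (wfx d a \<and> wfx d b)"
  "wfx d (LtE a b) = (wfx d b \<and> wfx d a)"
  "wfx d (EqE a b) = (wfx d a \<and> wfx d b)"
  "wfx d (ExE x e) = (3 < x \<and> x < d \<and> wfx d e)"
  "wfx d (AllE x e) = (3 < x \<and> x < d \<and> wfx d e)"
  "wfx d (IndE e) = wfx d e"
  "wfx d (ArrE j e) = (3 < d \<and> wfx d e)"
  unfolding NotE_def AndE_def OrE_def ImpE_def LtE_def EqE_def ExE_def AllE_def IndE_def ArrE_def
  by auto

text \<open>\<open>Sum 16 0 (Var x)\<close> is the product \<open>n * x\<close>. Register 16 is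
  bound by it, whence the side conditions \<open>x \<noteq> 16\<close> below; the other bound
  registers lead to similar ones.\<close>

definition EE :: "nat \<Rightarrow> nat \<Rightarrow> xexp" where
  "EE x y = AndE (LtE (Var x) (Var 0)) (AndE (LtE (Var y) (Var 0))
     (Ld (Add (Lit 3) (Add (Sum 16 0 (Var x)) (Var y)))))"

lemma tr_EE [simp]: "x \<noteq> 16 \<Longrightarrow> 0 < xval (EE x y) s \<longleftrightarrow> adj s (fst s x) (fst s y)"
  by (simp add: EE_def edge_def)

definition nbE :: "nat \<Rightarrow> nat \<Rightarrow> xexp" where
  "nbE x y = OrE (EqE (Var x) (Var y)) (EE x y)"

lemma tr_nbE [simp]: "x \<noteq> 16 \<Longrightarrow> 0 < xval (nbE x y) s \<longleftrightarrow> nb (adj s) (fst s x) (fst s y)"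
  by (simp add: nbE_def nb_def)

definition nearE :: "nat \<Rightarrow> nat \<Rightarrow> xexp" where
  "nearE x y = OrE (nbE x y) (ExE 17 (AndE (NotE (ArrE 0 (Var 17))) (AndE (EE x 17) (EE 17 y))))"

lemma tr_nearE [simp]:
  "x \<noteq> 16 \<Longrightarrow> x \<noteq> 17 \<Longrightarrow> y \<noteq> 17 \<Longrightarrow>
   0 < xval (nearE x y) s \<longleftrightarrow> near (fst s 0) (adj s) (support (ar s 0)) (fst s x) (fst s y)"
  by (simp add: nearE_def near_def)

definition obsE :: xexp where
  "obsE = AndE (NotE (ArrE 0 (Var 10))) (AndE (NotE (ArrE 0 (Var 11))) (AndE (NotE (ArrE 0 (Var 12)))
     (AndE (NotE (ArrE 0 (Var 13))) (AndE (EE 10 11) (AndE (EE 11 12) (AndE (EE 12 13) (NotE (nearE 10 13))))))))"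

lemma tr_obsE [simp]:
  "0 < xval obsE s \<longleftrightarrow> obstruction (fst s 0) (adj s) (support (ar s 0)) (fst s 10) (fst s 11) (fst s 12) (fst s 13)"
  by (simp add: obsE_def obstruction_def)

definition cleanE :: xexp where
  "cleanE = NotE (ExE 10 (ExE 11 (ExE 12 (ExE 13 obsE))))"

lemma tr_cleanE [simp]: "0 < xval cleanE s \<longleftrightarrow> clean (fst s 0) (adj s) (support (ar s 0))"
  by (simp add: cleanE_def clean_def)

definition cntE :: "nat \<Rightarrow> xexp" where
  "cntE u = Sum 23 0 (IndE (AndE (ArrE 1 (Var 23)) (nbE u 23)))"

lemma xval_cntE [simp]:
  "u \<noteq> 16 \<Longrightarrow> u \<noteq> 23 \<Longrightarrow> xval (cntE u) s = ndom (fst s 0) (adj s) (support (ar s 1)) (fst s u)"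
  by (simp add: cntE_def ndom_def sum_indicator)

definition wsumE :: "nat \<Rightarrow> xexp" where
  "wsumE v = Sum 23 0 (Cnd (EE v 23) (ArrE 0 (Var 23)) (Lit 0))"

lemma xval_wsumE [simp]:
  "v \<noteq> 16 \<Longrightarrow> v \<noteq> 23 \<Longrightarrow> xval (wsumE v) s = wsum (fst s 0) (adj s) (ar s 0) (fst s v)"
  by (auto simp: wsumE_def wsum_def intro!: sum.cong)

definition inclsE :: "nat \<Rightarrow> nat \<Rightarrow> xexp" where
  "inclsE r u = AndE (NotE (ArrE 0 (Var u))) (nearE r u)"

lemma tr_inclsE [simp]:
  "r \<noteq> 16 \<Longrightarrow> r \<noteq> 17 \<Longrightarrow> u \<noteq> 17 \<Longrightarrow>
   0 < xval (inclsE r u) s \<longleftrightarrow> in_class (fst s 0) (adj s) (support (ar s 0)) (fst s r) (fst s u)"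
  by (simp add: inclsE_def in_class_def)

definition isrepE :: "nat \<Rightarrow> xexp" where
  "isrepE r = AndE (NotE (ArrE 0 (Var r)))
     (AllE 18 (ImpE (LtE (Var 18) (Var r)) (ImpE (NotE (ArrE 0 (Var 18))) (NotE (nearE 18 r)))))"

lemma tr_isrepE [simp]:
  "r \<noteq> 17 \<Longrightarrow> r \<noteq> 18 \<Longrightarrow> 0 < xval (isrepE r) s \<longleftrightarrow> is_rep (fst s 0) (adj s) (support (ar s 0)) (fst s r)"
  by (simp add: isrepE_def is_rep_def)

definition targetE :: xexp where
  "targetE = Sum 18 0 (Cnd (cntE 18) (Lit 0) (ArrE 0 (Var 18)))"

lemma xval_targetE [simp]: "xval targetE s = target (fst s 0) (adj s) (support (ar s 1)) (ar s 0)"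
  by (auto simp: targetE_def target_def intro: sum.cong)

definition sizeE :: xexp where
  "sizeE = Add (Sum 18 0 (IndE (ArrE 1 (Var 18))))
     (Sum 20 0 (IndE (AndE (isrepE 20) (ExE 18 (AndE (inclsE 20 18) (NotE (cntE 18)))))))"

lemma xval_sizeE [simp]:
  "xval sizeE s = card {v. v < fst s 0 \<and> 0 < ar s 1 v} +
     nreps (fst s 0) (adj s) (support (ar s 0)) (support (ar s 1)) (fst s 0)"
  by (simp add: sizeE_def nreps_def sum_indicator)

definition dpE :: xexp where
  "dpE = Cnd (isrepE 20)
     (OrE (AndE (AllE 18 (ImpE (inclsE 20 18) (EqE (cntE 18) (Lit 1)))) (ArrE 2 (Var 21)))
       (ExE 19 (AndE (inclsE 20 19)
         (AndE (AllE 18 (ImpE (inclsE 20 18) (EqE (Add (cntE 18) (IndE (nbE 18 19))) (Lit 1))))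
         (AndE (NotE (LtE (Var 21) (wsumE 19))) (ArrE 2 (Sub (Var 21) (wsumE 19))))))))
     (ArrE 2 (Var 21))"

lemma tr_dpE:
  fixes s
  defines "n \<equiv> fst s 0" and "r \<equiv> fst s 20" and "x \<equiv> fst s 21" and "S \<equiv> support (ar s 0)"
    and "H \<equiv> support (ar s 1)" and "E \<equiv> adj s" and "w \<equiv> ar s 0"
  shows "0 < xval dpE s \<longleftrightarrow>
    (if is_rep n E S r then
       (\<forall>u<n. in_class n E S r u \<longrightarrow> ndom n E H u = 1) \<and> 0 < ar s 2 x \<or>
       (\<exists>v<n. in_class n E S r v \<and>
         (\<forall>u<n. in_class n E S r u \<longrightarrow> ndom n E H u + (if nb E u v then 1 else 0) = 1) \<and>
         wsum n E w v \<le> x \<and> 0 < ar s 2 (x - wsum n E w v))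
     else 0 < ar s 2 x)"
  unfolding dpE_def assms by (simp add: not_less)

text \<open>Cell 1 holds the absolute value of the bound and cell 2 marks a negative one, which is
  refused.\<close>

definition acceptE :: xexp where
  "acceptE = AndE (ArrE 2 targetE) (AndE (AllE 18 (ImpE (ArrE 0 (Var 18)) (LtE (cntE 18) (Lit 2))))
     (AndE (NotE (LtE (Ld (Lit 1)) sizeE)) (NotE (Ld (Lit 2)))))"

lemma tr_acceptE:
  fixes s
  defines "n \<equiv> fst s 0" and "S \<equiv> support (ar s 0)" and "H \<equiv> support (ar s 1)" and "E \<equiv> adj s"
  shows "0 < xval acceptE s \<longleftrightarrow> 0 < ar s 2 (target n E H (ar s 0)) \<and>
    (\<forall>u<n. u \<in> S \<longrightarrow> ndom n E H u \<le> 1) \<and>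
    card {v. v < n \<and> 0 < ar s 1 v} + nreps n E S H n \<le> snd s 1 \<and> snd s 2 = 0"
  unfolding acceptE_def assms by (auto simp: not_less)

text \<open>The least \<open>i\<close> satisfying \<open>e\<close> is the number of those \<open>j\<close> such that no \<open>i \<le> j\<close> satisfies \<open>e\<close>.\<close>

definition MuE :: "nat \<Rightarrow> xexp \<Rightarrow> xexp" where
  "MuE x e = Sum 26 0 (NotE (Sum x 0 (AndE (NotE (LtE (Var 26) (Var x))) e)))"

lemma xval_MuE:
  assumes x: "x \<noteq> 0" "x \<noteq> 26" and P: "\<And>i j. 0 < xval e (upd x i (upd 26 j s)) \<longleftrightarrow> P i"
    and ex: "\<exists>i<fst s 0. P i"
  shows "xval (MuE x e) s = (LEAST i. i < fst s 0 \<and> P i)"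
proof -
  define n where "n = fst s 0"
  define l where "l = (LEAST i. i < n \<and> P i)"
  have l: "l < n" "P l" using ex LeastI_ex[of "\<lambda>i. i < n \<and> P i"] unfolding l_def n_def by auto
  have least: "l \<le> i" if "i < n" "P i" for i
    unfolding l_def using that by (intro Least_le) simp
  have "xval (NotE (Sum x 0 (AndE (NotE (LtE (Var 26) (Var x))) e))) (upd 26 j s) =
    (if j < l then 1 else 0)" if "j < n" for j
  proof -
    have "0 < xval (Sum x 0 (AndE (NotE (LtE (Var 26) (Var x))) e)) (upd 26 j s) \<longleftrightarrow> \<not> j < l"
      using x l least by (auto simp: sum_nat_pos_iff P n_def[symmetric] not_less intro: le_trans)
    then show ?thesis by (auto simp: NotE_def simp del: xval.simps(7))
  qed
  then have "xval (MuE x e) s = (\<Sum>j<n. if j < l then 1 else 0)"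
    unfolding MuE_def n_def by simp
  also have "\<dots> = l"
  proof -
    have "{i. i < n \<and> i < l} = {..<l}" using l by auto
    then show ?thesis by (simp add: sum_indicator)
  qed
  finally show ?thesis unfolding l_def n_def .
qed

text \<open>\<open>i < c div 8\<close> holds exactly if \<open>8 * i + 7 < c\<close>, so division
  becomes counting.\<close>

definition div8E :: xexp where
  "div8E = Sum 26 2 (IndE (LtE (Add (Add (Add (Add (Var 26) (Var 26)) (Add (Var 26) (Var 26)))
     (Add (Add (Var 26) (Var 26)) (Add (Var 26) (Var 26)))) (Lit 7)) (Var 7)))"

lemma xval_div8E:
  assumes "fst s 7 \<le> fst s 2"
  shows "xval div8E s = fst s 7 div 8"
proof -
  have "{i. i < fst s 2 \<and> 8 * i + 7 < fst s 7} = {..<fst s 7 div 8}"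
    using assms by auto
  then have "card {i. i < fst s 2 \<and> 8 * i + 7 < fst s 7} = fst s 7 div 8" by simp
  then show ?thesis by (simp add: div8E_def sum_indicator)
qed

text \<open>
  Registers: 0 the number of vertices, 1 the depth \<open>k\<close>, 2 the bound \<open>8 ^ k\<close>, 3 the base address of the
  arrays, 4 whether some \<open>S\<close> was found, 5 the answer, 6 the current word as an octal number, 7 its
  remaining digits, 8 the power of 2 for the next weight, 9 the number \<open>2 ^ k\<close>. Arrays: 0 the weights
  (nonzero exactly on \<open>S\<close>), 1 the trace \<open>H\<close>, 2 and 3 the old and the new row of the subset sum table.
\<close>

definition stepS :: stm where
  "stepS =
     Set 24 cleanE ;;
     Set 10 (MuE 10 (ExE 11 (ExE 12 (ExE 13 obsE)))) ;;
     Set 11 (MuE 11 (ExE 12 (ExE 13 obsE))) ;;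
     Set 12 (MuE 12 (ExE 13 obsE)) ;;
     Set 13 (MuE 13 obsE) ;;
     Set 25 div8E ;;
     Set 15 (Sub (Var 7) (Add (Add (Add (Var 25) (Var 25)) (Add (Var 25) (Var 25)))
       (Add (Add (Var 25) (Var 25)) (Add (Var 25) (Var 25))))) ;;
     Set 27 (Cnd (LtE (Lit 3) (Var 15)) (Sub (Var 15) (Lit 4)) (Var 15)) ;;
     Set 14 (Cnd (EqE (Var 27) (Lit 0)) (Var 10) (Cnd (EqE (Var 27) (Lit 1)) (Var 11)
       (Cnd (EqE (Var 27) (Lit 2)) (Var 12) (Var 13)))) ;;
     Put 0 (Var 14) (Cnd (Var 24) (ArrE 0 (Var 14)) (Add (Var 9) (Var 8))) ;;
     Put 1 (Var 14) (Cnd (Var 24) (ArrE 1 (Var 14)) (Sub (Var 15) (Lit 3))) ;;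
     Set 8 (Add (Var 8) (Var 8)) ;;
     Set 7 (Var 25)"

text \<open>The recurrence reads smaller columns of the old row while columns are written in
  ascending order, hence the separate array for the new row.\<close>

definition dpS :: stm where
  "dpS = For 21 2 (Put 3 (Var 21) dpE) ;; For 21 2 (Put 2 (Var 21) (ArrE 3 (Var 21)))"

text \<open>There are no conditional statements, so the table is computed for every word; register
  24 masks the answer if the branch did not end in a clean set.\<close>

definition codeS :: stm where
  "codeS =
     For 19 0 (Put 0 (Var 19) (Lit 0)) ;;
     For 19 0 (Put 1 (Var 19) (Lit 0)) ;;
     Set 7 (Var 6) ;;
     Set 8 (Lit 1) ;;
     For 22 1 stepS ;;
     For 21 2 (Put 2 (Var 21) (EqE (Var 21) (Lit 0))) ;;
     For 20 0 dpS ;;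
     Set 24 cleanE ;;
     Set 5 (Cnd (Var 5) (Lit 1) (IndE (AndE (Var 24) acceptE))) ;;
     Set 4 (OrE (Var 4) (Var 24))"

definition bodyS :: stm where
  "bodyS =
     Set 4 (Lit 0) ;;
     Set 5 (Lit 0) ;;
     Set 9 (Lit 1) ;;
     For 22 1 (Set 9 (Add (Var 9) (Var 9))) ;;
     For 6 2 codeS"

lemmas exp_defs = EE_def nbE_def nearE_def obsE_def cleanE_def cntE_def wsumE_def inclsE_def isrepE_def
  targetE_def sizeE_def dpE_def acceptE_def MuE_def div8E_def

lemma wfs_stepS: "wfs 28 stepS"
  by (simp add: stepS_def exp_defs)

lemma wfs_dpS: "wfs 28 dpS"
  by (simp add: dpS_def exp_defs)

lemma wfs_codeS: "wfs 28 codeS"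
  by (simp add: codeS_def wfs_stepS wfs_dpS exp_defs)

lemma wfs_bodyS: "wfs 28 bodyS"
  by (simp add: bodyS_def wfs_codeS)

section \<open>Frame properties of loop programs\<close>

primrec wregs :: "stm \<Rightarrow> nat set" where
  "wregs (Set x e) = {x}"
| "wregs (Put j a e) = {}"
| "wregs (c1 ;; c2) = wregs c1 \<union> wregs c2"
| "wregs (For x b c) = insert x (wregs c)"

primrec warrs :: "stm \<Rightarrow> nat set" where
  "warrs (Set x e) = {}"
| "warrs (Put j a e) = {j}"
| "warrs (c1 ;; c2) = warrs c1 \<union> warrs c2"
| "warrs (For x b c) = warrs c"

text \<open>The four arrays occupy different residues modulo 4, so their cells never
  collide.\<close>

lemma ar_put:
  assumes "j < 4" "j' < 4"
  shows "ar (fst s, (snd s)(fst s 3 + (4 * i + j) := v)) j' = (if j' = j then (ar s j)(i := v) else ar s j')"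
proof -
  have "4 * i' + j' = 4 * i + j \<longleftrightarrow> i' = i \<and> j' = j" for i'
    using assms by presburger
  then show ?thesis by (auto simp: ar_def fun_eq_iff)
qed

lemma ar_sem_Put:
  assumes "j < 4" "j' < 4"
  shows "ar (sem (Put j a e) s) j' = (if j' = j then (ar s j)(xval a s := xval e s) else ar s j')"
  using ar_put[OF assms] by simp

lemma sem_wregs: "x \<notin> wregs c \<Longrightarrow> fst (sem c s) x = fst s x"
proof (induction c arbitrary: s)
  case (For y b c)
  have "fst (fold (\<lambda>i s. sem c (upd y i s)) is s) x = fst s x" for "is"
    by (induction "is" arbitrary: s) (use For in auto)
  then show ?case by simp
qed auto

lemma sem_warrs:
  assumes "wfs d c" "j \<notin> warrs c" "j < 4" "warrs c \<subseteq> {..<4}"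
  shows "ar (sem c s) j = ar s j"
  using assms
proof (induction c arbitrary: s)
  case (For y b c)
  have "ar (fold (\<lambda>i s. sem c (upd y i s)) is s) j = ar s j" for "is"
    by (induction "is" arbitrary: s) (use For in auto)
  then show ?case by simp
qed (auto simp: ar_put)

text \<open>All writes go to addresses from the value of register 3 on, and this register never
  changes.\<close>

lemma sem_input:
  assumes "wfs d c" "a < fst s 3"
  shows "snd (sem c s) a = snd s a"
  using assms
proof (induction c arbitrary: s)
  case (For y b c)
  have "snd (fold (\<lambda>i s. sem c (upd y i s)) is s) a = snd s a" for "is"
    using For.prems(2)
  proof (induction "is" arbitrary: s)
    case (Cons i "is")
    then show ?case using For sem_frame_reg[of d c 3] by simp
  qed simp
  then show ?case by simp
next
  case (Sq c1 c2)
  then show ?case using sem_frame_reg[of d c1 3 s] by simp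
qed auto

definition base :: "nat \<Rightarrow> nat \<Rightarrow> (nat \<Rightarrow> nat) \<Rightarrow> state \<Rightarrow> bool" where
  "base n k inp s \<longleftrightarrow> fst s 0 = n \<and> fst s 1 = k \<and> fst s 2 = 8 ^ k \<and> fst s 3 = 3 + n * n \<and>
     (\<forall>a < 3 + n * n. snd s a = inp a)"

lemma base_sem: "base n k inp s \<Longrightarrow> wfs d c \<Longrightarrow> base n k inp (sem c s)"
  unfolding base_def using sem_frame_reg[of d c] sem_input[of d c] by simp

lemma base_upd: "base n k inp s \<Longrightarrow> 3 < x \<Longrightarrow> base n k inp (upd x v s)"
  unfolding base_def by simp

lemma index_less:
  assumes "u < n" "v < (n::nat)"
  shows "n * u + v < n * n"
proof -
  have "n * u + v < n * (u + 1)" using assms by simp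
  also have "\<dots> \<le> n * n" using assms by (intro mult_le_mono2) simp
  finally show ?thesis .
qed

lemma base_adj: "base n k inp s \<Longrightarrow> adj s = edge n inp"
  unfolding base_def edge_def fun_eq_iff using index_less by auto

lemma base_edge: "base n k inp s \<Longrightarrow> edge n (snd s) = edge n inp"
  using base_adj unfolding base_def by auto

lemma sem_For_invariant:
  assumes "I 0 s" "\<And>i s'. i < fst s b \<Longrightarrow> I i s' \<Longrightarrow> I (Suc i) (sem c (upd x i s'))"
  shows "I (fst s b) (sem (For x b c) s)"
proof -
  have "m \<le> fst s b \<Longrightarrow> I m (fold (\<lambda>i s. sem c (upd x i s)) [0..<m] s)" for m
    by (induction m) (use assms in auto)
  then show ?thesis by simp
qed

text \<open>Searching each coordinate with the earlier ones fixed yields the lexicographically least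
  obstruction; this canonical choice is what makes program and \<open>pick\<close> agree.\<close>

lemma xval_pick:
  fixes s
  defines "n \<equiv> fst s 0" and "E \<equiv> adj s" and "S \<equiv> support (ar s 0)"
  assumes not_clean: "\<not> clean n E S" and pick: "pick n E S = (a, b, c, d)"
  shows "xval (MuE 10 (ExE 11 (ExE 12 (ExE 13 obsE)))) s = a"
    and "fst s 10 = a \<Longrightarrow> xval (MuE 11 (ExE 12 (ExE 13 obsE))) s = b"
    and "fst s 10 = a \<Longrightarrow> fst s 11 = b \<Longrightarrow> xval (MuE 12 (ExE 13 obsE)) s = c"
    and "fst s 10 = a \<Longrightarrow> fst s 11 = b \<Longrightarrow> fst s 12 = c \<Longrightarrow> xval (MuE 13 obsE) s = d"
proof -
  note o = pick_obstruction[OF not_clean pick]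
  have p: "a = (LEAST a. a < n \<and> (\<exists>b<n. \<exists>c<n. \<exists>d<n. obstruction n E S a b c d))"
    "b = (LEAST b. b < n \<and> (\<exists>c<n. \<exists>d<n. obstruction n E S a b c d))"
    "c = (LEAST c. c < n \<and> (\<exists>d<n. obstruction n E S a b c d))"
    "d = (LEAST d. d < n \<and> obstruction n E S a b c d)"
    using pick unfolding pick_def Let_def by auto
  show "xval (MuE 10 (ExE 11 (ExE 12 (ExE 13 obsE)))) s = a"
    by (subst p(1), unfold n_def, rule xval_MuE) (use o in \<open>auto simp: n_def E_def S_def\<close>)
  show "xval (MuE 11 (ExE 12 (ExE 13 obsE))) s = b" if "fst s 10 = a"
    by (subst p(2), unfold n_def, rule xval_MuE) (use o that in \<open>auto simp: n_def E_def S_def\<close>)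
  show "xval (MuE 12 (ExE 13 obsE)) s = c" if "fst s 10 = a" "fst s 11 = b"
    by (subst p(3), unfold n_def, rule xval_MuE) (use o that in \<open>auto simp: n_def E_def S_def\<close>)
  show "xval (MuE 13 obsE) s = d" if "fst s 10 = a" "fst s 11 = b" "fst s 12 = c"
    by (subst p(4), unfold n_def, rule xval_MuE) (use o that in \<open>auto simp: n_def E_def S_def\<close>)
qed

lemma eight_times: "8 * v = v + v + (v + v) + (v + v + (v + v))" for v :: nat
  by simp

text \<open>If \<open>S\<close> is clean, the registers 10 to 13 hold meaningless values, but then
  both arrays get their old entry written back, whatever the index \<open>z\<close> is.\<close>

lemma sem_stepS:
  assumes "fst s 7 \<le> fst s 2"
  shows "(ar (sem stepS s) 0, ar (sem stepS s) 1) =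
      branch_step (fst s 0) (adj s) (fst s 9) (fst s 8) (fst s 7 mod 8) (ar s 0, ar s 1)"
    and "fst (sem stepS s) 7 = fst s 7 div 8" and "fst (sem stepS s) 8 = 2 * fst s 8"
proof -
  define n E S where "n = fst s 0" and "E = adj s" and "S = support (ar s 0)"
  define q where "q = fst s 7 mod 8"
  define a1 where "a1 = upd 24 (xval cleanE s) s"
  define a2 where "a2 = upd 10 (xval (MuE 10 (ExE 11 (ExE 12 (ExE 13 obsE)))) a1) a1"
  define a3 where "a3 = upd 11 (xval (MuE 11 (ExE 12 (ExE 13 obsE))) a2) a2"
  define a4 where "a4 = upd 12 (xval (MuE 12 (ExE 13 obsE)) a3) a3"
  define a5 where "a5 = upd 13 (xval (MuE 13 obsE) a4) a4"
  define a6 where "a6 = upd 25 (xval div8E a5) a5"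
  define a7 where "a7 = upd 15 q a6"
  define a8 where "a8 = upd 27 (if 3 < q then q - 4 else q) a7"
  define z where "z = sel (fst a8 27) (fst a8 10, fst a8 11, fst a8 12, fst a8 13)"
  define a9 where "a9 = upd 14 z a8"
  define w where "w = (ar s 0)(z := if clean n E S then ar s 0 z else fst s 9 + fst s 8)"
  define h where "h = (ar s 1)(z := if clean n E S then ar s 1 z else q - 3)"
  define b1 where "b1 = sem (Put 0 (Var 14) (Cnd (Var 24) (ArrE 0 (Var 14)) (Add (Var 9) (Var 8)))) a9"
  define b2 where "b2 = sem (Put 1 (Var 14) (Cnd (Var 24) (ArrE 1 (Var 14)) (Sub (Var 15) (Lit 3)))) b1"
  have d8: "xval div8E a5 = fst s 7 div 8"
  proof -
    have "fst a5 7 = fst s 7" "fst a5 2 = fst s 2"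
      by (simp_all add: a5_def a4_def a3_def a2_def a1_def)
    then show ?thesis using xval_div8E[of a5] assms by simp
  qed
  then have a6: "a6 = upd 25 (fst s 7 div 8) a5" by (simp only: a6_def)
  have mod8: "q = fst s 7 - 8 * (fst s 7 div 8)"
    unfolding q_def by (simp add: minus_mult_div_eq_mod)
  have snd9: "snd a9 = snd s" and regs: "\<And>x. x \<in> {0,1,2,3,7,8,9} \<Longrightarrow> fst a9 x = fst s x"
    and r24: "0 < fst a9 24 \<longleftrightarrow> clean n E S" and r14: "fst a9 14 = z" and r15: "fst a9 15 = q"
    and r25: "fst a9 25 = fst s 7 div 8"
    unfolding a9_def a8_def a7_def a6 a5_def a4_def a3_def a2_def a1_def n_def E_def S_def by auto
  have ar9: "ar a9 j = ar s j" for j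
    using snd9 regs[of 3] by (simp add: ar_def fun_eq_iff)
  have sem: "sem stepS s = upd 7 (fst b2 25) (upd 8 (fst b2 8 + fst b2 8) b2)"
  proof -
    have sets: "sem (Set 24 cleanE) s = a1"
      "sem (Set 10 (MuE 10 (ExE 11 (ExE 12 (ExE 13 obsE))))) a1 = a2"
      "sem (Set 11 (MuE 11 (ExE 12 (ExE 13 obsE)))) a2 = a3"
      "sem (Set 12 (MuE 12 (ExE 13 obsE))) a3 = a4"
      "sem (Set 13 (MuE 13 obsE)) a4 = a5"
      "sem (Set 25 div8E) a5 = a6"
      by (simp_all only: sem.simps a1_def a2_def a3_def a4_def a5_def a6_def)
    have "fst a6 7 = fst s 7" "fst a6 25 = fst s 7 div 8"
      unfolding a6 by (simp_all add: a5_def a4_def a3_def a2_def a1_def)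
    then have 7: "sem (Set 15 (Sub (Var 7) (Add (Add (Add (Var 25) (Var 25)) (Add (Var 25) (Var 25)))
       (Add (Add (Var 25) (Var 25)) (Add (Var 25) (Var 25)))))) a6 = a7"
      unfolding a7_def mod8 eight_times by (simp add: upd_def)
    have 8: "sem (Set 27 (Cnd (LtE (Lit 3) (Var 15)) (Sub (Var 15) (Lit 4)) (Var 15))) a7 = a8"
      by (simp add: a7_def a8_def)
    have 9: "sem (Set 14 (Cnd (EqE (Var 27) (Lit 0)) (Var 10) (Cnd (EqE (Var 27) (Lit 1)) (Var 11)
       (Cnd (EqE (Var 27) (Lit 2)) (Var 12) (Var 13))))) a8 = a9"
      by (simp add: z_def a9_def sel_def)
    show ?thesis
      by (simp only: stepS_def sem.simps(3) sets 7 8 9 b1_def[symmetric] b2_def[symmetric]) simp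
  qed
  have fst2: "fst b2 = fst a9" unfolding b2_def b1_def by simp
  have ar1: "ar b1 0 = w" "ar b1 1 = ar s 1"
    unfolding b1_def
    using ar9 r24 r14 regs by (simp_all add: ar_sem_Put w_def del: sem.simps)
  have fst1: "fst b1 = fst a9" unfolding b1_def by simp
  have ar2: "ar b2 0 = w" "ar b2 1 = h"
    unfolding b2_def
    using ar1 r24 r14 r15 by (simp_all add: ar_sem_Put h_def fst1 del: sem.simps)
  show "fst (sem stepS s) 7 = fst s 7 div 8" "fst (sem stepS s) 8 = 2 * fst s 8"
    unfolding sem by (simp_all add: fst2 r25 regs)
  have "(ar (sem stepS s) 0, ar (sem stepS s) 1) = (w, h)"
    unfolding sem using ar2 by simp
  also have "\<dots> = branch_step n E (fst s 9) (fst s 8) q (ar s 0, ar s 1)"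
  proof (cases "clean n E S")
    case True
    then show ?thesis unfolding w_def h_def branch_step_def S_def by simp
  next
    case False
    obtain a b c d where pick: "pick n E S = (a, b, c, d)" by (metis prod_cases4)
    note xp = xval_pick[of t a b c d for t]
    have "fst a2 10 = a"
      using xp(1)[of a1] False pick unfolding a2_def a1_def n_def E_def S_def by simp
    moreover from this have "fst a3 11 = b"
      using xp(2)[of a2] False pick unfolding a3_def a2_def a1_def n_def E_def S_def by simp
    moreover from calculation have "fst a4 12 = c"
      using xp(3)[of a3] False pick unfolding a4_def a3_def a2_def a1_def n_def E_def S_def by simp
    moreover from calculation have "fst a5 13 = d"
      using xp(4)[of a4] False pick unfolding a5_def a4_def a3_def a2_def a1_def n_def E_def S_def by simp
    ultimately have "z = sel (if 3 < q then q - 4 else q) (pick n E S)"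
      unfolding z_def pick by (simp add: a8_def a7_def a6_def a5_def a4_def a3_def)
    then show ?thesis using False unfolding w_def h_def branch_step_def S_def by (simp add: Let_def)
  qed
  finally show "(ar (sem stepS s) 0, ar (sem stepS s) 1) =
      branch_step (fst s 0) (adj s) (fst s 9) (fst s 8) (fst s 7 mod 8) (ar s 0, ar s 1)"
    unfolding n_def E_def q_def .
qed

declare sem.simps(4) [simp del]

section \<open>Filling arrays, the branch and the table\<close>

definition same_but :: "nat \<Rightarrow> nat \<Rightarrow> state \<Rightarrow> state \<Rightarrow> bool" where
  "same_but x j s s' \<longleftrightarrow> (\<forall>y. y \<noteq> x \<longrightarrow> fst s' y = fst s y) \<and> (\<forall>a < fst s 3. snd s' a = snd s a) \<and>
     (\<forall>j'<4. j' \<noteq> j \<longrightarrow> ar s' j' = ar s j')"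

lemma same_but_base: "base n k inp s \<Longrightarrow> 3 < x \<Longrightarrow> same_but x j s s' \<Longrightarrow> base n k inp s'"
  unfolding base_def same_but_def by auto

text \<open>\<open>R\<close> is required in every state that differs from \<open>s\<close>, among
  loop register, input and arrays, only in the loop register and array \<open>j\<close>; so entries
  filled earlier cannot influence later ones.\<close>

lemma sem_fill:
  assumes "j < 4" "3 < x" "b < 3"
    and R: "\<And>i s'. i < fst s b \<Longrightarrow> same_but x j s s' \<Longrightarrow> R i (xval e (upd x i s'))"
  defines "s' \<equiv> sem (For x b (Put j (Var x) e)) s"
  shows "\<forall>i < fst s b. R i (ar s' j i)" and "\<forall>i \<ge> fst s b. ar s' j i = ar s j i" and "same_but x j s s'"
proof -
  define I where "I m t \<longleftrightarrow> same_but x j s t \<and> (\<forall>i<m. R i (ar t j i)) \<and> (\<forall>i\<ge>m. ar t j i = ar s j i)" for m t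
  have "I (fst s b) s'"
    unfolding s'_def
  proof (rule sem_For_invariant)
    show "I 0 s" by (simp add: I_def same_but_def)
    fix i t assume i: "i < fst s b" and I: "I i t"
    let ?t = "upd x i t"
    have "fst ?t 3 = fst s 3" using I assms unfolding I_def same_but_def by auto
    then have t: "sem (Put j (Var x) e) ?t = (fst ?t, (snd ?t)(fst ?t 3 + (4 * i + j) := xval e ?t))"
      by simp
    have a: "ar (sem (Put j (Var x) e) ?t) j' = (if j' = j then (ar t j)(i := xval e ?t) else ar t j')"
      if "j' < 4" for j'
      unfolding t using ar_put[OF assms(1) that, of ?t i] assms by simp
    have "same_but x j s (sem (Put j (Var x) e) ?t)"
      using I \<open>fst ?t 3 = fst s 3\<close> a unfolding I_def same_but_def by simp
    moreover have "R i (xval e ?t)" using R[OF i] I unfolding I_def by blast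
    ultimately show "I (Suc i) (sem (Put j (Var x) e) ?t)"
      using I a[OF assms(1)] unfolding I_def by (auto simp: less_Suc_eq)
  qed
  then show "\<forall>i < fst s b. R i (ar s' j i)" "\<forall>i \<ge> fst s b. ar s' j i = ar s j i" "same_but x j s s'"
    unfolding I_def by auto
qed

lemma sem_branch:
  assumes base: "base n k inp s" and "fst s 7 < 8 ^ k"
  shows "(ar (sem (For 22 1 stepS) s) 0, ar (sem (For 22 1 stepS) s) 1) =
    branch n (edge n inp) (fst s 9) k (fst s 8) (fst s 7) (ar s 0, ar s 1)"
proof -
  \<comment> \<open>The digits still to come, applied to the present arrays, always lead to the
    final result of the whole branch.\<close>
  define I where "I i t \<longleftrightarrow> base n k inp t \<and> fst t 7 < 8 ^ k \<and> fst t 9 = fst s 9 \<and>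
    branch n (edge n inp) (fst s 9) (k - i) (fst t 8) (fst t 7) (ar t 0, ar t 1) =
    branch n (edge n inp) (fst s 9) k (fst s 8) (fst s 7) (ar s 0, ar s 1)" for i t
  have "I (fst s 1) (sem (For 22 1 stepS) s)"
  proof (rule sem_For_invariant)
    show "I 0 s" using assms by (simp add: I_def)
    fix i t assume i: "i < fst s 1" and I: "I i t"
    let ?t = "upd 22 i t"
    have b: "base n k inp ?t" using I base_upd unfolding I_def by simp
    have le: "fst ?t 7 \<le> fst ?t 2" using I b unfolding I_def base_def by simp
    have "k - i = Suc (k - Suc i)" using i base unfolding base_def by simp
    then have "branch n (edge n inp) (fst s 9) (k - Suc i) (2 * fst t 8) (fst t 7 div 8)
        (branch_step n (edge n inp) (fst s 9) (fst t 8) (fst t 7 mod 8) (ar t 0, ar t 1)) =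
      branch n (edge n inp) (fst s 9) k (fst s 8) (fst s 7) (ar s 0, ar s 1)"
      using I unfolding I_def by simp
    moreover have "branch_step n (edge n inp) (fst s 9) (fst t 8) (fst t 7 mod 8) (ar t 0, ar t 1) =
        (ar (sem stepS ?t) 0, ar (sem stepS ?t) 1)"
      using sem_stepS(1)[OF le] base_edge[OF b] b I unfolding I_def base_def by simp
    moreover have "fst (sem stepS ?t) 9 = fst t 9"
      by (subst sem_wregs) (simp_all add: stepS_def)
    moreover have "fst t 7 div 8 < 8 ^ k" using I unfolding I_def by (meson div_le_dividend le_less_trans)
    ultimately show "I (Suc i) (sem stepS ?t)"
      using I base_sem[OF b wfs_stepS] sem_stepS(2,3)[OF le] unfolding I_def by simp
  qed
  then show ?thesis using base unfolding I_def base_def by simp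
qed

lemma sem_dpS:
  assumes base: "base n k inp s" and r: "fst s 20 = r" "r < n" and w: "ar s 0 = w" and h: "ar s 1 = h"
    and graph: "sgraph n (edge n inp)" and clean: "clean n (edge n inp) (support w)"
    and sub: "support h \<subseteq> support w"
    and cur: "\<forall>x<8 ^ k. 0 < ar s 2 x \<longleftrightarrow> (\<exists>D. partial_solution n (edge n inp) (support w) (support h) w r D x)"
  shows "\<forall>x<8 ^ k. 0 < ar (sem dpS s) 2 x \<longleftrightarrow>
    (\<exists>D. partial_solution n (edge n inp) (support w) (support h) w (Suc r) D x)"
proof -
  define s1 where "s1 = sem (For 21 2 (Put 3 (Var 21) dpE)) s"
  let ?R = "\<lambda>x v. 0 < v \<longleftrightarrow> (\<exists>D. partial_solution n (edge n inp) (support w) (support h) w (Suc r) D x)"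
  have s2: "fst s 2 = 8 ^ k" using base by (simp add: base_def)
  have R: "?R x (xval dpE (upd 21 x t))" if x: "x < fst s 2" and t: "same_but 21 3 s t" for x t
  proof -
    have bt: "base n k inp (upd 21 x t)" using same_but_base[OF base _ t] base_upd by simp
    have regs: "fst (upd 21 x t) 20 = r" "fst (upd 21 x t) 21 = x" "fst (upd 21 x t) 0 = n"
      and ars: "ar (upd 21 x t) 0 = w" "ar (upd 21 x t) 1 = h" "ar (upd 21 x t) 2 = ar s 2"
      using t r w h bt unfolding same_but_def base_def by auto
    have cur': "0 < ar s 2 (x - y) \<longleftrightarrow> (\<exists>D. partial_solution n (edge n inp) (support w) (support h) w r D (x - y))" for y
      using cur x s2 by simp
    show ?thesis
      unfolding tr_dpE[of "upd 21 x t"] regs base_edge[OF bt] ars cur' cur'[of 0, simplified]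
      unfolding sgraph.partial_solution_step[OF graph clean r(2) sub] by simp
  qed
  have 1: "\<forall>x<fst s 2. ?R x (ar s1 3 x)"
    unfolding s1_def by (rule sem_fill(1)[where R = ?R]) (simp_all add: R)
  have sb: "same_but 21 3 s s1"
    unfolding s1_def by (rule sem_fill(3)[where R = ?R]) (simp_all add: R)
  have s12: "fst s1 2 = 8 ^ k" using s2 sb unfolding same_but_def by simp
  have C: "xval (ArrE 3 (Var 21)) (upd 21 x t) = ar s1 3 x" if "same_but 21 2 s1 t" for x t
    using that unfolding same_but_def by simp
  have "\<forall>x<fst s1 2. ar (sem dpS s) 2 x = ar s1 3 x"
    unfolding dpS_def sem.simps(3) s1_def[symmetric]
    by (rule sem_fill(1)[where R = "\<lambda>x v. v = ar s1 3 x"]) (simp, simp, simp, rule C)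
  then show ?thesis using 1 s2 s12 by simp
qed

lemma sem_dp_loop:
  assumes base: "base n k inp s" and w: "ar s 0 = w" and h: "ar s 1 = h"
    and graph: "sgraph n (edge n inp)" and clean: "clean n (edge n inp) (support w)"
    and sub: "support h \<subseteq> support w"
    and cur: "\<forall>x<8 ^ k. 0 < ar s 2 x \<longleftrightarrow> x = 0"
  shows "\<forall>x<8 ^ k. 0 < ar (sem (For 20 0 dpS) s) 2 x \<longleftrightarrow>
    (\<exists>D. partial_solution n (edge n inp) (support w) (support h) w n D x)"
proof -
  define I where "I r t \<longleftrightarrow> base n k inp t \<and> ar t 0 = w \<and> ar t 1 = h \<and>
    (\<forall>x<8 ^ k. 0 < ar t 2 x \<longleftrightarrow> (\<exists>D. partial_solution n (edge n inp) (support w) (support h) w r D x))" for r t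
  have "I (fst s 0) (sem (For 20 0 dpS) s)"
  proof (rule sem_For_invariant)
    show "I 0 s" using assms sgraph.partial_solution_0[OF graph clean] unfolding I_def by simp
    fix r t assume r: "r < fst s 0" and I: "I r t"
    have b: "base n k inp (upd 20 r t)" using I base_upd unfolding I_def by simp
    have "\<forall>x<8 ^ k. 0 < ar (sem dpS (upd 20 r t)) 2 x \<longleftrightarrow>
        (\<exists>D. partial_solution n (edge n inp) (support w) (support h) w (Suc r) D x)"
      by (rule sem_dpS[OF b _ _ _ _ graph clean sub]) (use I r base in \<open>simp_all add: I_def base_def\<close>)
    moreover have "ar (sem dpS (upd 20 r t)) j = ar t j" if "j < 2" for j
      by (subst sem_warrs[OF wfs_dpS]) (use that in \<open>auto simp: dpS_def\<close>)
    ultimately show "I (Suc r) (sem dpS (upd 20 r t))"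
      using I base_sem[OF b wfs_dpS] unfolding I_def by simp
  qed
  then show ?thesis using base unfolding I_def base_def by simp
qed

section \<open>One word, and all words of one length\<close>

definition outcome :: "nat \<Rightarrow> (nat \<Rightarrow> nat \<Rightarrow> bool) \<Rightarrow> nat \<Rightarrow> nat \<Rightarrow> nat set \<times> nat set" where
  "outcome n E k c =
     (case branch n E (2 ^ k) k 1 c (\<lambda>_. 0, \<lambda>_. 0) of (w, h) \<Rightarrow> (support w, support h))"

text \<open>Supports range over all indices, but the clearing loops stop below \<open>n\<close>;
  \<open>tail\<close> covers the rest and persists because \<open>S\<close> and \<open>H\<close> lie
  below \<open>n\<close>.\<close>

lemma sem_codeS:
  assumes base: "base n k inp s" and c: "fst s 6 = c" "c < 8 ^ k" and P: "fst s 9 = 2 ^ k"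
    and graph: "sgraph n (edge n inp)" and tail: "\<forall>v\<ge>n. ar s 0 v = 0 \<and> ar s 1 v = 0"
    and outcome: "outcome n (edge n inp) k c = (S, H)"
  defines "s' \<equiv> sem codeS s"
  shows "base n k inp s'" and "fst s' 9 = 2 ^ k" and "\<forall>v\<ge>n. ar s' 0 v = 0 \<and> ar s' 1 v = 0"
    and "0 < fst s' 4 \<longleftrightarrow> 0 < fst s 4 \<or> clean n (edge n inp) S"
    and "fst s' 5 = (if 0 < fst s 5 \<or> clean n (edge n inp) S \<and> inp 2 = 0 \<and>
      (\<exists>D. eds n (edge n inp) D \<and> D \<inter> S = H \<and> card D \<le> inp 1) then 1 else 0)"
proof -
  show base': "base n k inp s'" unfolding s'_def by (rule base_sem[OF base wfs_codeS])
  show "fst s' 9 = 2 ^ k"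
    unfolding s'_def using P by (subst sem_wregs) (simp_all add: codeS_def stepS_def dpS_def)
  define E where "E = edge n inp"
  define s1 where "s1 = sem (For 19 0 (Put 0 (Var 19) (Lit 0))) s"
  define s2 where "s2 = sem (For 19 0 (Put 1 (Var 19) (Lit 0))) s1"
  define s3 where "s3 = upd 8 1 (upd 7 (fst s2 6) s2)"
  define s4 where "s4 = sem (For 22 1 stepS) s3"
  define s5 where "s5 = sem (For 21 2 (Put 2 (Var 21) (EqE (Var 21) (Lit 0)))) s4"
  define s6 where "s6 = sem (For 20 0 dpS) s5"
  define s7 where "s7 = upd 24 (xval cleanE s6) s6"
  define s8 where "s8 = upd 5 (if 0 < fst s7 5 then 1 else if 0 < fst s7 24 \<and> 0 < xval acceptE s7 then 1 else 0) s7"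
  have s': "s' = upd 4 (fst s8 4 + fst s8 24) s8"
    unfolding s'_def codeS_def s8_def s7_def s6_def s5_def s4_def s3_def s2_def s1_def
    by (simp add: OrE_def upd_def cong: if_cong)
  have b1: "base n k inp s1" unfolding s1_def by (rule base_sem[OF base, where d = 28]) simp
  have b2: "base n k inp s2" unfolding s2_def by (rule base_sem[OF b1, where d = 28]) simp
  have b3: "base n k inp s3" unfolding s3_def using b2 base_upd by simp
  have b4: "base n k inp s4" unfolding s4_def by (rule base_sem[OF b3, where d = 28]) (simp add: wfs_stepS)
  have b5: "base n k inp s5" unfolding s5_def by (rule base_sem[OF b4, where d = 28]) simp
  have b6: "base n k inp s6" unfolding s6_def by (rule base_sem[OF b5, where d = 28]) (simp add: wfs_dpS)
  have b7: "base n k inp s7" unfolding s7_def using b6 base_upd by simp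
  have ar1: "ar s1 0 = (\<lambda>_. 0)" "ar s1 1 = ar s 1"
    using sem_fill[where R = "\<lambda>_ v. v = 0" and j = 0 and x = 19 and b = 0 and e = "Lit 0" and s = s] base tail
    unfolding s1_def[symmetric] base_def same_but_def by (auto simp: fun_eq_iff not_less[symmetric])
  have ar2: "ar s2 0 = (\<lambda>_. 0)" "ar s2 1 = (\<lambda>_. 0)"
    using sem_fill[where R = "\<lambda>_ v. v = 0" and j = 1 and x = 19 and b = 0 and e = "Lit 0" and s = s1] b1 tail ar1
    unfolding s2_def[symmetric] base_def same_but_def by (auto simp: fun_eq_iff not_less[symmetric])
  have "fst s2 x = fst s x" if "x \<noteq> 19" for x
    unfolding s2_def s1_def using that by (simp add: sem_wregs)
  then have r3: "fst s3 7 = c" "fst s3 8 = 1" "fst s3 9 = 2 ^ k" "fst s3 4 = fst s 4" "fst s3 5 = fst s 5"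
    using c P unfolding s3_def by simp_all
  define w h where "w = ar s4 0" and "h = ar s4 1"
  have wh: "(w, h) = branch n E (2 ^ k) k 1 c (\<lambda>_. 0, \<lambda>_. 0)"
    using sem_branch[OF b3] c(2) ar2 r3 unfolding w_def h_def s4_def E_def s3_def by simp
  then have SH: "S = support w" "H = support h"
    using outcome unfolding outcome_def E_def by (auto split: prod.splits)
  have "branch_inv n (2 ^ k) 0 (\<lambda>_. 0, \<lambda>_. 0)"
    by (simp add: branch_inv_def good_weights_def)
  then have "branch_inv n (2 ^ k) (0 + k) (w, h)"
    unfolding wh using branch_inv_branch[of n "2 ^ k" 0 _ k E c] by simp
  then have inv: "S \<subseteq> {..<n}" "card S \<le> k" "H \<subseteq> S" "good_weights (2 ^ k) k S w"
    unfolding branch_inv_def SH by (simp_all add: Let_def)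
  have ar5: "ar s5 0 = w" "ar s5 1 = h"
    unfolding s5_def w_def h_def by (subst sem_warrs[where d = 28]; simp)+
  have "fst s4 2 = 8 ^ k" using b4 by (simp add: base_def)
  then have cur: "\<forall>x<8 ^ k. 0 < ar s5 2 x \<longleftrightarrow> x = 0"
    using sem_fill(1)[where R = "\<lambda>x v. 0 < v \<longleftrightarrow> x = 0" and j = 2 and x = 21 and b = 2
      and e = "EqE (Var 21) (Lit 0)" and s = s4]
    unfolding s5_def[symmetric] by simp
  have ar6: "ar s6 0 = w" "ar s6 1 = h"
    unfolding s6_def ar5[symmetric] by (subst sem_warrs[where d = 28]; simp add: wfs_dpS; simp add: dpS_def)+
  have r6: "fst s6 x = fst s3 x" if "x \<in> {4, 5}" for x
    unfolding s6_def s5_def s4_def using that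
    by (auto simp: sem_wregs stepS_def dpS_def)
  have ar8: "ar s' 0 = w" "ar s' 1 = h"
    unfolding s' s8_def s7_def using ar6 by simp_all
  have clean7: "0 < fst s7 24 \<longleftrightarrow> clean n E S"
    unfolding s7_def using base_edge[OF b6] b6 ar6 SH unfolding E_def base_def by simp
  show "\<forall>v\<ge>n. ar s' 0 v = 0 \<and> ar s' 1 v = 0"
    unfolding ar8 using inv SH by fastforce
  have "fst s8 24 = fst s7 24" "fst s8 4 = fst s 4"
    using r6 r3 unfolding s8_def s7_def by simp_all
  then show "0 < fst s' 4 \<longleftrightarrow> 0 < fst s 4 \<or> clean n (edge n inp) S"
    unfolding s' using clean7 E_def by simp
  have acc: "0 < xval acceptE s7 \<longleftrightarrow> inp 2 = 0 \<and> (\<exists>D. eds n E D \<and> D \<inter> S = H \<and> card D \<le> inp 1)"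
    if clean: "clean n E S"
  proof -
    have "\<forall>x<8 ^ k. 0 < ar s6 2 x \<longleftrightarrow> (\<exists>D. partial_solution n E S H w n D x)"
      using sem_dp_loop[OF b5 ar5 graph _ _ cur] clean inv(3) unfolding E_def SH s6_def by blast
    moreover have "target n E H w < 8 ^ k" by (rule target_bound[OF inv(4,1,2)])
    ultimately have "0 < ar s6 2 (target n E H w) \<longleftrightarrow> (\<exists>D. partial_solution n E S H w n D (target n E H w))" by blast
    moreover have "{v. v < n \<and> 0 < h v} = H" using inv SH by auto
    moreover have "snd s7 1 = inp 1" "snd s7 2 = inp 2" "fst s7 0 = n" using b7 unfolding base_def by auto
    moreover have "ar s7 0 = w" "ar s7 1 = h" "ar s7 2 = ar s6 2" using ar6 unfolding s7_def by simp_all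
    moreover have "edge n (snd s7) = E" using base_edge[OF b7] E_def by simp
    ultimately have "0 < xval acceptE s7 \<longleftrightarrow> (\<exists>D. partial_solution n E S H w n D (target n E H w)) \<and>
        (\<forall>u<n. u \<in> S \<longrightarrow> ndom n E H u \<le> 1) \<and> card H + nreps n E S H n \<le> inp 1 \<and> inp 2 = 0"
      unfolding tr_acceptE[of s7] by (simp add: SH)
    then show ?thesis
      using sgraph.accept_iff[OF graph[folded E_def] clean inv(1,3,4), of "inp 1"] by blast
  qed
  have "fst s' 5 = (if 0 < fst s7 5 then 1 else if 0 < fst s7 24 \<and> 0 < xval acceptE s7 then 1 else 0)"
    unfolding s' s8_def by simp
  moreover have "fst s7 5 = fst s 5" using r6 r3 unfolding s7_def by simp
  ultimately show "fst s' 5 = (if 0 < fst s 5 \<or> clean n (edge n inp) S \<and> inp 2 = 0 \<and>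
      (\<exists>D. eds n (edge n inp) D \<and> D \<inter> S = H \<and> card D \<le> inp 1) then 1 else 0)"
    using clean7 acc unfolding E_def by auto
qed

section \<open>The decision procedure\<close>

lemma outcome_sound:
  assumes "outcome n E k c = (S, H)"
  shows "S \<subseteq> {..<n}" "card S \<le> k"
proof -
  obtain w h where wh: "branch n E (2 ^ k) k 1 c (\<lambda>_. 0, \<lambda>_. 0) = (w, h)" by fastforce
  have "branch_inv n (2 ^ k) 0 (\<lambda>_. 0, \<lambda>_. 0)"
    by (simp add: branch_inv_def good_weights_def)
  then have "branch_inv n (2 ^ k) (0 + k) (w, h)"
    using branch_inv_branch[of n "2 ^ k" 0 "(\<lambda>_. 0, \<lambda>_. 0)" k E c] wh by simp
  then show "S \<subseteq> {..<n}" "card S \<le> k"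
    using assms wh unfolding branch_inv_def outcome_def by (auto simp: Let_def)
qed

text \<open>\<open>D\<close> is arbitrary: an efficient dominating set yields an accepting word, and
  the empty set yields the mere existence of a clean branch.\<close>

lemma outcome_complete:
  assumes "clean n E S'" "S' \<subseteq> {..<n}" "card S' \<le> k"
  shows "\<exists>c<8 ^ k. \<exists>S. outcome n E k c = (S, D \<inter> S) \<and> clean n E S"
proof -
  have "finite S'" using assms(2) finite_subset by blast
  then show ?thesis
    using branch_complete[OF assms(1), of "\<lambda>_. 0" k "\<lambda>_. 0" D "2 ^ k" 1] assms(3)
    unfolding outcome_def by fastforce
qed

lemma sem_bodyS:
  assumes base: "base n k inp s" and graph: "sgraph n (edge n inp)"
    and tail: "\<forall>v\<ge>n. ar s 0 v = 0 \<and> ar s 1 v = 0"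
  defines "s' \<equiv> sem bodyS s"
  shows "base n k inp s'" and "\<forall>v\<ge>n. ar s' 0 v = 0 \<and> ar s' 1 v = 0"
    and "0 < fst s' 4 \<longleftrightarrow> (\<exists>S\<subseteq>{..<n}. clean n (edge n inp) S \<and> card S \<le> k)"
    and "0 < fst s' 4 \<Longrightarrow>
      fst s' 5 = (if inp 2 = 0 \<and> (\<exists>D. eds n (edge n inp) D \<and> card D \<le> inp 1) then 1 else 0)"
proof -
  define E where "E = edge n inp"
  define F where "F c \<longleftrightarrow> clean n E (fst (outcome n E k c))" for c
  define A where "A c \<longleftrightarrow> F c \<and> inp 2 = 0 \<and>
    (\<exists>D. eds n E D \<and> D \<inter> fst (outcome n E k c) = snd (outcome n E k c) \<and> card D \<le> inp 1)" for c
  define s1 where "s1 = upd 9 1 (upd 5 0 (upd 4 0 s))"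
  define s2 where "s2 = sem (For 22 1 (Set 9 (Add (Var 9) (Var 9)))) s1"
  have s': "s' = sem (For 6 2 codeS) s2"
    unfolding s'_def bodyS_def s2_def s1_def by simp
  have b1: "base n k inp s1" unfolding s1_def using base base_upd by simp
  have b2: "base n k inp s2" unfolding s2_def by (rule base_sem[OF b1, where d = 28]) simp
  have "fst s2 9 = 2 ^ fst s1 1"
    unfolding s2_def
    by (rule sem_For_invariant[where I = "\<lambda>i t. fst t 9 = 2 ^ i"]) (simp_all add: s1_def)
  then have r2: "fst s2 9 = 2 ^ k" "fst s2 4 = 0" "fst s2 5 = 0"
    using b1 unfolding base_def by (simp_all add: s2_def sem_wregs, simp_all add: s1_def)
  have tail2: "\<forall>v\<ge>n. ar s2 0 v = 0 \<and> ar s2 1 v = 0"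
    using tail unfolding s2_def by (simp add: sem_warrs[where d = 28]) (simp add: s1_def)
  define I where "I c t \<longleftrightarrow> base n k inp t \<and> fst t 9 = 2 ^ k \<and> (\<forall>v\<ge>n. ar t 0 v = 0 \<and> ar t 1 v = 0) \<and>
    (0 < fst t 4 \<longleftrightarrow> (\<exists>c'<c. F c')) \<and> fst t 5 = (if \<exists>c'<c. A c' then 1 else 0)" for c t
  have "I (fst s2 2) s'"
    unfolding s'
  proof (rule sem_For_invariant)
    show "I 0 s2" using b2 r2 tail2 by (simp add: I_def)
    fix c t assume c: "c < fst s2 2" and I: "I c t"
    let ?t = "upd 6 c t"
    have b: "base n k inp ?t" using I base_upd unfolding I_def by simp
    have c8: "c < 8 ^ k" using c b2 unfolding base_def by simp
    have p: "fst ?t 6 = c" "fst ?t 9 = 2 ^ k" "\<forall>v\<ge>n. ar ?t 0 v = 0 \<and> ar ?t 1 v = 0"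
      "fst ?t 4 = fst t 4" "fst ?t 5 = fst t 5"
      using I unfolding I_def by simp_all
    note code = sem_codeS[OF b p(1) c8 p(2) graph p(3) prod.collapse[symmetric], folded E_def]
    have "0 < fst (sem codeS ?t) 4 \<longleftrightarrow> (\<exists>c'<Suc c. F c')"
      unfolding code(4) p using I by (auto simp: I_def F_def less_Suc_eq)
    moreover have "fst (sem codeS ?t) 5 = (if \<exists>c'<Suc c. A c' then 1 else 0)"
    proof -
      have "0 < fst t 5 \<longleftrightarrow> (\<exists>c'<c. A c')" using I unfolding I_def by simp
      then show ?thesis unfolding code(5) p by (auto simp: A_def F_def less_Suc_eq)
    qed
    ultimately show "I (Suc c) (sem codeS ?t)"
      using code(1-3) unfolding I_def by blast
  qed
  then have I: "I (8 ^ k) s'" using b2 unfolding base_def by simp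
  then show "base n k inp s'" "\<forall>v\<ge>n. ar s' 0 v = 0 \<and> ar s' 1 v = 0" unfolding I_def by auto
  have found: "0 < fst s' 4 \<longleftrightarrow> (\<exists>c<8 ^ k. F c)" and ans: "fst s' 5 = (if \<exists>c<8 ^ k. A c then 1 else 0)"
    using I unfolding I_def by auto
  have F_iff: "(\<exists>c<8 ^ k. F c) \<longleftrightarrow> (\<exists>S\<subseteq>{..<n}. clean n E S \<and> card S \<le> k)"
  proof
    assume "\<exists>c<8 ^ k. F c"
    then obtain c where "clean n E (fst (outcome n E k c))" unfolding F_def by blast
    moreover have "fst (outcome n E k c) \<subseteq> {..<n}" "card (fst (outcome n E k c)) \<le> k"
      using outcome_sound[of n E k c "fst (outcome n E k c)" "snd (outcome n E k c)"] by simp_all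
    ultimately show "\<exists>S\<subseteq>{..<n}. clean n E S \<and> card S \<le> k" by (intro exI conjI)
  next
    assume "\<exists>S\<subseteq>{..<n}. clean n E S \<and> card S \<le> k"
    then obtain S' where "clean n E S'" "S' \<subseteq> {..<n}" "card S' \<le> k" by blast
    then obtain c S where "c < 8 ^ k" "outcome n E k c = (S, {} \<inter> S)" "clean n E S"
      using outcome_complete[of n E S' k "{}"] by blast
    then show "\<exists>c<8 ^ k. F c" unfolding F_def by (metis fst_conv)
  qed
  then show "0 < fst s' 4 \<longleftrightarrow> (\<exists>S\<subseteq>{..<n}. clean n (edge n inp) S \<and> card S \<le> k)"
    using found unfolding E_def by simp
  show "fst s' 5 = (if inp 2 = 0 \<and> (\<exists>D. eds n (edge n inp) D \<and> card D \<le> inp 1) then 1 else 0)"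
    if "0 < fst s' 4"
  proof -
    have "\<exists>S\<subseteq>{..<n}. clean n E S \<and> card S \<le> k"
      by (rule iffD1[OF F_iff iffD1[OF found that]])
    then obtain S' where S': "clean n E S'" "S' \<subseteq> {..<n}" "card S' \<le> k" by blast
    have "\<exists>c<8 ^ k. A c" if "inp 2 = 0" "eds n E D" "card D \<le> inp 1" for D
    proof -
      obtain c S where c: "c < 8 ^ k" "outcome n E k c = (S, D \<inter> S)" "clean n E S"
        using outcome_complete[OF S', of D] by blast
      have "A c"
        unfolding A_def F_def c(2) fst_conv snd_conv by (intro conjI exI[of _ D] c(3) that refl)
      then show ?thesis using c(1) by blast
    qed
    moreover have "inp 2 = 0" "\<exists>D. eds n E D \<and> card D \<le> inp 1" if "A c" for c
      using that unfolding A_def by auto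
    ultimately have "(\<exists>c<8 ^ k. A c) \<longleftrightarrow> inp 2 = 0 \<and> (\<exists>D. eds n E D \<and> card D \<le> inp 1)"
      by metis
    then show ?thesis unfolding ans E_def by simp
  qed
qed

section \<open>The machine program and its running time\<close>

definition baseE :: xexp where
  "baseE = Add (Lit 3) (Sum 16 0 (Var 0))"

definition search_loop :: com where
  "search_loop = While (Less (Reg 4) (Const 1))
     (Seq (compile_stm bodyS 28) (Seq (Assign 1 (Plus (Reg 1) (Const 1)))
       (Assign 2 (Plus (Plus (Plus (Reg 2) (Reg 2)) (Plus (Reg 2) (Reg 2)))
         (Plus (Plus (Reg 2) (Reg 2)) (Plus (Reg 2) (Reg 2)))))))"

definition decider :: com where
  "decider = Seq (Assign 0 (Load (Const 0))) (Seq (compile_exp baseE 28) (Seq (Assign 3 (Reg 28))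
     (Seq (Assign 2 (Const 1)) (Seq search_loop (Store (Const 0) (Reg 5))))))"

text \<open>50 exceeds the sum of the overhead 27 per round and the one-time constants, 15 in
  all.\<close>

definition decider_time :: "nat \<Rightarrow> nat" where
  "decider_time M = xtime baseE M + (stime bodyS M + 50)"

lemma decider_time_polynomial: "polynomial_bound decider_time"
  unfolding decider_time_def[abs_def]
  by (intro polynomial_bound_add polynomial_bound_const xtime_polynomial stime_polynomial)

lemma ar_agree: "agree d s s' \<Longrightarrow> 3 < d \<Longrightarrow> ar s j = ar s' j"
  by (simp add: agree_def ar_def fun_eq_iff)

lemma base_agree: "base n k inp s \<Longrightarrow> agree d s s' \<Longrightarrow> 3 < d \<Longrightarrow> base n k inp s'"
  by (auto simp: agree_def base_def)

text \<open>\<open>K\<close> is the least size of a clean set, so the rounds are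
  \<open>k = 0\<close> to \<open>K\<close>. In all of them \<open>M\<close> bounds \<open>n\<close>,
  \<open>k\<close> and \<open>8 ^ k\<close>, hence every inner loop.\<close>

lemma runs_search_loop:
  assumes base: "base n 0 inp s" and graph: "sgraph n (edge n inp)"
    and tail: "\<forall>v\<ge>n. ar s 0 v = 0 \<and> ar s 1 v = 0" and r4: "fst s 4 = 0"
    and K: "\<And>k. (\<exists>S\<subseteq>{..<n}. clean n (edge n inp) S \<and> card S \<le> k) \<longleftrightarrow> K \<le> k"
    and M: "M = n + 8 ^ K"
  shows "runs search_loop s ((K + 1) * (stime bodyS M + 27) + 4)
    (\<lambda>s'. fst s' 5 = (if inp 2 = 0 \<and> (\<exists>D. eds n (edge n inp) D \<and> card D \<le> inp 1) then 1 else 0))"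
proof -
  define I where "I k t \<longleftrightarrow> (k \<le> K \<longrightarrow> base n k inp t \<and> (\<forall>v\<ge>n. ar t 0 v = 0 \<and> ar t 1 v = 0) \<and> fst t 4 = 0) \<and>
     (K < k \<longrightarrow> 0 < fst t 4 \<and>
       fst t 5 = (if inp 2 = 0 \<and> (\<exists>D. eds n (edge n inp) D \<and> card D \<le> inp 1) then 1 else 0))" for k t
  let ?B = "Seq (compile_stm bodyS 28) (Seq (Assign 1 (Plus (Reg 1) (Const 1)))
       (Assign 2 (Plus (Plus (Plus (Reg 2) (Reg 2)) (Plus (Reg 2) (Reg 2)))
         (Plus (Plus (Reg 2) (Reg 2)) (Plus (Reg 2) (Reg 2))))))"
  have body: "runs ?B t (stime bodyS M + 24) (I (Suc k))" if k: "k < K + 1" and I: "I k t" for k t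
  proof -
    have b: "base n k inp t" and tl: "\<forall>v\<ge>n. ar t 0 v = 0 \<and> ar t 1 v = 0"
      using k I unfolding I_def by auto
    have "(8::nat) ^ k \<le> 8 ^ K" using k by (intro power_increasing) auto
    moreover have "k \<le> 8 ^ k" by (rule less_imp_le, rule less_le_trans[OF less_exp]) (simp add: power_mono)
    ultimately have "fst t 0 \<le> M" "fst t 1 \<le> M" "fst t 2 \<le> M"
      using b M unfolding base_def by linarith+
    moreover have "x = 0 \<or> x = 1 \<or> x = 2" if "x < 3" for x :: nat using that by linarith
    ultimately have bound: "\<forall>x<3. fst t x \<le> M" by metis
    note body = sem_bodyS[OF b graph tl]
    have run: "runs (compile_stm bodyS 28) t (stime bodyS M) (agree 28 (sem bodyS t))"
      by (rule compile_stm_correct[OF wfs_bodyS _ _ bound]) simp_all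
    show ?thesis
    proof (rule runs_Seq[OF run, where T' = 24])
      fix t1 assume agr: "agree 28 (sem bodyS t) t1"
      define t2 where "t2 = upd 2 (8 * fst t1 2) (upd 1 (fst t1 1 + 1) t1)"
      have b1: "base n k inp t1" using base_agree[OF body(1) agr] by simp
      have r: "fst t1 4 = fst (sem bodyS t) 4" "fst t1 5 = fst (sem bodyS t) 5"
        using agr by (simp_all add: agree_def)
      have "ar t2 j = ar (sem bodyS t) j" for j
        using ar_agree[OF agr] by (simp add: t2_def)
      moreover have "base n (Suc k) inp t2"
        using b1 unfolding t2_def base_def by simp
      moreover have "0 < fst t2 4 \<longleftrightarrow> K \<le> k"
        unfolding t2_def using r body(3) K by simp
      moreover have "fst t2 5 = (if inp 2 = 0 \<and> (\<exists>D. eds n (edge n inp) D \<and> card D \<le> inp 1) then 1 else 0)"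
        if "K \<le> k"
        unfolding t2_def using r body(3,4) K that by simp
      ultimately have "I (Suc k) t2"
        using body(2) unfolding I_def by auto
      then show "runs (Seq (Assign 1 (Plus (Reg 1) (Const 1)))
       (Assign 2 (Plus (Plus (Plus (Reg 2) (Reg 2)) (Plus (Reg 2) (Reg 2)))
         (Plus (Plus (Reg 2) (Reg 2)) (Plus (Reg 2) (Reg 2)))))) t1 24 (I (Suc k))"
        by (intro runs_Seq[where T = 4 and T' = 20 and R = "\<lambda>t. t = upd 1 (fst t1 1 + 1) t1"])
          (auto intro!: runs_Assign simp: t2_def upd_def eight_times)
    qed simp
  qed
  have "runs search_loop s ((K + 1) * (stime bodyS M + 24 + bcost (Less (Reg 4) (Const 1))) + bcost (Less (Reg 4) (Const 1)))
      (I (K + 1))"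
    unfolding search_loop_def
  proof (rule runs_While[where I = I])
    show "I 0 s" using base tail r4 by (simp add: I_def)
    show "bval (Less (Reg 4) (Const 1)) t \<and> runs ?B t (stime bodyS M + 24) (I (Suc k))" if "k < K + 1" "I k t" for k t
      using body[OF that] that by (simp add: I_def)
    show "\<not> bval (Less (Reg 4) (Const 1)) t" if "I (K + 1) t" for t
      using that by (simp add: I_def)
  qed
  then show ?thesis
    by (rule runs_mono) (auto simp: I_def add.commute)
qed

lemma halts_within_mono: "halts_within P inp T out \<Longrightarrow> T \<le> T' \<Longrightarrow> halts_within P inp T' out"
  unfolding halts_within_def using le_trans by blast

text \<open>The zero cells behind the matrix serve as initially empty arrays, which provides
  \<open>tail\<close>.\<close>

lemma halts_decider:
  assumes n: "inp 0 = n" and graph: "sgraph n (edge n inp)" and zero: "\<And>a. 3 + n * n \<le> a \<Longrightarrow> inp a = 0"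
    and K: "\<And>k. (\<exists>S\<subseteq>{..<n}. clean n (edge n inp) S \<and> card S \<le> k) \<longleftrightarrow> K \<le> k"
  shows "halts_within decider inp ((K + 1) * decider_time (n + 8 ^ K))
    (if inp 2 = 0 \<and> (\<exists>D. eds n (edge n inp) D \<and> card D \<le> inp 1) then 1 else 0)"
proof -
  define M where "M = n + 8 ^ K"
  define s1 :: state where "s1 = ((\<lambda>_. 0)(0 := n), inp)"
  have x1: "xval baseE s1 = 3 + n * n" by (simp add: baseE_def s1_def)
  have base_run: "runs (compile_exp baseE 28) s1 (xtime baseE M) (\<lambda>s'. agree 28 s1 s' \<and> fst s' 28 = 3 + n * n)"
    unfolding x1[symmetric]
    by (rule compile_exp_correct[of 28]) (simp_all add: baseE_def s1_def M_def)
  have init: "runs (Seq (Assign 3 (Reg 28)) (Seq (Assign 2 (Const 1)) (Seq search_loop (Store (Const 0) (Reg 5)))))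
      s2 (4 + ((K + 1) * (stime bodyS M + 27) + 4) + 4)
      (\<lambda>s. snd s 0 = (if inp 2 = 0 \<and> (\<exists>D. eds n (edge n inp) D \<and> card D \<le> inp 1) then 1 else 0))"
    if s2: "agree 28 s1 s2 \<and> fst s2 28 = 3 + n * n" for s2
  proof -
    define s3 where "s3 = upd 2 1 (upd 3 (3 + n * n) s2)"
    have "snd s3 = inp" using s2 by (simp add: s3_def agree_def s1_def)
    moreover have "fst s3 0 = n" "fst s3 1 = 0" "fst s3 2 = 1" "fst s3 3 = 3 + n * n" "fst s3 4 = 0"
    proof -
      have "fst s2 x = fst s1 x" if "x < 28" for x using s2 that by (simp add: agree_def)
      then show "fst s3 0 = n" "fst s3 1 = 0" "fst s3 2 = 1" "fst s3 3 = 3 + n * n" "fst s3 4 = 0"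
        by (simp_all add: s3_def s1_def)
    qed
    ultimately have s3: "base n 0 inp s3" "\<forall>v\<ge>n. ar s3 0 v = 0 \<and> ar s3 1 v = 0" "fst s3 4 = 0"
      by (simp_all add: base_def ar_def zero)
    have loop: "runs (Seq search_loop (Store (Const 0) (Reg 5))) s3 (((K + 1) * (stime bodyS M + 27) + 4) + 4)
      (\<lambda>s. snd s 0 = (if inp 2 = 0 \<and> (\<exists>D. eds n (edge n inp) D \<and> card D \<le> inp 1) then 1 else 0))"
      by (rule runs_Seq[OF runs_search_loop[OF s3(1) graph s3(2,3) K M_def], where T' = 4])
        (auto intro!: runs_Store)
    show ?thesis
    proof (rule runs_Seq[where T = 2 and R = "\<lambda>s. s = upd 3 (3 + n * n) s2"])
      show "runs (Assign 3 (Reg 28)) s2 2 (\<lambda>s. s = upd 3 (3 + n * n) s2)"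
        by (rule runs_Assign) (use s2 in \<open>auto simp: upd_def\<close>)
      show "runs (Seq (Assign 2 (Const 1)) (Seq search_loop (Store (Const 0) (Reg 5)))) s
        (2 + (((K + 1) * (stime bodyS M + 27) + 4) + 4))
        (\<lambda>s. snd s 0 = (if inp 2 = 0 \<and> (\<exists>D. eds n (edge n inp) D \<and> card D \<le> inp 1) then 1 else 0))"
        if s: "s = upd 3 (3 + n * n) s2" for s
      proof (rule runs_Seq[where T = 2 and R = "\<lambda>s. s = s3"])
        show "runs (Assign 2 (Const 1)) s 2 (\<lambda>s. s = s3)" 
          by (rule runs_Assign) (use s in \<open>auto simp: s3_def upd_def\<close>)
        show "runs (Seq search_loop (Store (Const 0) (Reg 5))) s (((K + 1) * (stime bodyS M + 27) + 4) + 4)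
          (\<lambda>s. snd s 0 = (if inp 2 = 0 \<and> (\<exists>D. eds n (edge n inp) D \<and> card D \<le> inp 1) then 1 else 0))"
          if "s = s3" for s
          unfolding that by (rule loop)
      qed (rule order_refl)
    qed simp
  qed
  have "runs decider (\<lambda>_. 0, inp) (3 + (xtime baseE M + (4 + ((K + 1) * (stime bodyS M + 27) + 4) + 4)))
      (\<lambda>s. snd s 0 = (if inp 2 = 0 \<and> (\<exists>D. eds n (edge n inp) D \<and> card D \<le> inp 1) then 1 else 0))"
    unfolding decider_def
  proof (rule runs_Seq[where T = 3 and R = "\<lambda>s. s = s1"])
    show "runs (Assign 0 (Load (Const 0))) (\<lambda>_. 0, inp) 3 (\<lambda>s. s = s1)"
      by (rule runs_Assign) (auto simp: s1_def n)
    show "runs (Seq (compile_exp baseE 28) (Seq (Assign 3 (Reg 28))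
     (Seq (Assign 2 (Const 1)) (Seq search_loop (Store (Const 0) (Reg 5)))))) s
     (xtime baseE M + (4 + ((K + 1) * (stime bodyS M + 27) + 4) + 4))
      (\<lambda>s. snd s 0 = (if inp 2 = 0 \<and> (\<exists>D. eds n (edge n inp) D \<and> card D \<le> inp 1) then 1 else 0))"
      if "s = s1" for s
      unfolding that by (rule runs_Seq[OF base_run init]) auto
  qed simp
  moreover have "3 + (xtime baseE M + (4 + ((K + 1) * (stime bodyS M + 27) + 4) + 4)) \<le> (K + 1) * decider_time M"
    unfolding decider_time_def by (simp add: algebra_simps)
  ultimately show ?thesis
    unfolding halts_within_def runs_def M_def[symmetric] by (meson le_trans)
qed

section \<open>Computability of the parameter function\<close>

primrec scale :: "nat \<Rightarrow> aexp \<Rightarrow> aexp" where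
  "scale 0 e = Const 0"
| "scale (Suc b) e = Plus (scale b e) e"

lemma aval_scale: "aval (scale b e) s = b * aval e s"
  by (induction b) auto

text \<open>\<open>B\<close> is a constant of the program, so multiplication by it is the fixed
  expression \<open>scale B\<close>.\<close>

lemma computable_exponential: "computable (\<lambda>k. A * B ^ k)"
  unfolding computable_def
proof (intro exI allI)
  fix k :: nat
  let ?b = "Less (Const 0) (Reg 0)"
  let ?c = "Seq (Assign 1 (scale B (Reg 1))) (Assign 0 (Minus (Reg 0) (Const 1)))"
  define T where "T = acost (scale B (Reg 1)) + 1 + 4"
  define I where "I i s \<longleftrightarrow> fst s 0 = k - i \<and> fst s 1 = A * B ^ i" for i and s :: state
  have step: "bval ?b s \<and> runs ?c s T (I (Suc i))" if "i < k" "I i s" for i s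
  proof
    show "bval ?b s" using that by (simp add: I_def)
    show "runs ?c s T (I (Suc i))"
      by (rule runs_Seq[where T = "acost (scale B (Reg 1)) + 1" and T' = 4
            and R = "\<lambda>s'. s' = upd 1 (B * fst s 1) s"])
        (use that in \<open>auto intro!: runs_Assign simp: T_def I_def aval_scale upd_def\<close>)
  qed
  have loop: "runs (While ?b ?c) s (k * (T + bcost ?b) + bcost ?b) (I k)" if "I 0 s" for s
    by (rule runs_While[where I = I, OF that step]) (simp_all add: I_def)
  let ?P = "Seq (Assign 0 (Load (Const 0))) (Seq (Assign 1 (Const A)) (Seq (While ?b ?c) (Store (Const 0) (Reg 1))))"
  have "runs ?P (\<lambda>_. 0, (\<lambda>_. 0)(0 := k)) (3 + (2 + ((k * (T + bcost ?b) + bcost ?b) + 3))) (\<lambda>s. snd s 0 = A * B ^ k)"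
  proof (rule runs_Seq[OF runs_Assign[where T = 3 and Q = "\<lambda>s. fst s 0 = k"]])
    fix s :: state assume s: "fst s 0 = k"
    show "runs (Seq (Assign 1 (Const A)) (Seq (While ?b ?c) (Store (Const 0) (Reg 1)))) s
        (2 + ((k * (T + bcost ?b) + bcost ?b) + 3)) (\<lambda>s. snd s 0 = A * B ^ k)"
    proof (rule runs_Seq[OF runs_Assign[where T = 2 and Q = "I 0"]])
      show "runs (Seq (While ?b ?c) (Store (Const 0) (Reg 1))) s
        ((k * (T + bcost ?b) + bcost ?b) + 3) (\<lambda>s. snd s 0 = A * B ^ k)" if "I 0 s" for s
        by (rule runs_Seq[OF loop[OF that] _ order_refl], rule runs_Store) (simp_all add: I_def)
    qed (use s in \<open>simp_all add: I_def\<close>)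
  qed simp_all
  then show "halts_within ?P ((\<lambda>_. 0)(0 := k)) (3 + (2 + ((k * (T + bcost ?b) + bcost ?b) + 3))) (A * B ^ k)"
    unfolding halts_within_def runs_def .
qed

section \<open>Encoded graphs and the time bound in terms of the parameter\<close>

lemma edge_encode_instance:
  assumes "pair_graph G" "pverts G = {..<n}"
  shows "edge n (encode_instance n (with_proj G) l) u v \<longleftrightarrow> (u, v) \<in> parcs G"
proof -
  interpret pair_graph G by (rule assms(1))
  show ?thesis
  proof (cases "u < n \<and> v < n")
    case True
    then have "n * u + v < n * n" "(n * u + v) div n = u" "(n * u + v) mod n = v"
      using index_less by auto
    then show ?thesis using True by (simp add: edge_def encode_instance_def)
  next
    case False
    then show ?thesis using in_arcsD1[of u v] in_arcsD2[of u v] assms(2) by (auto simp: edge_def)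
  qed
qed

theorem theorem1:
  shows "\<exists>(P :: com) (f :: nat \<Rightarrow> nat) (c :: nat). computable f \<and>
    (\<forall>(n :: nat) (G :: nat pair_pre_digraph) (l :: int).
       pair_graph G \<and> pverts G = {..<n} \<longrightarrow>
       decides_within P (encode_instance n (with_proj G) l)
         (f (two_ccvd (with_proj G)) * (max 1 n) ^ c)
         (\<exists>D. efficient_dominating_set (with_proj G) D \<and> int (card D) \<le> l))"
proof -
  obtain C d where time: "\<And>M. M \<ge> 1 \<Longrightarrow> decider_time M \<le> C * M ^ d"
    using decider_time_polynomial unfolding polynomial_bound_def by blast
  \<comment> \<open>With \<open>q = 8 ^ two_ccvd (with_proj G)\<close> one has
    \<open>K + 1 \<le> q\<close> and \<open>n + 8 ^ K \<le> 2 * max 1 n * q\<close>. The time is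
    then at most \<open>C * 2 ^ d * q ^ (d + 1) * max 1 n ^ d\<close>, whose part without
    \<open>n\<close> is \<open>f\<close>.\<close>
  define f where "f k = (C * 2 ^ d) * (8 ^ (d + 1)) ^ k" for k :: nat
  have "decides_within decider (encode_instance n (with_proj G) l)
         (f (two_ccvd (with_proj G)) * (max 1 n) ^ d)
         (\<exists>D. efficient_dominating_set (with_proj G) D \<and> int (card D) \<le> l)"
    if G: "pair_graph G" "pverts G = {..<n}" for n G l
  proof -
    define inp where "inp = encode_instance n (with_proj G) l"
    define E where "E = edge n inp"
    have E: "E u v \<longleftrightarrow> (u, v) \<in> parcs G" for u v
      unfolding E_def inp_def using edge_encode_instance[OF G] .
    have sg: "sgraph n E"
    proof
      interpret pair_graph G by (rule G(1))
      show "E v u" if "E u v" for u v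
        using pair_sym_arcs that unfolding E by (simp add: symmetric_def sym_def)
    qed
    \<comment> \<open>The depth at which the search stops; it enters the time bound only through
      being at most \<open>two_ccvd (with_proj G)\<close>.\<close>
    define K where "K = (LEAST k. \<exists>S\<subseteq>{..<n}. clean n E S \<and> card S \<le> k)"
    obtain S where S: "two_club_deletion_set (with_proj G) S" "card S = two_ccvd (with_proj G)"
      using two_ccvd_attained[OF G(1)] by blast
    have "S \<subseteq> {..<n}" using S(1) G(2) unfolding two_club_deletion_set_def by simp
    moreover have "clean n E S" by (rule clean_if_deletion_set[OF G E S(1)])
    ultimately have ex: "\<exists>S\<subseteq>{..<n}. clean n E S \<and> card S \<le> two_ccvd (with_proj G)"
      using S(2) by (intro exI[of _ S] conjI) simp_all
    have K_le: "K \<le> k" if "\<exists>S\<subseteq>{..<n}. clean n E S \<and> card S \<le> k" for k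
      unfolding K_def using that by (intro Least_le)
    note KT = K_le[OF ex]
    have "\<exists>S\<subseteq>{..<n}. clean n E S \<and> card S \<le> K"
      unfolding K_def by (rule LeastI_ex) (use ex in blast)
    then have K: "(\<exists>S\<subseteq>{..<n}. clean n E S \<and> card S \<le> k) \<longleftrightarrow> K \<le> k" for k
      using K_le le_trans by blast
    have halts: "halts_within decider inp ((K + 1) * decider_time (n + 8 ^ K))
        (if inp 2 = 0 \<and> (\<exists>D. eds n E D \<and> card D \<le> inp 1) then 1 else 0)"
      unfolding E_def by (rule halts_decider) (use sg K in \<open>auto simp: E_def inp_def encode_instance_def\<close>)
    have answer: "inp 2 = 0 \<and> (\<exists>D. eds n E D \<and> card D \<le> inp 1) \<longleftrightarrow>
      (\<exists>D. efficient_dominating_set (with_proj G) D \<and> int (card D) \<le> l)"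
      unfolding eds_iff[OF G E] by (auto simp: inp_def encode_instance_def)
    have time_le: "(K + 1) * decider_time (n + 8 ^ K) \<le> f (two_ccvd (with_proj G)) * (max 1 n) ^ d"
    proof -
      define q where "q = (8::nat) ^ two_ccvd (with_proj G)"
      have q: "8 ^ K \<le> q" unfolding q_def using KT by (intro power_increasing) auto
      have "K < 8 ^ K" by (rule less_le_trans[OF less_exp]) (simp add: power_mono)
      then have "K + 1 \<le> q" using q by simp
      have "n + 8 ^ K \<le> max 1 n * q + max 1 n * q"
      proof (rule add_mono)
        have "1 \<le> q" using \<open>K + 1 \<le> q\<close> by simp
        then have "max 1 n * 1 \<le> max 1 n * q" by (intro mult_left_mono) auto
        then show "n \<le> max 1 n * q" by simp
        have "1 * q \<le> max 1 n * q" by (intro mult_right_mono) auto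
        then have "q \<le> max 1 n * q" by (simp only: mult_1)
        with q show "8 ^ K \<le> max 1 n * q" by (rule le_trans)
      qed
      then have "(n + 8 ^ K) ^ d \<le> (2 * max 1 n * q) ^ d" by (intro power_mono) auto
      moreover have "decider_time (n + 8 ^ K) \<le> C * (n + 8 ^ K) ^ d"
        by (rule time) (simp add: Suc_le_eq)
      ultimately have "decider_time (n + 8 ^ K) \<le> C * (2 * max 1 n * q) ^ d"
        by (meson le_trans mult_le_mono2)
      then have "(K + 1) * decider_time (n + 8 ^ K) \<le> q * (C * (2 * max 1 n * q) ^ d)"
        using \<open>K + 1 \<le> q\<close> by (intro mult_le_mono)
      also have "\<dots> = f (two_ccvd (with_proj G)) * (max 1 n) ^ d"
      proof -
        have "(8 ^ (d + 1)) ^ two_ccvd (with_proj G) = q ^ (d + 1)"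
          unfolding q_def by (simp only: power_mult[symmetric] mult.commute)
        then show ?thesis unfolding f_def by (simp add: power_mult_distrib)
      qed
      finally show ?thesis .
    qed
    show ?thesis
      unfolding decides_within_def inp_def[symmetric]
      by (rule halts_within_mono[OF halts[unfolded answer] time_le])
  qed
  moreover have "computable f" unfolding f_def[abs_def] by (rule computable_exponential)
  ultimately show ?thesis by blast
qed

end
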